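(* Let $k$ be a field and let $G$ be a finite simple graph. Suppose that $G$ has an induced subgraph of the form $H = G_{r_1,d_1}\sqcup G_{r_2,d_2}\sqcup\cdots\sqcup G_{r_s,d_s}$, i.e., the disjoint union of $s \geq 1$ graphs of the form $G_{r,d}$, where $r_l\geq 3$ and $d_l\geq 2$ for all $l$. Then \begin{enumerate} \item[(i)] $\mathrm{reg}(I_G)\geq r_1+\cdots+r_s-s+1$, and \item[(ii)] $\mathrm{pdim}(I_G)\geq d_1+\cdots+d_s-1$. \end{enumerate}
   Context: For a finite simple graph $G$ with vertices $V(G)$ and edges $E(G)$, let $k[V(G)]$ and $k[E(G)]$ be the polynomial rings over a field $k$ whose variables are the vertices, respectively the edges, of $G$. The toric ideal $I_G \subseteq k[E(G)]$ is the kernel of the $k$-algebra homomorphism $\phi_G: k[E(G)] \to k[V(G)]$ sending the variable of each edge $e=\{x,x'\}$ to $x x'$. The ring $k[E(G)]$ is standard graded. For integers $r\geq 3$, $d \geq 2$, the graph $G_{r,d}$ has vertex set $\{x_1,x_2,y_1,\ldots,y_d,z_1,\ldots,z_{2r-3}\}$ and edges: $\{x_1,y_i\}$ and $\{x_2,y_i\}$ for $1\leq i\leq d$; $\{x_1,z_1\}$; $\{z_{i},z_{i+1}\}$ for $1\leq i\leq 2r-4$; and $\{z_{2r-3},x_2\}$. A graph $H$ is an induced subgraph of $G$ if there is a subset $W\subseteq V(G)$ with $H=(W,E(W))$, where $E(W)=\{e\in E(G)\mid e\subseteq W\}$ (here $H$ is understood up to isomorphism of graphs). For a homogeneous ideal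 $I$ of a polynomial ring $R$, $\beta_{i,j}(I)$ is the multiplicity of $R(-j)$ in homological degree $i$ of the minimal graded free resolution of $I$ (so $\beta_{0,j}(I)$ counts minimal generators of degree $j$). The Castelnuovo–Mumford regularity is $\mathrm{reg}(I)=\max\{j-i\mid\beta_{i,j}(I)\neq 0\}$ and the projective dimension is $\mathrm{pdim}(I)=\max\{i\mid\beta_{i,j}(I)\neq 0 \text{ for some } j\}$. *)

theory Defs
  imports Complex_Main "HOL-Library.Poly_Mapping" "HOL-Library.Extended_Real"
begin

section \<open>Finite simple graphs\<close>

record 'v graph =
  verts :: "'v set"
  edges :: "'v set set"

definition finite_simple_graph :: "'v graph \<Rightarrow> bool" where
  "finite_simple_graph G \<longleftrightarrow>
     finite (verts G) \<and> (\<forall>e\<in>edges G. e \<subseteq> verts G \<and> card e = 2)"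

definition graph_isomorphic :: "'v graph \<Rightarrow> 'w graph \<Rightarrow> bool" where
  "graph_isomorphic G H \<longleftrightarrow>
     (\<exists>f. bij_betw f (verts G) (verts H) \<and> (\<lambda>e. f ` e) ` edges G = edges H)"

definition induced_on :: "'v graph \<Rightarrow> 'v set \<Rightarrow> 'v graph" where
  "induced_on G W = \<lparr>verts = W, edges = {e \<in> edges G. e \<subseteq> W}\<rparr>"

definition has_induced_subgraph :: "'v graph \<Rightarrow> 'w graph \<Rightarrow> bool" where
  "has_induced_subgraph G H \<longleftrightarrow>
     (\<exists>W. W \<subseteq> verts G \<and> graph_isomorphic H (induced_on G W))"

definition disjoint_union :: "'i set \<Rightarrow> ('i \<Rightarrow> 'v graph) \<Rightarrow> ('i \<times> 'v) graph" where
  "disjoint_union L H =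
     \<lparr>verts = (\<Union>l\<in>L. Pair l ` verts (H l)),
      edges = (\<Union>l\<in>L. (\<lambda>e. Pair l ` e) ` edges (H l))\<rparr>"

datatype grd_vertex = X nat | Y nat | Z nat

text \<open>The graph is only meaningful for \<open>r \<ge> 3\<close> (so that no subtraction truncates) and \<open>d \<ge> 2\<close>.\<close>

definition grd :: "nat \<Rightarrow> nat \<Rightarrow> grd_vertex graph" where
  "grd r d =
     \<lparr>verts = {X 1, X 2} \<union> Y ` {1..d} \<union> Z ` {1..2 * r - 3},
      edges = (\<lambda>i. {X 1, Y i}) ` {1..d} \<union> (\<lambda>i. {X 2, Y i}) ` {1..d}
            \<union> {{X 1, Z 1}} \<union> (\<lambda>i. {Z i, Z (i + 1)}) ` {1..2 * r - 4}
            \<union> {{Z (2 * r - 3), X 2}}\<rparr>"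

section \<open>Polynomial rings and toric ideals\<close>

type_synonym ('x, 'k) mpoly = "('x \<Rightarrow>\<^sub>0 nat) \<Rightarrow>\<^sub>0 'k"

definition Var :: "'x \<Rightarrow> ('x, 'k::field) mpoly" where
  "Var x = Poly_Mapping.single (Poly_Mapping.single x 1) 1"

definition Const :: "'k::field \<Rightarrow> ('x, 'k) mpoly" where
  "Const c = Poly_Mapping.single 0 c"

text \<open>\<open>poly_ring S\<close> is \<open>k[S]\<close>, as a subring of the polynomial ring on all elements of
  the type \<open>'x\<close>.\<close>

definition poly_ring :: "'x set \<Rightarrow> ('x, 'k::field) mpoly set" where
  "poly_ring S = {p. \<forall>m\<in>Poly_Mapping.keys p. Poly_Mapping.keys m \<subseteq> S}"

text \<open>The \<open>k\<close>-algebra homomorphism that sends each variable \<open>x\<close> to \<open>f x\<close>.\<close>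

definition poly_subst ::
    "('x \<Rightarrow> ('y, 'k::field) mpoly) \<Rightarrow> ('x, 'k) mpoly \<Rightarrow> ('y, 'k) mpoly" where
  "poly_subst f p =
     (\<Sum>m\<in>Poly_Mapping.keys p.
        Const (Poly_Mapping.lookup p m) * (\<Prod>x\<in>Poly_Mapping.keys m. f x ^ Poly_Mapping.lookup m x))"

text \<open>Edges are themselves the variables of \<open>k[E(G)]\<close>.\<close>

definition toric_ideal :: "'v graph \<Rightarrow> ('v set, 'k::field) mpoly set" where
  "toric_ideal G =
     {p \<in> poly_ring (edges G). poly_subst (\<lambda>e. \<Prod>v\<in>e. Var v) p = 0}"

definition mdeg :: "('x \<Rightarrow>\<^sub>0 nat) \<Rightarrow> nat" where
  "mdeg m = (\<Sum>x\<in>Poly_Mapping.keys m. Poly_Mapping.lookup m x)"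

section \<open>Minimal graded free resolutions\<close>

text \<open>
  A record encodes a complex
  \<open>\<dots> \<rightarrow> F\<^sub>2 \<rightarrow> F\<^sub>1 \<rightarrow> F\<^sub>0 \<rightarrow> R\<close> of finitely generated graded free modules with chosen bases:
  \<open>F\<^sub>i\<close> is the direct sum of \<open>R(-shift i b)\<close> over \<open>b < rank i\<close>, the map \<open>F\<^sub>0 \<rightarrow> R\<close> sends the
  \<open>b\<close>-th basis element to \<open>aug b\<close>, and \<open>diff i a b\<close> is the entry in row \<open>a\<close> and column \<open>b\<close> of
  the matrix of \<open>F\<^bsub>i+1\<^esub> \<rightarrow> F\<^sub>i\<close>. Natural number shifts suffice: no negative degree can occur in
  a minimal resolution of an ideal.
\<close>

record (overloaded) ('x, 'k) free_complex =
  rank :: "nat \<Rightarrow> nat"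
  shift :: "nat \<Rightarrow> nat \<Rightarrow> nat"
  aug :: "nat \<Rightarrow> ('x, 'k) mpoly"
  diff :: "nat \<Rightarrow> nat \<Rightarrow> nat \<Rightarrow> ('x, 'k) mpoly"

definition free_module :: "'x set \<Rightarrow> nat \<Rightarrow> (nat \<Rightarrow> ('x, 'k::field) mpoly) set" where
  "free_module S n = {v. (\<forall>a<n. v a \<in> poly_ring S) \<and> (\<forall>a\<ge>n. v a = 0)}"

definition aug_map :: "('x, 'k::field) free_complex \<Rightarrow> (nat \<Rightarrow> ('x, 'k) mpoly) \<Rightarrow> ('x, 'k) mpoly"
  where "aug_map F v = (\<Sum>b<rank F 0. aug F b * v b)"

definition diff_map ::
    "('x, 'k::field) free_complex \<Rightarrow> nat \<Rightarrow> (nat \<Rightarrow> ('x, 'k) mpoly) \<Rightarrow> nat \<Rightarrow> ('x, 'k) mpoly"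
  where "diff_map F i v =
    (\<lambda>a. if a < rank F i then (\<Sum>b<rank F (Suc i). diff F i a b * v b) else 0)"

text \<open>Homogeneity is with respect to the standard grading; the maps have degree 0 once the
  shifts are taken into account.\<close>

definition graded_free_resolution ::
    "'x set \<Rightarrow> ('x, 'k::field) mpoly set \<Rightarrow> ('x, 'k) free_complex \<Rightarrow> bool" where
  "graded_free_resolution S I F \<longleftrightarrow>
     (\<forall>b<rank F 0. aug F b \<in> poly_ring S \<and>
        (\<forall>m\<in>Poly_Mapping.keys (aug F b). mdeg m = shift F 0 b)) \<and>
     (\<forall>i. \<forall>a<rank F i. \<forall>b<rank F (Suc i). diff F i a b \<in> poly_ring S \<and>
        (\<forall>m\<in>Poly_Mapping.keys (diff F i a b). mdeg m + shift F i a = shift F (Suc i) b)) \<and>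
     aug_map F ` free_module S (rank F 0) = I \<and>
     {v \<in> free_module S (rank F 0). aug_map F v = 0}
       = diff_map F 0 ` free_module S (rank F 1) \<and>
     (\<forall>i. {v \<in> free_module S (rank F (Suc i)). diff_map F i v = (\<lambda>_. 0)}
       = diff_map F (Suc i) ` free_module S (rank F (Suc (Suc i))))"

text \<open>Minimality: the image of \<open>F\<^bsub>i+1\<^esub>\<close> lies in \<open>M F\<^sub>i\<close>, where \<open>M\<close> is the ideal generated by
  the variables, i.e. no matrix entry has a constant term.\<close>

definition minimal_graded_free_resolution ::
    "'x set \<Rightarrow> ('x, 'k::field) mpoly set \<Rightarrow> ('x, 'k) free_complex \<Rightarrow> bool" where
  "minimal_graded_free_resolution S I F \<longleftrightarrow>
     graded_free_resolution S I F \<and>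
     (\<forall>i. \<forall>a<rank F i. \<forall>b<rank F (Suc i). Poly_Mapping.lookup (diff F i a b) 0 = 0)"

text \<open>For a finite variable set \<open>S\<close> and a homogeneous ideal \<open>I\<close> of \<open>k[S]\<close>, a minimal graded free
  resolution exists and is unique up to isomorphism, so the choice does not matter.\<close>

definition betti :: "'x set \<Rightarrow> ('x, 'k::field) mpoly set \<Rightarrow> nat \<Rightarrow> nat \<Rightarrow> nat" where
  "betti S I i j =
     (let F = (SOME F. minimal_graded_free_resolution S I F)
      in card {b. b < rank F i \<and> shift F i b = j})"

text \<open>By Hilbert's syzygy theorem only finitely many Betti numbers are nonzero, so for \<open>I \<noteq> 0\<close> the
  suprema are maxima; for \<open>I = 0\<close> both values are \<open>-\<infinity>\<close>.\<close>

definition reg :: "'x set \<Rightarrow> ('x, 'k::field) mpoly set \<Rightarrow> ereal" where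
  "reg S I = Sup {ereal (real j - real i) | i j. betti S I i j \<noteq> 0}"

definition pdim :: "'x set \<Rightarrow> ('x, 'k::field) mpoly set \<Rightarrow> ereal" where
  "pdim S I = Sup {ereal (real i) | i. \<exists>j. betti S I i j \<noteq> 0}"

end

theory Submission
  imports Defs "HOL-Computational_Algebra.Primes"
begin

text \<open>
  Write \<open>R = k[E(G)]\<close> and \<open>I = I\<^sub>G\<close>.  A single Betti number gives both bounds: with
  \<open>n = d\<^sub>1 + \<dots> + d\<^sub>s\<close> and \<open>j = \<Sum>\<^sub>l (d\<^sub>l + r\<^sub>l - 1)\<close> one has \<open>\<beta>\<^bsub>n-1,j\<^esub>(I) \<noteq> 0\<close>, and
  \<open>j - (n - 1) = \<Sum>\<^sub>l r\<^sub>l - s + 1\<close>.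

  \<^bold>\<open>From Betti numbers to Koszul homology.\<close>  Let \<open>K\<close> be the Koszul complex of all variables, and
  let \<open>y \<in> K\<^sub>n\<close> be homogeneous of degree \<open>j\<close> with \<open>\<partial>y \<in> I K\<^bsub>n-1\<^esub>\<close>.  If some graded free resolution of
  \<open>I\<close> has no generator of degree \<open>j\<close> in homological degree \<open>n - 1\<close>, then \<open>y \<in> I K\<^sub>n + \<partial>K\<^bsub>n+1\<^esub>\<close>; this is
  a diagram chase through the resolution (\<open>koszul_boundary_if_no_generator\<close>).  So it suffices to
  exhibit a \<open>y\<close> that does not lie there.

  \<^bold>\<open>The homology class.\<close>  The complex \<open>K \<otimes> R/I\<close> is graded by vertex degrees, and in degree \<open>\<alpha>\<close> it is
  the chain complex of the simplicial complex \<open>\<Delta>\<^sub>\<alpha>\<close> of all edge sets \<open>F\<close> for which \<open>\<alpha> - deg F\<close> is the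
  vertex degree of a monomial.  Only edges inside the support of \<open>\<alpha>\<close> matter, so \<open>G\<close> may be
  replaced by the induced subgraph.  For \<open>G\<^bsub>r,d\<^esub>\<close> take \<open>\<alpha> = x\<^sub>1 x\<^sub>2\<^sup>d y\<^sub>1\<dots>y\<^sub>d z\<^sub>1\<dots>z\<^bsub>2r-3\<^esub>\<close> and put
  \<open>a\<^sub>i = {x\<^sub>1, y\<^sub>i}\<close>, \<open>b\<^sub>i = {x\<^sub>2, y\<^sub>i}\<close>.  Number the edges of the path from \<open>x\<^sub>1\<close> to \<open>x\<^sub>2\<close> from \<open>0\<close>, and let \<open>Q\<close>
  and \<open>P\<close> be the even and the odd ones.  A monomial of degree \<open>\<alpha>\<close> covers every \<open>z\<^sub>i\<close> once and
  therefore contains \<open>Q\<close> or \<open>P\<close>, so the facets of \<open>\<Delta>\<^sub>\<alpha>\<close> are \<open>{b\<^sub>1, \<dots>, b\<^sub>d} \<union> Q\<close> and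
  \<open>{a\<^sub>i} \<union> {b\<^sub>t | t \<noteq> i} \<union> P\<close> for \<open>i \<le> d\<close>.  Sending \<open>Q\<close> to \<open>b\<^sub>1\<close>, and \<open>P\<close> and all \<open>a\<^sub>i\<close> to the last path edge \<open>p\<close>,
  retracts \<open>\<Delta>\<^sub>\<alpha>\<close> onto the boundary of the simplex \<open>{p, b\<^sub>1, \<dots>, b\<^sub>d}\<close>, a sphere of dimension \<open>d - 1\<close>.
  For a disjoint union of such graphs \<open>\<Delta>\<^sub>\<alpha>\<close> is a join, which retracts onto a sphere of dimension
  \<open>n - 1\<close>.  Its fundamental cycle, with coefficients lifted from \<open>R/I\<close> to \<open>R\<close>, is \<open>sphere_chain\<close>.
  It is told apart from boundaries by \<open>cocycle\<close>, the pullback of the cochain that is \<open>1\<close> on the facet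
  of the sphere consisting of all \<open>b\<^sub>i\<close> and \<open>0\<close> on the other facets.

  \<^bold>\<open>Existence of resolutions.\<close>  Betti numbers are read off a chosen minimal resolution, so one has
  to know that minimal resolutions exist.  This is Hilbert's basis theorem for graded submodules of
  free modules, derived from Dickson's lemma, together with the choice of generating sets of least
  cardinality (\<open>minimal_graded_free_resolution_exists\<close>).
\<close>

section \<open>Polynomials as finitely supported functions\<close>

abbreviation lookup where "lookup \<equiv> Poly_Mapping.lookup"
abbreviation keys where "keys \<equiv> Poly_Mapping.keys"
abbreviation single where "single \<equiv> Poly_Mapping.single"

lemma lookup_single_times_shift:
  fixes p :: "('x, 'k::field) mpoly"
  shows "lookup (single t c * p) (t + u) = c * lookup p u"
proof -
  have "lookup (single t c * p) (t + u)
      = (\<Sum>l. (c * (\<Sum>q. lookup p q when t + u = l + q)) when t = l)"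
    by (simp add: lookup_mult lookup_single when_mult)
  also have "\<dots> = c * (\<Sum>q. lookup p q when t + u = t + q)"
    by (simp add: when_def)
  also have "(\<Sum>q. lookup p q when t + u = t + q) = (\<Sum>q. lookup p q when u = q)"
    by simp
  finally show ?thesis by simp
qed

lemma keys_single_times:
  fixes p :: "('x, 'k::field) mpoly"
  shows "m \<in> keys (single t c * p) \<Longrightarrow> \<exists>u\<in>keys p. m = t + u"
  using keys_mult[of "single t c" p] by (auto split: if_splits)

lemma keys_nat_add: "keys (m + m' :: 'x \<Rightarrow>\<^sub>0 nat) = keys m \<union> keys m'"
  by (auto simp: in_keys_iff lookup_add)

lemma lookup_Var_times:
  fixes p :: "('x, 'k::field) mpoly"
  shows "lookup (Var e * p) m = (if e \<in> keys m then lookup p (m - single e 1) else 0)"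
proof (cases "e \<in> keys m")
  case True
  then have "m = single e 1 + (m - single e 1)"
    by (intro poly_mapping_eqI) (auto simp: lookup_add lookup_minus lookup_single when_def in_keys_iff)
  then show ?thesis
    using True lookup_single_times_shift[of "single e 1" "1::'k" p "m - single e 1"] by (simp add: Var_def)
next
  case False
  then have "m \<notin> keys (Var e * p)"
    unfolding Var_def using keys_single_times[of m "single e 1" 1 p] by (auto simp: keys_nat_add)
  then show ?thesis using False by (simp add: in_keys_iff)
qed

lemma poly_mapping_sum_singles:
  fixes p :: "'a \<Rightarrow>\<^sub>0 'b::comm_monoid_add"
  shows "p = (\<Sum>m\<in>keys p. single m (lookup p m))"
  by (rule poly_mapping_eqI) (auto simp: lookup_sum lookup_single when_def in_keys_iff sum.delta)

lemma keys_sum_subset: "keys (sum f A) \<subseteq> (\<Union>a\<in>A. keys (f a))"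
proof (induction A rule: infinite_finite_induct)
  case (insert x F)
  then show ?case using keys_add[of "f x" "sum f F"] by auto
qed auto

lemma keys_uminus: "keys (- p) = keys (p :: 'a \<Rightarrow>\<^sub>0 'b::ab_group_add)"
  by (auto simp: in_keys_iff)

subsection \<open>Membership in the polynomial ring\<close>

lemma poly_ring_zero [simp]: "0 \<in> poly_ring S"
  and poly_ring_one [simp]: "1 \<in> poly_ring S"
  by (auto simp: poly_ring_def)

lemma poly_ring_add: "p \<in> poly_ring S \<Longrightarrow> q \<in> poly_ring S \<Longrightarrow> p + q \<in> poly_ring S"
  using keys_add[of p q] unfolding poly_ring_def by blast

lemma poly_ring_uminus: "p \<in> poly_ring S \<Longrightarrow> - p \<in> poly_ring S"
  by (simp add: poly_ring_def keys_uminus)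

lemma poly_ring_diff: "p \<in> poly_ring S \<Longrightarrow> q \<in> poly_ring S \<Longrightarrow> p - q \<in> poly_ring S"
  using poly_ring_add[of p S "- q"] poly_ring_uminus by fastforce

lemma poly_ring_mult: "p \<in> poly_ring S \<Longrightarrow> q \<in> poly_ring S \<Longrightarrow> p * q \<in> poly_ring S"
proof -
  assume pq: "p \<in> poly_ring S" "q \<in> poly_ring S"
  have "keys m \<subseteq> S" if m: "m \<in> keys (p * q)" for m
  proof -
    obtain a b where "m = a + b" "a \<in> keys p" "b \<in> keys q" using m keys_mult[of p q] by blast
    then show ?thesis using pq by (simp add: keys_nat_add poly_ring_def)
  qed
  then show ?thesis by (simp add: poly_ring_def)
qed

lemma poly_ring_sum: "(\<And>a. a \<in> A \<Longrightarrow> f a \<in> poly_ring S) \<Longrightarrow> sum f A \<in> poly_ring S"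
  by (induction A rule: infinite_finite_induct) (auto intro: poly_ring_add)

lemma poly_ring_Var: "e \<in> S \<Longrightarrow> Var e \<in> poly_ring S"
  by (simp add: poly_ring_def Var_def)

lemma poly_ring_single: "keys m \<subseteq> S \<Longrightarrow> single m c \<in> poly_ring S"
  by (simp add: poly_ring_def)

lemma poly_ring_power_minus_one: "(- 1) ^ n \<in> poly_ring S"
  by (cases "even n") (auto intro: poly_ring_uminus)

lemmas poly_ring_intros = poly_ring_zero poly_ring_one poly_ring_add poly_ring_uminus poly_ring_diff
  poly_ring_mult poly_ring_sum poly_ring_Var poly_ring_power_minus_one

subsection \<open>Homogeneous polynomials and homogeneous components\<close>

lemma mdeg_superset: "finite A \<Longrightarrow> keys m \<subseteq> A \<Longrightarrow> mdeg m = (\<Sum>x\<in>A. lookup m x)"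
  unfolding mdeg_def by (intro sum.mono_neutral_left) (auto simp: in_keys_iff)

lemma mdeg_add: "mdeg (m + m') = mdeg m + mdeg m'"
proof -
  let ?A = "keys m \<union> keys m'"
  have "mdeg m = (\<Sum>x\<in>?A. lookup m x)" "mdeg m' = (\<Sum>x\<in>?A. lookup m' x)"
    by (intro mdeg_superset; simp)+
  moreover have "mdeg (m + m') = (\<Sum>x\<in>?A. lookup (m + m') x)"
    by (intro mdeg_superset) (auto simp: keys_nat_add)
  ultimately show ?thesis by (simp add: lookup_add sum.distrib)
qed

lemma mdeg_zero_iff [simp]: "mdeg m = 0 \<longleftrightarrow> m = 0"
  unfolding mdeg_def by (auto simp: in_keys_iff poly_mapping_eq_iff fun_eq_iff)

lemma mdeg_sum: "mdeg (sum f I) = (\<Sum>i\<in>I. mdeg (f i))"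
  by (induction I rule: infinite_finite_induct) (auto simp: mdeg_add)

lemma mdeg_single [simp]: "mdeg (single e k) = k"
  by (simp add: mdeg_def)

text \<open>The polynomial \<open>p\<close> is a degree \<open>0\<close> map from \<open>R(-t)\<close> to \<open>R(-s)\<close>.\<close>

definition homog :: "nat \<Rightarrow> nat \<Rightarrow> ('x, 'k::field) mpoly \<Rightarrow> bool" where
  "homog s t p \<longleftrightarrow> (\<forall>m\<in>keys p. mdeg m + s = t)"

lemma homog_zero [simp]: "homog s t 0"
  and homog_one: "homog s s 1"
  and homog_Var: "homog s (Suc s) (Var e)"
  by (auto simp: homog_def Var_def)

lemma homog_add: "homog s t p \<Longrightarrow> homog s t q \<Longrightarrow> homog s t (p + q)"
  using keys_add[of p q] unfolding homog_def by blast

lemma homog_uminus: "homog s t p \<Longrightarrow> homog s t (- p)"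
  by (simp add: homog_def keys_uminus)

lemma homog_sum: "(\<And>a. a \<in> A \<Longrightarrow> homog s t (f a)) \<Longrightarrow> homog s t (sum f A)"
  by (induction A rule: infinite_finite_induct) (auto intro: homog_add)

lemma homog_mult: "homog s t p \<Longrightarrow> homog t u q \<Longrightarrow> homog s u (p * q)"
proof -
  assume pq: "homog s t p" "homog t u q"
  have "mdeg m + s = u" if m: "m \<in> keys (p * q)" for m
  proof -
    obtain a b where "m = a + b" "a \<in> keys p" "b \<in> keys q" using m keys_mult[of p q] by blast
    then show ?thesis using pq by (auto simp: mdeg_add homog_def)
  qed
  then show ?thesis by (simp add: homog_def)
qed

lemma homog_power_minus_one: "homog s s ((- 1) ^ n)"
  by (cases "even n") (auto intro: homog_one homog_uminus)

definition hcomp :: "nat \<Rightarrow> nat \<Rightarrow> ('x, 'k::field) mpoly \<Rightarrow> ('x, 'k) mpoly" where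
  "hcomp s t p = (\<Sum>m\<in>{m\<in>keys p. mdeg m + s = t}. single m (lookup p m))"

lemma lookup_hcomp: "lookup (hcomp s t p) m = (if mdeg m + s = t then lookup p m else 0)"
  unfolding hcomp_def
  by (auto simp: lookup_sum lookup_single when_def in_keys_iff sum.delta)

lemma homog_hcomp: "homog s t (hcomp s t p)"
  by (auto simp: homog_def in_keys_iff lookup_hcomp split: if_splits)

lemma hcomp_homog: "homog s t p \<Longrightarrow> hcomp s t p = p"
  by (intro poly_mapping_eqI) (auto simp: homog_def in_keys_iff lookup_hcomp)

lemma hcomp_zero [simp]: "hcomp s t 0 = 0"
  by (simp add: hcomp_homog)

lemma hcomp_add: "hcomp s t (p + q) = hcomp s t p + hcomp s t q"
  by (intro poly_mapping_eqI) (auto simp: lookup_hcomp lookup_add)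

lemma hcomp_sum: "hcomp s t (sum f A) = (\<Sum>a\<in>A. hcomp s t (f a))"
  by (induction A rule: infinite_finite_induct) (auto simp: hcomp_add)

lemma hcomp_poly_ring: "p \<in> poly_ring S \<Longrightarrow> hcomp s t p \<in> poly_ring S"
  by (auto simp: poly_ring_def in_keys_iff lookup_hcomp split: if_splits)

lemma hcomp_mult:
  assumes "homog s t A"
  shows "hcomp s u (A * q) = A * hcomp t u q"
proof -
  define r where "r = q - hcomp t u q"
  have q: "q = hcomp t u q + r" by (simp add: r_def)
  have r: "mdeg m + t \<noteq> u" if "m \<in> keys r" for m
    using that by (auto simp: r_def in_keys_iff lookup_minus lookup_hcomp split: if_splits)
  have "hcomp s u (A * r) = 0"
  proof (rule poly_mapping_eqI)
    fix m
    show "lookup (hcomp s u (A * r)) m = lookup 0 m"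
    proof (cases "m \<in> keys (A * r)")
      case True
      then obtain a b where "m = a + b" "a \<in> keys A" "b \<in> keys r" using keys_mult by blast
      then show ?thesis using assms r[of b] by (auto simp: lookup_hcomp homog_def mdeg_add)
    qed (simp add: lookup_hcomp in_keys_iff)
  qed
  then have "hcomp s u (A * q) = hcomp s u (A * hcomp t u q)"
    by (subst q) (simp add: distrib_left hcomp_add)
  also have "\<dots> = A * hcomp t u q"
    using assms homog_mult homog_hcomp hcomp_homog by blast
  finally show ?thesis .
qed

lemma sum_hcomp:
  assumes "finite J" "\<And>m. m \<in> keys p \<Longrightarrow> mdeg m + s \<in> J"
  shows "(\<Sum>t\<in>J. hcomp s t p) = p"
proof (rule poly_mapping_eqI)
  fix m
  show "lookup (\<Sum>t\<in>J. hcomp s t p) m = lookup p m"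
    using assms by (cases "m \<in> keys p") (auto simp: lookup_sum lookup_hcomp sum.delta in_keys_iff)
qed

section \<open>Dickson's lemma and a monomial order\<close>

lemma nat_seq_mono_subseq:
  fixes s :: "nat \<Rightarrow> nat"
  shows "\<exists>f :: nat \<Rightarrow> nat. strict_mono f \<and> mono (\<lambda>n. s (f n))"
proof -
  obtain f where f: "strict_mono f" "monoseq (\<lambda>n. s (f n))" using seq_monosub by blast
  from f(2) consider "mono (\<lambda>n. s (f n))" | "antimono (\<lambda>n. s (f n))"
    unfolding monoseq_iff by blast
  then show ?thesis
  proof cases
    case 1 then show ?thesis using f by blast
  next
    case 2
    define k where "k = (LEAST k. \<exists>n. s (f n) = k)"
    obtain n where n: "s (f n) = k"
      using LeastI_ex[of "\<lambda>k. \<exists>n. s (f n) = k"] unfolding k_def by blast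
    have "s (f (n + i)) = k" for i
      using antimonoD[OF 2, of n "n + i"] n Least_le[of "\<lambda>k. \<exists>n. s (f n) = k" "s (f (n + i))"]
      unfolding k_def by force
    then have "mono (\<lambda>i. s (f (n + i)))" by (simp add: mono_def)
    moreover have "strict_mono (\<lambda>i. f (n + i))" using f(1) by (simp add: strict_mono_def)
    ultimately show ?thesis by (intro exI[of _ "\<lambda>i. f (n + i)"]) simp
  qed
qed

lemma dickson_subseq:
  fixes m :: "nat \<Rightarrow> 'x \<Rightarrow> nat"
  assumes "finite S"
  shows "\<exists>f :: nat \<Rightarrow> nat. strict_mono f \<and> (\<forall>x\<in>S. mono (\<lambda>n. m (f n) x))"
  using assms
proof (induction S)
  case empty
  show ?case by (intro exI[of _ id]) (auto simp: strict_mono_def)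
next
  case (insert y S)
  then obtain f :: "nat \<Rightarrow> nat"
    where f: "strict_mono f" "\<forall>x\<in>S. mono (\<lambda>n. m (f n) x)" by blast
  obtain g :: "nat \<Rightarrow> nat" where g: "strict_mono g" "mono (\<lambda>n. m (f (g n)) y)"
    using nat_seq_mono_subseq[of "\<lambda>n. m (f n) y"] by blast
  have "strict_mono (f \<circ> g)" using f(1) g(1) by (simp add: strict_mono_def)
  moreover have "mono (\<lambda>n. m (f (g n)) x)" if "x \<in> S" for x
    using f(2) that g(1) by (auto simp: mono_def strict_mono_less_eq)
  ultimately show ?case using g(2) by (intro exI[of _ "\<lambda>n. f (g n)"]) (auto simp: comp_def)
qed

text \<open>If no finite subset of \<open>L\<close> sufficed, one could pick a sequence in \<open>L\<close> in
  which no monomial divides a later one, which contradicts the existence of a subsequence that is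
  monotone in every exponent.\<close>

lemma dickson:
  fixes L :: "('x \<Rightarrow>\<^sub>0 nat) set"
  assumes "finite S" "\<And>m. m \<in> L \<Longrightarrow> keys m \<subseteq> S"
  shows "\<exists>B\<subseteq>L. finite B \<and> (\<forall>m\<in>L. \<exists>t\<in>B. \<exists>u. m = t + u)"
proof (rule ccontr)
  assume no: "\<not> ?thesis"
  have "\<exists>g :: nat \<Rightarrow> _. \<forall>n. g n \<in> L \<and> (\<forall>i<n. \<not> (\<exists>u. g n = g i + u))"
  proof -
    have step: "\<exists>m. m \<in> L \<and> (\<forall>t\<in>B. \<not> (\<exists>u. m = t + u))" if "B \<subseteq> L" "finite B" for B
      using no[unfolded not_ex, rule_format, of B] that by blast
    define nxt where "nxt B = (SOME m. m \<in> L \<and> (\<forall>t\<in>B. \<not> (\<exists>u. m = t + u)))" for B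
    define Bs where "Bs = rec_nat {} (\<lambda>_ B. insert (nxt B) B)"
    have Bs: "Bs 0 = {}" "Bs (Suc n) = insert (nxt (Bs n)) (Bs n)" for n
      by (simp_all add: Bs_def)
    have nxt: "nxt B \<in> L \<and> (\<forall>t\<in>B. \<not> (\<exists>u. nxt B = t + u))" if "B \<subseteq> L" "finite B" for B
      unfolding nxt_def by (rule someI_ex) (rule step[OF that])
    have BL: "Bs n \<subseteq> L \<and> finite (Bs n)" for n
      by (induction n) (use Bs nxt in auto)
    have mem: "nxt (Bs i) \<in> Bs n" if "i < n" for i n
      using that by (induction n) (auto simp: Bs less_Suc_eq)
    have "nxt (Bs n) \<in> L" for n using nxt BL by blast
    moreover have "\<not> (\<exists>u. nxt (Bs n) = nxt (Bs i) + u)" if "i < n" for n i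
      using nxt[of "Bs n"] BL[of n] mem[OF that] by blast
    ultimately show ?thesis by (intro exI[of _ "\<lambda>n. nxt (Bs n)"]) simp
  qed
  then obtain g :: "nat \<Rightarrow> 'x \<Rightarrow>\<^sub>0 nat" where g: "\<And>n. g n \<in> L" "\<And>n i. i < n \<Longrightarrow> \<not> (\<exists>u. g n = g i + u)" by blast
  obtain f :: "nat \<Rightarrow> nat" where f: "strict_mono f" "\<forall>x\<in>S. mono (\<lambda>n. lookup (g (f n)) x)"
    using dickson_subseq[OF assms(1), of "\<lambda>n. lookup (g n)"] by blast
  have le: "lookup (g (f 0)) x \<le> lookup (g (f 1)) x" for x
  proof (cases "x \<in> S")
    case True then show ?thesis using f(2) by (simp add: mono_def)
  next
    case False
    then have "x \<notin> keys (g (f 0))" using assms(2)[OF g(1)] by blast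
    then show ?thesis by (simp add: in_keys_iff)
  qed
  have "g (f 1) = g (f 0) + (g (f 1) - g (f 0))"
    by (intro poly_mapping_eqI) (use le in \<open>simp add: lookup_add lookup_minus\<close>)
  moreover have "f 0 < f 1" using f(1) by (simp add: strict_mono_def)
  ultimately show False using g(2) by blast
qed

text \<open>A monomial order on the terms of a free module that comes as a weight in the natural numbers:
  sending the variables to distinct primes embeds the monomials multiplicatively.\<close>

lemma monomial_weight_exists:
  fixes S :: "'x set"
  assumes "finite S"
  shows "\<exists>N :: ('x \<Rightarrow>\<^sub>0 nat) \<Rightarrow> nat.
    (\<forall>m m'. N (m + m') = N m * N m') \<and> (\<forall>m. N m > 0) \<and>
    (\<forall>m m'. keys m \<subseteq> S \<longrightarrow> keys m' \<subseteq> S \<longrightarrow> N m = N m' \<longrightarrow> m = m')"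
proof -
  obtain P :: "nat set" where P: "P \<subseteq> {p. prime p}" "finite P" "card P = card S"
    using infinite_arbitrarily_large[OF primes_infinite] by blast
  then obtain f where f: "bij_betw f S P"
    using assms by (metis finite_same_card_bij)
  define N where "N m = (\<Prod>x\<in>S. f x ^ lookup m x)" for m :: "'x \<Rightarrow>\<^sub>0 nat"
  have pr: "prime (f x)" if "x \<in> S" for x using that f P(1) by (auto simp: bij_betw_def)
  have mul: "N (m + m') = N m * N m'" for m m'
    by (simp add: N_def lookup_add power_add prod.distrib)
  have pos: "N m > 0" for m unfolding N_def
    by (intro prod_pos) (auto simp: prime_gt_0_nat dest: pr)
  have N_alt: "N m = (\<Prod>p\<in>P. p ^ lookup m (inv_into S f p))" for m
    unfolding N_def prod.reindex_bij_betw[OF f, symmetric]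
    by (auto intro!: prod.cong simp: bij_betw_inv_into_left[OF f])
  have inj: "m = m'" if "keys m \<subseteq> S" "keys m' \<subseteq> S" "N m = N m'" for m m'
  proof (rule poly_mapping_eqI)
    fix x
    show "lookup m x = lookup m' x"
    proof (cases "x \<in> S")
      case True
      have "multiplicity (f x) (N m) = lookup m x" for m
        unfolding N_alt using True f P pr
        by (subst multiplicity_prod_prime_powers)
           (auto simp: bij_betw_inv_into_left[OF f] bij_betw_def)
      then show ?thesis using that(3) by metis
    next
      case False
      then have "x \<notin> keys m" "x \<notin> keys m'" using that by auto
      then show ?thesis by (simp add: in_keys_iff)
    qed
  qed
  show ?thesis by (intro exI[of _ N] conjI allI impI) (fact mul pos inj)+
qed

section \<open>Graded submodules of free modules\<close>

definition lincomb ::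
    "nat \<Rightarrow> nat \<Rightarrow> (nat \<Rightarrow> nat \<Rightarrow> ('x, 'k::field) mpoly) \<Rightarrow> (nat \<Rightarrow> ('x, 'k) mpoly) \<Rightarrow> nat \<Rightarrow> ('x, 'k) mpoly"
  where "lincomb n N A v = (\<lambda>a. if a < n then (\<Sum>b<N. A a b * v b) else 0)"

definition vhomog :: "nat \<Rightarrow> (nat \<Rightarrow> nat) \<Rightarrow> nat \<Rightarrow> (nat \<Rightarrow> ('x, 'k::field) mpoly) \<Rightarrow> bool" where
  "vhomog n sh j v \<longleftrightarrow> (\<forall>a<n. homog (sh a) j (v a))"

definition vcomp :: "(nat \<Rightarrow> nat) \<Rightarrow> nat \<Rightarrow> (nat \<Rightarrow> ('x, 'k::field) mpoly) \<Rightarrow> nat \<Rightarrow> ('x, 'k) mpoly" where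
  "vcomp sh j v = (\<lambda>a. hcomp (sh a) j (v a))"

lemma vhomog_vcomp: "vhomog n sh j (vcomp sh j v)"
  by (simp add: vhomog_def vcomp_def homog_hcomp)

lemma lincomb_vcomp:
  assumes "\<And>a b. a < n \<Longrightarrow> b < N \<Longrightarrow> homog (sh a) (sh' b) (A a b)"
  shows "lincomb n N A (vcomp sh' j v) = vcomp sh j (lincomb n N A v)"
proof
  fix a
  have "hcomp (sh a) j (A a b * v b) = A a b * hcomp (sh' b) j (v b)" if "a < n" "b < N" for b
    using assms[OF that] by (rule hcomp_mult)
  then show "lincomb n N A (vcomp sh' j v) a = vcomp sh j (lincomb n N A v) a"
    by (auto simp: lincomb_def vcomp_def hcomp_sum)
qed

lemma lincomb_add: "lincomb n N A (\<lambda>b. u b + v b) = (\<lambda>a. lincomb n N A u a + lincomb n N A v a)"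
  by (auto simp: lincomb_def distrib_left sum.distrib)

lemma lincomb_smult: "lincomb n N A (\<lambda>b. p * v b) = (\<lambda>a. p * lincomb n N A v a)"
  by (auto simp: lincomb_def sum_distrib_left mult.left_commute intro!: sum.cong)

lemma lincomb_zero [simp]: "lincomb n N A (\<lambda>_. 0) = (\<lambda>_. 0)"
  by (auto simp: lincomb_def)

lemma lincomb_free_module:
  assumes "\<And>a b. a < n \<Longrightarrow> b < N \<Longrightarrow> A a b \<in> poly_ring S" "v \<in> free_module S N"
  shows "lincomb n N A v \<in> free_module S n"
  using assms by (auto simp: lincomb_def free_module_def intro!: poly_ring_sum poly_ring_mult)

definition graded_submodule ::
    "'x set \<Rightarrow> nat \<Rightarrow> (nat \<Rightarrow> nat) \<Rightarrow> (nat \<Rightarrow> ('x, 'k::field) mpoly) set \<Rightarrow> bool" where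
  "graded_submodule S n sh M \<longleftrightarrow> M \<subseteq> free_module S n \<and> (\<lambda>_. 0) \<in> M \<and>
     (\<forall>u\<in>M. \<forall>v\<in>M. (\<lambda>a. u a + v a) \<in> M) \<and>
     (\<forall>p\<in>poly_ring S. \<forall>v\<in>M. (\<lambda>a. p * v a) \<in> M) \<and>
     (\<forall>v\<in>M. \<forall>j. vcomp sh j v \<in> M)"

lemma
  assumes "graded_submodule S n sh M"
  shows graded_submodule_subset: "M \<subseteq> free_module S n"
    and graded_submodule_zero: "(\<lambda>_. 0) \<in> M"
    and graded_submodule_add: "u \<in> M \<Longrightarrow> v \<in> M \<Longrightarrow> (\<lambda>a. u a + v a) \<in> M"
    and graded_submodule_smult: "p \<in> poly_ring S \<Longrightarrow> v \<in> M \<Longrightarrow> (\<lambda>a. p * v a) \<in> M"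
    and graded_submodule_vcomp: "v \<in> M \<Longrightarrow> vcomp sh j v \<in> M"
  using assms by (auto simp: graded_submodule_def)

lemma graded_submodule_sum:
  assumes "graded_submodule S n sh M" "\<And>i. i \<in> J \<Longrightarrow> f i \<in> M"
  shows "(\<lambda>a. \<Sum>i\<in>J. f i a) \<in> M"
  using assms(2)
  by (induction J rule: infinite_finite_induct)
     (auto intro: graded_submodule_zero[OF assms(1)] graded_submodule_add[OF assms(1)])

definition spanned ::
    "'x set \<Rightarrow> (nat \<Rightarrow> ('x, 'k::field) mpoly) set \<Rightarrow> (nat \<Rightarrow> ('x, 'k) mpoly) set" where
  "spanned S B = {\<lambda>a. \<Sum>g\<in>B. c g * g a | c. \<forall>g\<in>B. c g \<in> poly_ring S}"

lemma spanned_add: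
  assumes "u \<in> spanned S B" "v \<in> spanned S B"
  shows "(\<lambda>a. u a + v a) \<in> spanned S B"
proof -
  obtain c c' where "u = (\<lambda>a. \<Sum>g\<in>B. c g * g a)" "v = (\<lambda>a. \<Sum>g\<in>B. c' g * g a)"
    "\<forall>g\<in>B. c g \<in> poly_ring S" "\<forall>g\<in>B. c' g \<in> poly_ring S"
    using assms by (auto simp: spanned_def)
  then show ?thesis unfolding spanned_def
    by (intro CollectI exI[of _ "\<lambda>g. c g + c' g"])
       (auto simp: distrib_right sum.distrib intro: poly_ring_add)
qed

lemma spanned_smult:
  assumes "p \<in> poly_ring S" "v \<in> spanned S B"
  shows "(\<lambda>a. p * v a) \<in> spanned S B"
proof -
  obtain c where "v = (\<lambda>a. \<Sum>g\<in>B. c g * g a)" "\<forall>g\<in>B. c g \<in> poly_ring S"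
    using assms by (auto simp: spanned_def)
  then show ?thesis unfolding spanned_def
    by (intro CollectI exI[of _ "\<lambda>g. p * c g"])
       (auto simp: sum_distrib_left mult.assoc intro: poly_ring_mult assms)
qed

lemma spanned_zero: "(\<lambda>_. 0) \<in> spanned S B"
  unfolding spanned_def by (intro CollectI exI[of _ "\<lambda>g. 0"]) auto

lemma spanned_base:
  assumes "finite B" "g \<in> B"
  shows "g \<in> spanned S B"
proof -
  have "(\<Sum>h\<in>B. (if h = g then 1 else 0) * h a) = g a" for a
    using assms by (simp add: if_distrib[of "\<lambda>x. x * _"] sum.delta cong: if_cong)
  then show ?thesis unfolding spanned_def
    by (intro CollectI exI[of _ "\<lambda>h. if h = g then 1 else 0"]) auto
qed

lemma spanned_sum:
  assumes "\<And>i. i \<in> J \<Longrightarrow> f i \<in> spanned S B"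
  shows "(\<lambda>a. \<Sum>i\<in>J. f i a) \<in> spanned S B"
  using assms
  by (induction J rule: infinite_finite_induct) (auto intro: spanned_zero spanned_add)

lemma spanned_trans:
  assumes "B \<subseteq> spanned S C" "v \<in> spanned S B"
  shows "v \<in> spanned S C"
proof -
  obtain c where v: "v = (\<lambda>a. \<Sum>g\<in>B. c g * g a)" and c: "\<forall>g\<in>B. c g \<in> poly_ring S"
    using assms by (auto simp: spanned_def)
  show ?thesis unfolding v
    by (rule spanned_sum) (use c assms(1) in \<open>auto intro: spanned_smult\<close>)
qed

text \<open>The index set consists of the degrees of the finitely many terms of \<open>v\<close>.\<close>

lemma vcomp_decomposition:
  assumes "v \<in> free_module S n"
  shows "\<exists>J. v = (\<lambda>a. \<Sum>j\<in>J. vcomp sh j v a)"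
proof -
  define J where "J = (\<Union>a<n. (\<lambda>m. mdeg m + sh a) ` keys (v a))"
  have "finite J" by (simp add: J_def)
  have "(\<Sum>j\<in>J. vcomp sh j v a) = v a" for a
  proof (cases "a < n")
    case True
    then show ?thesis unfolding vcomp_def
      by (intro sum_hcomp) (auto simp: \<open>finite J\<close>, auto simp: J_def)
  next
    case False
    then show ?thesis using assms by (simp add: vcomp_def free_module_def)
  qed
  then show ?thesis by metis
qed

section \<open>Existence of minimal graded free resolutions\<close>

text \<open>This is division with remainder.  Among the terms \<open>x\<^sup>m e\<^sub>a\<close> of a vector one is the heaviest; by Dickson's
  lemma finitely many homogeneous elements of \<open>M\<close> have leading terms that divide all leading terms
  of homogeneous elements of \<open>M\<close>.  Subtracting a multiple of one of them removes the leading
  term and keeps the vector homogeneous, and the weights decrease in the natural numbers.\<close>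

lemma graded_submodule_finitely_generated:
  fixes M :: "(nat \<Rightarrow> ('x, 'k::field) mpoly) set"
  assumes "finite S" and M: "graded_submodule S n sh M"
  shows "\<exists>B\<subseteq>M. finite B \<and> (\<forall>g\<in>B. \<exists>j. vhomog n sh j g) \<and> M \<subseteq> spanned S B"
proof -
  obtain N :: "('x \<Rightarrow>\<^sub>0 nat) \<Rightarrow> nat" where
    N_mult: "\<And>m m'. N (m + m') = N m * N m'" and N_pos: "\<And>m. N m > 0" and
    N_inj: "\<And>m m'. keys m \<subseteq> S \<Longrightarrow> keys m' \<subseteq> S \<Longrightarrow> N m = N m' \<Longrightarrow> m = m'"
    using monomial_weight_exists[OF assms(1)] by metis
  define W where "W a m = N m * n + a" for a m
  have W_le: "W a m \<le> W b m' \<longleftrightarrow> N m < N m' \<or> N m = N m' \<and> a \<le> b" if "a < n" "b < n" for a b m m'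
  proof -
    have "N m * n + a < N m' * n + b" if "N m < N m'" "a < n" for m m' a b
    proof -
      have "N m * n + a < Suc (N m) * n" using that by simp
      also have "\<dots> \<le> N m' * n" using that by (intro mult_le_mono1) simp
      finally show ?thesis by simp
    qed
    from this[of m m' a b] this[of m' m b a] that show ?thesis
      by (cases "N m" "N m'" rule: linorder_cases) (auto simp: W_def)
  qed
  have W_shift: "W a (u + m) \<le> W b (u + m')" if "W a m \<le> W b m'" "a < n" "b < n" for a b u m m'
    using that N_pos[of u] by (auto simp: W_le N_mult)
  have W_inj: "a = b \<and> m = m'" if "W a m = W b m'" "a < n" "b < n" "keys m \<subseteq> S" "keys m' \<subseteq> S" for a b m m'
  proof -
    have "N m = N m' \<and> a = b"
      using W_le[of a b m m'] W_le[of b a m' m] that(1,2,3) by auto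
    then show ?thesis using N_inj that by blast
  qed
  define lead where "lead v a m \<longleftrightarrow> a < n \<and> m \<in> keys (v a) \<and> (\<forall>b<n. \<forall>m'\<in>keys (v b). W b m' \<le> W a m)"
    for v :: "nat \<Rightarrow> ('x, 'k) mpoly" and a m
  have lead_ex: "\<exists>a m. lead v a m" if v: "v \<in> free_module S n" "v \<noteq> (\<lambda>_. 0)" for v
  proof -
    define T where "T = (SIGMA a:{..<n}. keys (v a))"
    have "finite T" by (simp add: T_def)
    obtain a where "v a \<noteq> 0" using v(2) by auto
    then obtain m where "m \<in> keys (v a)"
      by (metis in_keys_iff lookup_zero poly_mapping_eqI)
    moreover have "a < n" using v(1) \<open>v a \<noteq> 0\<close> by (metis (mono_tags, lifting) free_module_def mem_Collect_eq not_le)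
    ultimately have "(a, m) \<in> T" by (simp add: T_def)
    then have "T \<noteq> {}" by blast
    then have "Max (case_prod W ` T) \<in> case_prod W ` T" using \<open>finite T\<close> by simp
    then obtain x where x: "x \<in> T" "case_prod W x = Max (case_prod W ` T)" by force
    have "case_prod W y \<le> case_prod W x" if "y \<in> T" for y
      unfolding x(2) using that \<open>finite T\<close> by simp
    then have "lead v (fst x) (snd x)"
      using x(1) unfolding lead_def T_def by (auto simp: case_prod_beta)
    then show ?thesis by blast
  qed
  define H where "H = {v \<in> M. \<exists>j. vhomog n sh j v}"
  have HM: "v \<in> free_module S n" if "v \<in> H" for v
    using that graded_submodule_subset[OF M] by (auto simp: H_def)
  have keysS: "keys m \<subseteq> S" if "v \<in> free_module S n" "a < n" "m \<in> keys (v a)" for v a m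
    using that by (auto simp: free_module_def poly_ring_def)
  define D where "D a = {m. \<exists>v\<in>H. lead v a m}" for a
  have "\<exists>B\<subseteq>D a. finite B \<and> (\<forall>m\<in>D a. \<exists>t\<in>B. \<exists>u. m = t + u)" for a
  proof (rule dickson[OF assms(1)])
    fix m assume "m \<in> D a"
    then show "keys m \<subseteq> S" using keysS HM by (auto simp: D_def lead_def)
  qed
  then obtain F where F: "\<And>a. F a \<subseteq> D a" "\<And>a. finite (F a)"
      "\<And>a m. m \<in> D a \<Longrightarrow> \<exists>t\<in>F a. \<exists>u. m = t + u"
    by metis
  define gen where "gen a t = (SOME v. v \<in> H \<and> lead v a t)" for a t
  have gen: "gen a t \<in> H \<and> lead (gen a t) a t" if "t \<in> F a" for a t
    using someI_ex[of "\<lambda>v. v \<in> H \<and> lead v a t"] F(1)[of a] that by (auto simp: D_def gen_def)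
  define B where "B = case_prod gen ` (SIGMA a:{..<n}. F a)"
  have fB: "finite B" by (auto simp: B_def F)
  have BH: "B \<subseteq> H" using gen by (auto simp: B_def)
  have main: "v \<in> spanned S B" if "v \<in> H" "lead v a m" "W a m = w" for v a m w
    using that
  proof (induction w arbitrary: v a m rule: less_induct)
    case (less w)
    have a: "a < n" and m: "m \<in> keys (v a)"
      and mx: "\<And>b m'. b < n \<Longrightarrow> m' \<in> keys (v b) \<Longrightarrow> W b m' \<le> W a m"
      using less.prems(2) by (auto simp: lead_def)
    have "m \<in> D a" using less.prems by (auto simp: D_def)
    then obtain t u where t: "t \<in> F a" and tu: "m = t + u" using F(3) by blast
    define g where "g = gen a t"
    have gH: "g \<in> H" and gl: "lead g a t" using gen[OF t] by (auto simp: g_def)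
    have gB: "g \<in> B" using t a by (auto simp: g_def B_def)
    define c where "c = lookup (v a) m / lookup (g a) t"
    define p where "p = single u c"
    have uS: "keys u \<subseteq> S" using keysS[OF HM[OF less.prems(1)] a m] by (simp add: tu keys_nat_add)
    have pS: "p \<in> poly_ring S" unfolding p_def by (rule poly_ring_single[OF uS])
    define v' where "v' = (\<lambda>b. v b + (- p) * g b)"
    have v_eq: "v = (\<lambda>b. v' b + p * g b)" by (auto simp: v'_def)
    have v'M: "v' \<in> M" unfolding v'_def
      using less.prems(1) gH
      by (intro graded_submodule_add[OF M] graded_submodule_smult[OF M] poly_ring_uminus pS)
         (auto simp: H_def)
    have "v' \<in> H"
    proof -
      obtain j k where j: "vhomog n sh j v" and k: "vhomog n sh k g"
        using less.prems(1) gH by (auto simp: H_def)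
      have "mdeg m + sh a = j" using j a m by (auto simp: vhomog_def homog_def)
      moreover have "mdeg t + sh a = k" using k gl by (auto simp: vhomog_def homog_def lead_def)
      ultimately have "mdeg u + k = j" by (simp add: tu mdeg_add)
      then have "homog k j p" by (auto simp: homog_def p_def)
      then have "vhomog n sh j v'" using j k unfolding v'_def vhomog_def
        by (metis homog_add homog_mult homog_uminus mult.commute)
      then show ?thesis using v'M by (auto simp: H_def)
    qed
    have "v' \<in> spanned S B"
    proof (cases "v' = (\<lambda>_. 0)")
      case True
      then show ?thesis by (simp add: spanned_zero)
    next
      case False
      then obtain a' m' where l': "lead v' a' m'"
        using lead_ex HM[OF \<open>v' \<in> H\<close>] by blast
      then have a': "a' < n" and m': "m' \<in> keys (v' a')" by (auto simp: lead_def)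
      have le: "W a' m' \<le> W a m"
      proof (cases "m' \<in> keys (v a')")
        case True then show ?thesis using mx a' by blast
      next
        case False
        then have "m' \<in> keys (p * g a')"
          using m' by (auto simp: v'_def in_keys_iff lookup_add lookup_minus)
        then obtain m'' where "m'' \<in> keys (g a')" "m' = u + m''"
          unfolding p_def using keys_single_times by blast
        then have "W a' m' \<le> W a (u + t)"
          using gl a' by (auto simp: lead_def intro!: W_shift)
        then show ?thesis by (simp add: tu add.commute)
      qed
      have "W a' m' \<noteq> W a m"
      proof
        assume "W a' m' = W a m"
        then have "a' = a" "m' = m"
          using W_inj[OF _ a' a keysS[OF HM[OF \<open>v' \<in> H\<close>] a' m'] keysS[OF HM[OF less.prems(1)] a m]] by auto
        moreover have "lookup (v' a) m = 0"
        proof -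
          have "lookup (p * g a) m = c * lookup (g a) t"
            unfolding p_def tu by (subst add.commute) (rule lookup_single_times_shift)
          also have "\<dots> = lookup (v a) m"
            using gl by (simp add: c_def lead_def in_keys_iff)
          finally show ?thesis by (simp add: v'_def lookup_add lookup_minus)
        qed
        ultimately show False using m' by (simp add: in_keys_iff)
      qed
      with le have "W a' m' < w" using less.prems(3) by simp
      then show ?thesis using less.IH \<open>v' \<in> H\<close> l' by blast
    qed
    moreover have "(\<lambda>b. p * g b) \<in> spanned S B"
      by (intro spanned_smult pS spanned_base fB gB)
    ultimately show ?case by (subst v_eq) (rule spanned_add)
  qed
  have "v \<in> spanned S B" if v: "v \<in> M" for v
  proof -
    obtain J where J: "v = (\<lambda>a. \<Sum>j\<in>J. vcomp sh j v a)"
      using vcomp_decomposition graded_submodule_subset[OF M] v by blast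
    have "vcomp sh j v \<in> spanned S B" for j
    proof (cases "vcomp sh j v = (\<lambda>_. 0)")
      case True
      then show ?thesis by (simp add: spanned_zero)
    next
      case False
      have "vcomp sh j v \<in> H"
        using graded_submodule_vcomp[OF M v, of j] vhomog_vcomp[of n sh j v] by (auto simp: H_def)
      then show ?thesis using main lead_ex HM False by blast
    qed
    then show ?thesis by (subst J) (rule spanned_sum)
  qed
  then show ?thesis using fB BH by (intro exI[of _ B]) (auto simp: H_def)
qed

lemma graded_submodule_kernel:
  assumes "\<And>a b. a < n \<Longrightarrow> b < N \<Longrightarrow> homog (sh a) (sh' b) (A a b)"
  shows "graded_submodule S N sh' {v \<in> free_module S N. lincomb n N A v = (\<lambda>_. 0)}"
proof -
  have "lincomb n N A (vcomp sh' j v) = (\<lambda>_. 0)" if "lincomb n N A v = (\<lambda>_. 0)" for j v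
    using lincomb_vcomp[of n N sh sh' A j v] assms that by (simp add: vcomp_def)
  then show ?thesis
    by (auto simp: graded_submodule_def lincomb_add lincomb_smult free_module_def
          intro!: poly_ring_add poly_ring_mult)
       (auto simp: vcomp_def intro: hcomp_poly_ring)
qed

text \<open>A homogeneous generating set of least cardinality has no syzygy with
  an invertible entry, because such a syzygy, cut down to the degree of that entry, would express
  one of the generators by the others.\<close>

lemma minimal_presentation:
  fixes M :: "(nat \<Rightarrow> ('x, 'k::field) mpoly) set"
  assumes "finite S" and M: "graded_submodule S n sh M"
  shows "\<exists>N sh' A. (\<forall>a<n. \<forall>b<N. A a b \<in> poly_ring S \<and> homog (sh a) (sh' b) (A a b)) \<and>
    lincomb n N A ` free_module S N = M \<and>
    (\<forall>v\<in>free_module S N. lincomb n N A v = (\<lambda>_. 0) \<longrightarrow> (\<forall>b<N. lookup (v b) 0 = 0))"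
proof -
  define P where "P B \<longleftrightarrow> B \<subseteq> M \<and> finite B \<and> (\<forall>g\<in>B. \<exists>j. vhomog n sh j g) \<and> M \<subseteq> spanned S B" for B
  obtain B0 where "P B0" using graded_submodule_finitely_generated[OF assms] by (auto simp: P_def)
  then obtain B where "P B" and least: "\<And>C. P C \<Longrightarrow> card B \<le> card C"
    using ex_has_least_nat[of P B0 card] by blast
  then have B: "B \<subseteq> M" "finite B" "M \<subseteq> spanned S B" and "\<forall>g\<in>B. \<exists>j. vhomog n sh j g"
    by (auto simp: P_def)
  define N where "N = card B"
  obtain h where h: "bij_betw h {..<N} B"
    using ex_bij_betw_nat_finite[OF \<open>finite B\<close>] by (auto simp: N_def lessThan_atLeast0)
  have hB: "h b \<in> B" if "b < N" for b using h that by (auto simp: bij_betw_def)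
  have "\<exists>j. b < N \<longrightarrow> vhomog n sh j (h b)" for b
    using \<open>\<forall>g\<in>B. \<exists>j. vhomog n sh j g\<close> hB by blast
  then obtain sh' where sh': "\<And>b. b < N \<Longrightarrow> vhomog n sh (sh' b) (h b)" by metis
  define A where "A a b = h b a" for a b
  have A_hom: "homog (sh a) (sh' b) (A a b)" if "a < n" "b < N" for a b
    using sh' that by (simp add: A_def vhomog_def)
  have hF: "h b \<in> free_module S n" if "b < N" for b
    using hB[OF that] B(1) graded_submodule_subset[OF M] by blast
  have A_ring: "A a b \<in> poly_ring S" if "a < n" "b < N" for a b
    using hF[OF that(2)] that(1) by (simp add: A_def free_module_def)
  have lin: "lincomb n N A v = (\<lambda>a. \<Sum>b<N. v b * h b a)" for v
  proof
    fix a
    show "lincomb n N A v a = (\<Sum>b<N. v b * h b a)"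
      using hF by (auto simp: lincomb_def A_def mult.commute free_module_def)
  qed
  have "lincomb n N A ` free_module S N = M"
  proof (intro equalityI subsetI)
    fix x assume "x \<in> lincomb n N A ` free_module S N"
    then obtain v where v: "v \<in> free_module S N" "x = (\<lambda>a. \<Sum>b<N. v b * h b a)" by (auto simp: lin)
    show "x \<in> M" unfolding v(2)
      using v(1) hB B(1)
      by (intro graded_submodule_sum[OF M] graded_submodule_smult[OF M]) (auto simp: free_module_def)
  next
    fix x assume "x \<in> M"
    then obtain c where c: "\<forall>g\<in>B. c g \<in> poly_ring S" "x = (\<lambda>a. \<Sum>g\<in>B. c g * g a)"
      using B(3) by (auto simp: spanned_def)
    define v where "v b = (if b < N then c (h b) else 0)" for b
    have "v \<in> free_module S N" using c(1) hB by (auto simp: v_def free_module_def)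
    moreover have "lincomb n N A v = x"
    proof
      fix a
      have "(\<Sum>b<N. v b * h b a) = (\<Sum>b<N. c (h b) * h b a)" by (simp add: v_def)
      also have "\<dots> = x a" unfolding c(2) by (rule sum.reindex_bij_betw[OF h])
      finally show "lincomb n N A v a = x a" by (simp add: lin)
    qed
    ultimately show "x \<in> lincomb n N A ` free_module S N" by blast
  qed
  moreover have "lookup (v b0) 0 = 0"
    if v: "v \<in> free_module S N" "lincomb n N A v = (\<lambda>_. 0)" "b0 < N" for v b0
  proof (rule ccontr)
    define c where "c = lookup (v b0) 0"
    assume "lookup (v b0) 0 \<noteq> 0"
    then have "c \<noteq> 0" by (simp add: c_def)
    define w where "w = vcomp sh' (sh' b0) v"
    have "w b0 = single 0 c"
      by (rule poly_mapping_eqI)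
         (auto simp: w_def vcomp_def lookup_hcomp c_def lookup_single when_def)
    have "w \<in> {v \<in> free_module S N. lincomb n N A v = (\<lambda>_. 0)}"
      unfolding w_def using v A_hom
      by (intro graded_submodule_vcomp[OF graded_submodule_kernel[of n N sh]]) auto
    then have w: "w \<in> free_module S N" "\<And>a. (\<Sum>b<N. w b * h b a) = 0"
      by (auto simp: lin fun_eq_iff)
    define C where "C = B - {h b0}"
    have "h b0 = (\<lambda>a. \<Sum>b\<in>{..<N} - {b0}. (- single 0 (inverse c) * w b) * h b a)"
    proof
      fix a
      have "0 = single 0 (inverse c) * (\<Sum>b<N. w b * h b a)" by (simp add: w)
      also have "(\<Sum>b<N. w b * h b a) = w b0 * h b0 a + (\<Sum>b\<in>{..<N} - {b0}. w b * h b a)"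
        using v(3) by (subst sum.remove[of _ b0]) auto
      also have "single 0 (inverse c) * (w b0 * h b0 a + (\<Sum>b\<in>{..<N} - {b0}. w b * h b a))
          = h b0 a + single 0 (inverse c) * (\<Sum>b\<in>{..<N} - {b0}. w b * h b a)"
        using \<open>c \<noteq> 0\<close> by (simp add: \<open>w b0 = _\<close> distrib_left mult.assoc[symmetric] mult_single)
      finally show "h b0 a = (\<Sum>b\<in>{..<N} - {b0}. (- single 0 (inverse c) * w b) * h b a)"
        by (simp add: sum_distrib_left sum_negf mult.assoc eq_neg_iff_add_eq_0)
    qed
    also have "\<dots> \<in> spanned S C"
    proof (intro spanned_sum spanned_smult)
      fix b assume b: "b \<in> {..<N} - {b0}"
      then show "- single 0 (inverse c) * w b \<in> poly_ring S"
        using w(1) by (intro poly_ring_mult poly_ring_uminus poly_ring_single) (auto simp: free_module_def)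
      have "h b \<in> C" using b hB h v(3) by (auto simp: C_def bij_betw_def inj_on_def)
      then show "h b \<in> spanned S C" using \<open>finite B\<close> by (intro spanned_base) (auto simp: C_def)
    qed
    finally have "h b0 \<in> spanned S C" .
    moreover have "g \<in> spanned S C" if "g \<in> B" "g \<noteq> h b0" for g
      using \<open>finite B\<close> that by (intro spanned_base) (auto simp: C_def)
    ultimately have "B \<subseteq> spanned S C" by blast
    then have "P C" using \<open>P B\<close> spanned_trans unfolding P_def C_def by blast
    moreover have "card C < card B"
      unfolding C_def using hB[OF v(3)] \<open>finite B\<close> by (intro card_Diff1_less)
    ultimately show False using least by fastforce
  qed
  ultimately show ?thesis
    by (intro exI[of _ N] exI[of _ sh'] exI[of _ A]) (use A_hom A_ring in auto)
qed

text \<open>An ideal as a submodule of the free module of rank one, so that presentations of the ideal and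
  of its syzygy modules are instances of the same construction.\<close>

definition ideal_module :: "'x set \<Rightarrow> ('x, 'k::field) mpoly set \<Rightarrow> (nat \<Rightarrow> ('x, 'k) mpoly) set" where
  "ideal_module S I = {v \<in> free_module S 1. v 0 \<in> I}"

text \<open>Presenting first the ideal and then each syzygy module in turn.  The matrix entries have no
  constant term because the columns of each matrix are syzygies of the preceding minimal
  presentation.\<close>

theorem minimal_graded_free_resolution_exists:
  fixes I :: "('x, 'k::field) mpoly set"
  assumes S: "finite S" and I: "I \<subseteq> poly_ring S" "graded_submodule S 1 (\<lambda>_. 0) (ideal_module S I)"
  shows "\<exists>F. minimal_graded_free_resolution S I F"
proof -
  define P where "P k = (\<lambda>(n, sh, M). graded_submodule S n sh M
      \<and> (k = 0 \<longrightarrow> n = 1 \<and> sh = (\<lambda>_. 0) \<and> M = ideal_module S I)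
      \<and> (k > 0 \<longrightarrow> (\<forall>v\<in>M. \<forall>b<n. lookup (v b) 0 = 0)))" for k :: nat
  define Q where "Q A = (\<lambda>(n, sh, M) (n', sh', M').
      (\<forall>a<n. \<forall>b<n'. A a b \<in> poly_ring S \<and> homog (sh a) (sh' b) (A a b)) \<and>
      lincomb n n' A ` free_module S n' = M \<and>
      M' = {v \<in> free_module S n'. lincomb n n' A v = (\<lambda>_. 0)})"
    for A :: "nat \<Rightarrow> nat \<Rightarrow> ('x, 'k) mpoly"
  \<comment> \<open>The state after \<open>k\<close> steps is a module that remains to be presented, with the shifts of the free
    module that contains it.\<close>
  have "\<exists>f. \<forall>k. P k (f k) \<and> (\<exists>A. Q A (f k) (f (Suc k)))"
  proof (rule dependent_nat_choice)
    show "\<exists>x. P 0 x" unfolding P_def using I(2) by auto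
  next
    fix x k assume x: "P k x"
    obtain n sh M where x_eq: "x = (n, sh, M)" by (cases x)
    then have "graded_submodule S n sh M" using x by (simp add: P_def)
    from minimal_presentation[OF S this] obtain N sh' A where
      A: "\<forall>a<n. \<forall>b<N. A a b \<in> poly_ring S \<and> homog (sh a) (sh' b) (A a b)"
        "lincomb n N A ` free_module S N = M"
        "\<forall>v\<in>free_module S N. lincomb n N A v = (\<lambda>_. 0) \<longrightarrow> (\<forall>b<N. lookup (v b) 0 = 0)"
      by blast
    let ?y = "(N, sh', {v \<in> free_module S N. lincomb n N A v = (\<lambda>_. 0)})"
    have "P (Suc k) ?y" unfolding P_def
      using A graded_submodule_kernel[of n N sh sh' A] by auto
    moreover have "Q A x ?y" unfolding Q_def x_eq using A by auto
    ultimately show "\<exists>y. P (Suc k) y \<and> (\<exists>A. Q A x y)" by blast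
  qed
  then obtain f where f: "\<And>k. P k (f k)" "\<And>k. \<exists>A. Q A (f k) (f (Suc k))" by blast
  then obtain A where A: "\<And>k. Q (A k) (f k) (f (Suc k))" by metis
  define n where "n k = fst (f k)" for k
  define sh where "sh k = fst (snd (f k))" for k
  define M where "M k = snd (snd (f k))" for k
  have A1: "A k a b \<in> poly_ring S" "homog (sh k a) (sh (Suc k) b) (A k a b)"
    if "a < n k" "b < n (Suc k)" for k a b
    using A[of k] that by (auto simp: Q_def n_def sh_def case_prod_beta)
  have A2: "lincomb (n k) (n (Suc k)) (A k) ` free_module S (n (Suc k)) = M k" for k
    using A[of k] by (auto simp: Q_def n_def M_def case_prod_beta)
  have A3: "M (Suc k) = {v \<in> free_module S (n (Suc k)). lincomb (n k) (n (Suc k)) (A k) v = (\<lambda>_. 0)}" for k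
    using A[of k] by (auto simp: Q_def n_def M_def case_prod_beta)
  have P0: "n 0 = 1" "sh 0 = (\<lambda>_. 0)" "M 0 = ideal_module S I"
    using f(1)[of 0] by (auto simp: P_def n_def M_def sh_def case_prod_beta)
  have PS: "lookup (v b) 0 = 0" if "v \<in> M (Suc k)" "b < n (Suc k)" for v b k
    using f(1)[of "Suc k"] that by (auto simp: P_def n_def M_def case_prod_beta)
  define F :: "('x, 'k) free_complex" where
    "F = \<lparr>rank = \<lambda>i. n (Suc i), shift = \<lambda>i. sh (Suc i), aug = A 0 0, diff = \<lambda>i. A (Suc i)\<rparr>"
  have F: "rank F i = n (Suc i)" "shift F i = sh (Suc i)" "aug F = A 0 0" "diff F i = A (Suc i)" for i
    by (simp_all add: F_def)
  have dm: "diff_map F i = lincomb (n (Suc i)) (n (Suc (Suc i))) (A (Suc i))" for i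
    by (intro ext) (simp add: diff_map_def lincomb_def F)
  have am: "lincomb (n 0) (n 1) (A 0) = (\<lambda>v a. if a = 0 then aug_map F v else 0)"
    by (auto simp: aug_map_def lincomb_def F P0 fun_eq_iff)
  have am0: "lincomb (n 0) (n 1) (A 0) v = (\<lambda>_. 0) \<longleftrightarrow> aug_map F v = 0" for v
    unfolding am by (auto simp: fun_eq_iff)
  have "aug_map F ` free_module S (n 1) = I"
  proof -
    have "aug_map F = (\<lambda>v. v 0) \<circ> lincomb (n 0) (n 1) (A 0)"
      unfolding am by (simp add: comp_def)
    then have "aug_map F ` free_module S (n 1)
        = (\<lambda>v. v 0) ` lincomb (n 0) (n 1) (A 0) ` free_module S (n 1)"
      by (simp only: image_comp)
    also have "\<dots> = (\<lambda>v. v 0) ` ideal_module S I"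
      using A2[of 0] P0(3) by simp
    also have "\<dots> = I"
    proof (intro equalityI subsetI)
      fix p assume "p \<in> I"
      then have "(\<lambda>a. if a = 0 then p else 0) \<in> ideal_module S I"
        using I(1) by (auto simp: ideal_module_def free_module_def)
      then show "p \<in> (\<lambda>v. v 0) ` ideal_module S I" by (rule image_eqI[rotated]) simp
    qed (auto simp: ideal_module_def)
    finally show ?thesis .
  qed
  moreover have "{v \<in> free_module S (n 1). aug_map F v = 0} = diff_map F 0 ` free_module S (n 2)"
    using A2[of 1] A3[of 0] am0 by (simp add: dm numeral_2_eq_2)
  moreover have "{v \<in> free_module S (rank F (Suc i)). diff_map F i v = (\<lambda>_. 0)}
       = diff_map F (Suc i) ` free_module S (rank F (Suc (Suc i)))" for i
    using A2[of "Suc (Suc i)"] A3[of "Suc i"] by (simp add: dm F)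
  moreover have "lookup (A (Suc k) a b) 0 = 0" if ab: "a < n (Suc k)" "b < n (Suc (Suc k))" for k a b
  proof -
    let ?e = "\<lambda>c. if c = b then 1 else 0"
    have "?e \<in> free_module S (n (Suc (Suc k)))" using ab by (auto simp: free_module_def)
    then have "lincomb (n (Suc k)) (n (Suc (Suc k))) (A (Suc k)) ?e \<in> M (Suc k)" using A2 by blast
    from PS[OF this ab(1)] show ?thesis using ab
      by (simp add: lincomb_def if_distrib[of "\<lambda>x. _ * x"] sum.delta cong: if_cong)
  qed
  ultimately have "minimal_graded_free_resolution S I F"
    unfolding minimal_graded_free_resolution_def graded_free_resolution_def
    using A1[of _ 0] A1[of _ "Suc _"] P0
    by (auto simp: F homog_def numeral_2_eq_2)
  then show ?thesis by blast
qed

section \<open>The Koszul complex\<close>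

text \<open>The sign of \<open>e \<and> F\<close> when the elements of \<open>F\<close> are written in increasing order of \<open>idx\<close>.\<close>

definition sg :: "('x \<Rightarrow> nat) \<Rightarrow> 'x \<Rightarrow> 'x set \<Rightarrow> 'a::comm_ring_1" where
  "sg idx e F = (- 1) ^ card {f \<in> F. idx f < idx e}"

lemma sg_square: "sg idx e F * sg idx e F = 1"
  by (simp add: sg_def flip: power_mult_distrib)

lemma sg_swap:
  assumes "finite F" "e \<notin> F" "e' \<notin> F" "idx e \<noteq> idx e'"
  shows "sg idx e F * sg idx e' (insert e F) = - (sg idx e' F * sg idx e (insert e' F) :: 'a::comm_ring_1)"
proof -
  have *: "sg idx a F * sg idx b (insert a F) = - (sg idx b F * (sg idx a (insert b F) :: 'a))"
    if "idx a < idx b" "a \<notin> F" for a b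
  proof -
    have "{f \<in> insert a F. idx f < idx b} = insert a {f \<in> F. idx f < idx b}"
      "{f \<in> insert b F. idx f < idx a} = {f \<in> F. idx f < idx a}" using that by auto
    then show ?thesis using that \<open>finite F\<close> by (simp add: sg_def)
  qed
  show ?thesis
  proof (cases "idx e < idx e'")
    case True
    then show ?thesis using * assms by blast
  next
    case False
    then have "idx e' < idx e" using assms by simp
    from *[OF this] assms show ?thesis by (metis minus_minus)
  qed
qed

lemma lookup_sg_times:
  fixes p :: "('x, 'k::field) mpoly"
  shows "lookup (sg idx e F * p) m = sg idx e F * lookup p m"
  unfolding sg_def by (cases "even (card {f \<in> F. idx f < idx e})") auto

text \<open>Collecting the two orders of each pair lets terms that are antisymmetric in \<open>e\<close> and \<open>e'\<close> cancel
  in every characteristic, \<open>2\<close> included.\<close>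

lemma sum_ordered_pairs:
  fixes T :: "'x \<Rightarrow> 'x \<Rightarrow> 'a::comm_monoid_add" and idx :: "'x \<Rightarrow> nat"
  assumes D: "finite D" and idx: "inj_on idx D"
  shows "(\<Sum>e\<in>D. \<Sum>e'\<in>D - {e}. T e e')
       = (\<Sum>e\<in>D. \<Sum>e'\<in>{e'\<in>D. idx e < idx e'}. T e e' + T e' e)"
proof -
  have "(\<Sum>e'\<in>D - {e}. T e e')
      = (\<Sum>e'\<in>{e'\<in>D. idx e < idx e'}. T e e') + (\<Sum>e'\<in>{e'\<in>D. idx e' < idx e}. T e e')"
    if "e \<in> D" for e
  proof -
    have "idx e' < idx e \<or> idx e < idx e'" if "e' \<in> D" "e' \<noteq> e" for e'
      using inj_onD[OF idx _ that(1) \<open>e \<in> D\<close>] that(2) by (meson linorder_neqE_nat)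
    then have eq: "D - {e} = {e'\<in>D. idx e < idx e'} \<union> {e'\<in>D. idx e' < idx e}" by blast
    show ?thesis unfolding eq by (rule sum.union_disjoint) (use D in auto)
  qed
  then have "(\<Sum>e\<in>D. \<Sum>e'\<in>D - {e}. T e e')
      = (\<Sum>e\<in>D. \<Sum>e'\<in>{e'\<in>D. idx e < idx e'}. T e e') + (\<Sum>e\<in>D. \<Sum>e'\<in>{e'\<in>D. idx e' < idx e}. T e e')"
    by (simp add: sum.distrib)
  also have "(\<Sum>e\<in>D. \<Sum>e'\<in>{e'\<in>D. idx e' < idx e}. T e e')
      = (\<Sum>e\<in>D. \<Sum>e'\<in>{e'\<in>D. idx e < idx e'}. T e' e)"
    by (rule sum.swap_restrict[OF D D])
  finally show ?thesis by (simp add: sum.distrib)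
qed

text \<open>The exterior algebra on \<open>S\<close> with coefficients in \<open>R\<close>: a chain assigns a coefficient to every subset
  of \<open>S\<close>.  The order \<open>idx\<close> of the variables only serves to fix signs.\<close>

locale koszul =
  fixes S :: "'x set" and idx :: "'x \<Rightarrow> nat"
  assumes finite_S: "finite S" and inj_idx: "inj_on idx S"
begin

text \<open>Contraction with the linear form \<open>e \<mapsto> f e\<close>.  The case \<open>f = Var\<close> is the Koszul differential; other
  forms are used to build Koszul chains.\<close>

definition contract ::
    "('x \<Rightarrow> ('x, 'k::field) mpoly) \<Rightarrow> ('x set \<Rightarrow> ('x, 'k) mpoly) \<Rightarrow> 'x set \<Rightarrow> ('x, 'k) mpoly" where
  "contract f w F = (if F \<subseteq> S then (\<Sum>e\<in>S - F. sg idx e F * f e * w (insert e F)) else 0)"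

text \<open>Two contractions only see the \<open>2\<close>-minors of the two linear forms.  This one formula yields that
  contractions anticommute, that they square to zero, and that proportional forms compose to zero.\<close>

lemma contract_contract:
  fixes f g :: "'x \<Rightarrow> ('x, 'k::field) mpoly"
  assumes "F \<subseteq> S"
  shows "contract f (contract g w) F =
    (\<Sum>e\<in>S - F. \<Sum>e'\<in>{e'\<in>S - F. idx e < idx e'}.
       sg idx e F * sg idx e' (insert e F) * (f e * g e' - f e' * g e) * w (insert e (insert e' F)))"
proof -
  let ?D = "S - F"
  define T where "T e e' = sg idx e F * sg idx e' (insert e F) * f e * g e' * w (insert e (insert e' F))"
    for e e'
  have "contract f (contract g w) F = (\<Sum>e\<in>?D. \<Sum>e'\<in>?D - {e}. T e e')"
    using assms
    by (auto simp: contract_def T_def sum_distrib_left insert_commute Diff_insert2[symmetric]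
          Diff_insert[symmetric] mult_ac intro!: sum.cong)
  also have "\<dots> = (\<Sum>e\<in>?D. \<Sum>e'\<in>{e'\<in>?D. idx e < idx e'}. T e e' + T e' e)"
    using finite_S inj_idx by (intro sum_ordered_pairs) (auto intro: inj_on_diff)
  also have "\<dots> = (\<Sum>e\<in>?D. \<Sum>e'\<in>{e'\<in>?D. idx e < idx e'}.
       sg idx e F * sg idx e' (insert e F) * (f e * g e' - f e' * g e) * w (insert e (insert e' F)))"
  proof (intro sum.cong refl)
    fix e e' assume e: "e \<in> ?D" "e' \<in> {e'\<in>?D. idx e < idx e'}"
    have "sg idx e' F * sg idx e (insert e' F) = - (sg idx e F * (sg idx e' (insert e F) :: ('x, 'k) mpoly))"
      using e assms finite_S by (intro sg_swap) (auto dest: finite_subset)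
    then have "T e' e = - (sg idx e F * sg idx e' (insert e F)) * f e' * g e * w (insert e (insert e' F))"
      unfolding T_def by (simp add: insert_commute)
    then show "T e e' + T e' e = sg idx e F * sg idx e' (insert e F) * (f e * g e' - f e' * g e)
        * w (insert e (insert e' F))"
      unfolding T_def by (simp add: algebra_simps)
  qed
  finally show ?thesis .
qed

lemma contract_anticommute: "contract f (contract g w) F = - contract g (contract f w) F"
proof (cases "F \<subseteq> S")
  case True
  show ?thesis unfolding contract_contract[OF True]
    by (simp add: sum_negf[symmetric] algebra_simps)
qed (simp add: contract_def)

lemma contract_square: "contract f (contract f w) F = 0"
  by (cases "F \<subseteq> S") (simp add: contract_contract mult.commute, simp add: contract_def)

lemma contract_poly_ring:
  assumes "\<And>e. e \<in> S \<Longrightarrow> f e \<in> poly_ring S" "\<And>F. w F \<in> poly_ring S"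
  shows "contract f w F \<in> poly_ring S"
  unfolding contract_def sg_def using assms by (auto intro!: poly_ring_intros)

lemma contract_zero [simp]: "contract f (\<lambda>_. 0) F = 0"
  by (simp add: contract_def)

lemma contract_diff: "contract f (\<lambda>F. u F - w F) F = contract f u F - contract f w F"
  by (simp add: contract_def right_diff_distrib sum_subtractf)

lemma contract_nonzero:
  assumes "contract f w F \<noteq> 0"
  obtains e where "F \<subseteq> S" "e \<in> S" "e \<notin> F" "f e \<noteq> 0" "w (insert e F) \<noteq> 0"
proof -
  have "F \<subseteq> S" using assms by (auto simp: contract_def split: if_splits)
  have "\<exists>e\<in>S - F. sg idx e F * f e * w (insert e F) \<noteq> 0"
    using assms by (auto simp: contract_def intro: sum.not_neutral_contains_not_neutral split: if_splits)
  then obtain e where "e \<in> S - F" "sg idx e F * f e * w (insert e F) \<noteq> 0" by blast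
  moreover from this have "f e \<noteq> 0" "w (insert e F) \<noteq> 0" by (auto simp del: mult_eq_0_iff) 
  ultimately show ?thesis using that \<open>F \<subseteq> S\<close> by blast
qed

text \<open>In a fixed multidegree the Koszul
  complex is the simplicial chain complex of a full simplex on the variables that divide the
  multidegree, and coning with one of these variables contracts it.\<close>

lemma koszul_exact:
  fixes w :: "'x set \<Rightarrow> ('x, 'k::field) mpoly"
  assumes w_ring: "\<And>G. w G \<in> poly_ring S"
    and w_supp: "\<And>G. w G \<noteq> 0 \<Longrightarrow> G \<subseteq> S \<and> card G = p"
    and cycle: "\<And>G. contract Var w G = 0"
    and const: "lookup (w {}) 0 = 0"
  shows "\<exists>u. (\<forall>G. u G \<in> poly_ring S) \<and> (\<forall>G. u G \<noteq> 0 \<longrightarrow> G \<subseteq> S \<and> card G = Suc p) \<and>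
    (\<forall>G. contract Var u G = w G)"
proof -
  \<comment> \<open>\<open>G \<union> keys m\<close> is the set of variables that divide the multidegree of the term \<open>m e\<^sub>G\<close>, and the choice
    of the cone point depends on this set alone.\<close>
  define apex where "apex U = (SOME e. e \<in> U)" for U :: "'x set"
  have apex: "apex U \<in> U" if "U \<noteq> {}" for U
    using that unfolding apex_def by (simp add: some_in_eq)
  define uc where "uc G m = (let e = apex (G \<union> keys m) in
      if G \<subseteq> S \<and> e \<in> G then sg idx e (G - {e}) * lookup (w (G - {e})) (m + single e 1) else 0)"
    for G and m :: "'x \<Rightarrow>\<^sub>0 nat"
  have fin: "finite {m. uc G m \<noteq> 0}" for G
  proof (cases "G \<subseteq> S")
    case True
    have "{m. uc G m \<noteq> 0} \<subseteq> (\<Union>e\<in>G. (\<lambda>m. m - single e 1) ` keys (w (G - {e})))"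
    proof
      fix m assume "m \<in> {m. uc G m \<noteq> 0}"
      then obtain e where e: "e \<in> G" "m + single e 1 \<in> keys (w (G - {e}))"
        by (auto simp: uc_def Let_def in_keys_iff split: if_splits)
      moreover have "m = m + single e 1 - single e 1" by simp
      ultimately show "m \<in> (\<Union>e\<in>G. (\<lambda>m. m - single e 1) ` keys (w (G - {e})))" by blast
    qed
    moreover have "finite G" using True finite_S finite_subset by blast
    ultimately show ?thesis by (rule finite_subset[OF _ finite_UN_I]) auto
  qed (simp add: uc_def Let_def)
  define u where "u G = Abs_poly_mapping (uc G)" for G
  have lu: "lookup (u G) m = uc G m" for G m
    unfolding u_def using fin by simp
  have u_nz: "\<exists>e\<in>G. G \<subseteq> S \<and> m + single e 1 \<in> keys (w (G - {e}))" if "uc G m \<noteq> 0" for G m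
    using that by (auto simp: uc_def Let_def in_keys_iff split: if_splits)
  have u_ring: "u G \<in> poly_ring S" for G
    unfolding poly_ring_def
  proof (intro CollectI ballI)
    fix m assume "m \<in> keys (u G)"
    then have "uc G m \<noteq> 0" by (simp add: in_keys_iff lu)
    from u_nz[OF this] obtain e where "m + single e 1 \<in> keys (w (G - {e}))" by blast
    then have "keys (m + single e 1) \<subseteq> S" using w_ring by (auto simp: poly_ring_def)
    then show "keys m \<subseteq> S" by (simp add: keys_nat_add)
  qed
  have u_supp: "G \<subseteq> S \<and> card G = Suc p" if "u G \<noteq> 0" for G
  proof -
    obtain m where "uc G m \<noteq> 0" using \<open>u G \<noteq> 0\<close> lu by (metis lookup_zero poly_mapping_eqI)
    then obtain e where e: "e \<in> G" "G \<subseteq> S" "w (G - {e}) \<noteq> 0" using u_nz by fastforce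
    moreover have "finite G" using e finite_S finite_subset by blast
    ultimately have "card G = Suc p"
      using w_supp[of "G - {e}"] by (metis card.remove)
    with e show ?thesis by blast
  qed
  have "lookup (contract Var u G) m = lookup (w G) m" for G m
  proof (cases "G \<subseteq> S \<and> keys m \<subseteq> S")
    case False
    have "contract Var u G \<in> poly_ring S"
      by (rule contract_poly_ring) (auto intro: poly_ring_Var u_ring)
    then have "lookup (contract Var u G) m = 0"
      using False by (auto simp: contract_def poly_ring_def in_keys_iff)
    moreover have "lookup (w G) m = 0"
      using False w_supp[of G] w_ring[of G] by (cases "w G = 0") (auto simp: poly_ring_def in_keys_iff)
    ultimately show ?thesis by simp
  next
    case True
    then have G: "G \<subseteq> S" and m: "keys m \<subseteq> S" by auto
    have finG: "finite G" using G finite_S finite_subset by blast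
    define U where "U = G \<union> keys m"
    define x where "x = apex U"
    have expand: "lookup (contract Var v H) m' =
        (\<Sum>e\<in>S - H. sg idx e H * (if e \<in> keys m' then lookup (v (insert e H)) (m' - single e 1) else 0))"
      if "H \<subseteq> S" for v :: "'x set \<Rightarrow> ('x, 'k) mpoly" and H m'
      using that by (simp add: contract_def lookup_sum lookup_sg_times lookup_Var_times mult.assoc)
    have uce: "uc (insert e G) (m - single e 1) =
       (if x \<in> insert e G then sg idx x (insert e G - {x}) *
          lookup (w (insert e G - {x})) (m - single e 1 + single x 1) else 0)"
      if "e \<in> S - G" "e \<in> keys m" for e
    proof -
      have "insert e G \<union> keys (m - single e 1) = U"
        using that by (auto simp: U_def in_keys_iff lookup_minus lookup_single when_def split: if_splits)
      then show ?thesis using that G by (simp add: uc_def Let_def x_def)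
    qed
    show ?thesis
    proof (cases "U = {}")
      case True
      then have "G = {}" "m = 0"
        by (auto simp: U_def in_keys_iff intro: poly_mapping_eqI)
      then show ?thesis using const expand[of "{}" u 0] by simp
    next
      case False
      then have "x \<in> U" using apex by (simp add: x_def)
      show ?thesis
      proof (cases "x \<in> G")
        case False
        then have x: "x \<in> keys m" "x \<in> S - G" using \<open>x \<in> U\<close> m by (auto simp: U_def)
        have mx: "m - single x 1 + single x 1 = m"
          using x by (intro poly_mapping_eqI)
            (auto simp: lookup_add lookup_minus lookup_single when_def in_keys_iff)
        have "lookup (contract Var u G) m = (\<Sum>e\<in>S - G. if e = x then lookup (w G) m else 0)"
          unfolding expand[OF G] lu
        proof (intro sum.cong refl)
          fix e assume e: "e \<in> S - G"
          show "sg idx e G * (if e \<in> keys m then uc (insert e G) (m - single e 1) else 0)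
              = (if e = x then lookup (w G) m else 0)"
            using uce[OF e] False x mx sg_square[of idx x G, where 'a = 'k]
            by (auto simp: mult.assoc[symmetric])
        qed
        then show ?thesis using x finite_S by (simp add: sum.delta)
      next
        case True
        define G' where "G' = G - {x}"
        have GG: "G = insert x G'" "x \<notin> G'" "finite G'" "G' \<subseteq> S"
          using True finG G by (auto simp: G'_def)
        have SG: "S - G' = insert x (S - G)" using True G by (auto simp: G'_def)
        let ?t = "\<lambda>e. if e \<in> keys m then lookup (w (insert e G')) (m - single e 1 + single x 1) else 0"
        have eq: "(if e \<in> keys (m + single x 1) then lookup (w (insert e G')) (m + single x 1 - single e 1) else 0)
            = ?t e" if "e \<in> S - G" for e
        proof -
          have "e \<noteq> x" using that True by auto
          moreover have "m + single x 1 - single e 1 = m - single e 1 + single x 1" if "e \<in> keys m"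
            using that \<open>e \<noteq> x\<close> by (intro poly_mapping_eqI)
              (auto simp: lookup_add lookup_minus lookup_single when_def in_keys_iff)
          ultimately show ?thesis by (simp add: keys_nat_add)
        qed
        \<comment> \<open>Here \<open>h\<partial> + \<partial>h = id\<close> for the coning homotopy \<open>h\<close>: the cycle condition at \<open>G - {x}\<close> expresses the
          coefficient at \<open>G\<close> by the coefficients from which \<open>u\<close> is made.\<close>
        have "0 = lookup (contract Var w G') (m + single x 1)" by (simp add: cycle)
        also have "\<dots> = sg idx x G' * lookup (w G) m + (\<Sum>e\<in>S - G. sg idx e G' * ?t e)"
          unfolding expand[OF GG(4)] SG using finite_S True eq GG(1)
          by (subst sum.insert) (auto simp: keys_nat_add)
        finally have 0: "sg idx x G' * lookup (w G) m = - (\<Sum>e\<in>S - G. sg idx e G' * ?t e)"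
          by (simp add: eq_neg_iff_add_eq_0)
        have "lookup (contract Var u G) m = (\<Sum>e\<in>S - G. - sg idx x G' * (sg idx e G' * ?t e))"
          unfolding expand[OF G] lu
        proof (intro sum.cong refl)
          fix e assume e: "e \<in> S - G"
          then have ex: "e \<noteq> x" "e \<notin> G'" using True by (auto simp: G'_def)
          then have "insert e G - {x} = insert e G'" by (auto simp: G'_def)
          then have l: "(if e \<in> keys m then uc (insert e G) (m - single e 1) else 0)
              = sg idx x (insert e G') * ?t e" using uce[OF e] True by simp
          have "idx e \<noteq> idx x" using inj_idx ex e True G by (metis DiffD1 inj_onD subsetD)
          from sg_swap[where 'a = 'k, OF GG(3) ex(2) GG(2) this]
          have sw: "sg idx e G' * sg idx x (insert e G') = - (sg idx x G' * (sg idx e G :: 'k))"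
            by (simp only: GG(1)[symmetric])
          have "sg idx e G * sg idx x (insert e G')
             = (sg idx e G' * sg idx e G') * sg idx e G * (sg idx x (insert e G') :: 'k)"
            by (simp add: sg_square)
          also have "\<dots> = sg idx e G' * sg idx e G * (sg idx e G' * sg idx x (insert e G'))"
            by (simp only: mult_ac)
          also have "\<dots> = - (sg idx x G' * sg idx e G') * (sg idx e G * sg idx e G)"
            unfolding sw by (simp add: mult_ac)
          finally have "sg idx e G * sg idx x (insert e G') = - (sg idx x G' * (sg idx e G' :: 'k))"
            by (simp add: sg_square)
          then show "sg idx e G * (if e \<in> keys m then uc (insert e G) (m - single e 1) else 0)
              = - sg idx x G' * (sg idx e G' * ?t e)"
            unfolding l by (simp add: mult.assoc[symmetric])
        qed
        also have "\<dots> = sg idx x G' * - (\<Sum>e\<in>S - G. sg idx e G' * ?t e)"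
          by (simp add: sum_distrib_left sum_negf)
        also have "\<dots> = lookup (w G) m"
          by (simp add: 0[symmetric] mult.assoc[symmetric] sg_square)
        finally show ?thesis .
      qed
    qed
  qed
  then have "contract Var u G = w G" for G by (intro poly_mapping_eqI)
  then show ?thesis using u_ring u_supp by blast
qed

text \<open>The differential of \<open>K \<otimes> F\<close> for a free module \<open>F\<close>, one copy of the Koszul complex for each basis
  element.\<close>

definition vcontract ::
    "('x set \<Rightarrow> nat \<Rightarrow> ('x, 'k::field) mpoly) \<Rightarrow> 'x set \<Rightarrow> nat \<Rightarrow> ('x, 'k) mpoly" where
  "vcontract z G = (\<lambda>a. contract Var (\<lambda>H. z H a) G)"

lemma vcontract_square: "vcontract (vcontract z) G = (\<lambda>_. 0)"
  by (simp add: vcontract_def contract_square)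

lemma vcontract_diff:
  "vcontract (\<lambda>G a. u G a - w G a) G = (\<lambda>a. vcontract u G a - vcontract w G a)"
  by (simp add: vcontract_def contract_diff)

lemma vcontract_free_module:
  assumes "\<And>G. z G \<in> free_module S n"
  shows "vcontract z G \<in> free_module S n"
proof -
  have "z G a \<in> poly_ring S" for G a
    using assms[of G] by (cases "a < n") (auto simp: free_module_def)
  moreover have "z G a = 0" if "a \<ge> n" for G a
    using assms[of G] that by (simp add: free_module_def)
  ultimately show ?thesis unfolding free_module_def vcontract_def
    by (auto intro!: contract_poly_ring poly_ring_Var)
qed

lemma lincomb_vcontract:
  "lincomb n N A (vcontract z G) = vcontract (\<lambda>H. lincomb n N A (z H)) G"
proof
  fix a
  show "lincomb n N A (vcontract z G) a = vcontract (\<lambda>H. lincomb n N A (z H)) G a"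
  proof (cases "a < n \<and> G \<subseteq> S")
    case True
    then have "lincomb n N A (vcontract z G) a
        = (\<Sum>b<N. \<Sum>e\<in>S - G. sg idx e G * Var e * (A a b * z (insert e G) b))"
      by (auto simp: lincomb_def vcontract_def contract_def sum_distrib_left mult_ac intro!: sum.cong)
    also have "\<dots> = vcontract (\<lambda>H. lincomb n N A (z H)) G a"
      using True by (subst sum.swap) (simp add: lincomb_def vcontract_def contract_def sum_distrib_left)
    finally show ?thesis .
  qed (auto simp: lincomb_def vcontract_def contract_def)
qed

lemma vkoszul_exact:
  fixes z :: "'x set \<Rightarrow> nat \<Rightarrow> ('x, 'k::field) mpoly"
  assumes z: "\<And>G. z G \<in> free_module S n"
    and supp: "\<And>G a. z G a \<noteq> 0 \<Longrightarrow> G \<subseteq> S \<and> card G = p"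
    and cycle: "\<And>G. vcontract z G = (\<lambda>_. 0)"
    and const: "\<And>a. lookup (z {} a) 0 = 0"
  shows "\<exists>u. (\<forall>G. u G \<in> free_module S n) \<and> (\<forall>G a. u G a \<noteq> 0 \<longrightarrow> G \<subseteq> S \<and> card G = Suc p) \<and>
    (\<forall>G. vcontract u G = z G)"
proof -
  have ring: "z G a \<in> poly_ring S" for G a
    using z[of G] by (cases "a < n") (auto simp: free_module_def)
  have "\<exists>u. (\<forall>G. u G \<in> poly_ring S) \<and> (\<forall>G. u G \<noteq> 0 \<longrightarrow> G \<subseteq> S \<and> card G = Suc p) \<and>
    (\<forall>G. contract Var u G = z G a)" for a
    using ring supp const cycle by (intro koszul_exact) (auto simp: vcontract_def fun_eq_iff)
  then obtain U where U: "\<And>a G. U a G \<in> poly_ring S"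
      "\<And>a G. U a G \<noteq> 0 \<Longrightarrow> G \<subseteq> S \<and> card G = Suc p" "\<And>a G. contract Var (U a) G = z G a"
    by metis
  define u where "u G a = (if a < n then U a G else 0)" for G a
  have "vcontract u G = z G" for G
  proof
    fix a
    show "vcontract u G a = z G a"
      using U(3)[of a G] z[of G]
      by (cases "a < n") (auto simp: vcontract_def u_def free_module_def)
  qed
  moreover have "u G \<in> free_module S n" for G using U(1) by (simp add: u_def free_module_def)
  moreover have "G \<subseteq> S \<and> card G = Suc p" if "u G a \<noteq> 0" for G a
    using U(2)[of a G] that by (simp add: u_def split: if_splits)
  ultimately show ?thesis by blast
qed

end

section \<open>Betti numbers and Koszul homology\<close>

lemma homog_shift: "homog (s + c) (t + c) p \<longleftrightarrow> homog s t p"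
  by (simp add: homog_def)

lemma homog_sg: "homog s s (sg idx e F)"
  by (simp add: sg_def homog_power_minus_one)

context koszul
begin

lemma vcontract_vhomog:
  assumes "\<And>G. vhomog n (\<lambda>a. sh a + card G) j (z G)"
  shows "vhomog n (\<lambda>a. sh a + card G) j (vcontract z G)"
  unfolding vhomog_def
proof (intro allI impI)
  fix a assume "a < n"
  show "homog (sh a + card G) j (vcontract z G a)"
  proof (cases "G \<subseteq> S")
    case True
    then have "finite G" using finite_S finite_subset by blast
    have "homog (sh a + card G) j (sg idx e G * Var e * z (insert e G) a)" if "e \<in> S - G" for e
    proof (intro homog_mult)
      show "homog (sh a + card G) (sh a + card G) (sg idx e G)" by (rule homog_sg)
      show "homog (sh a + card G) (Suc (sh a + card G)) (Var e)" by (rule homog_Var)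
      show "homog (Suc (sh a + card G)) j (z (insert e G) a)"
        using assms[of "insert e G"] that \<open>a < n\<close> \<open>finite G\<close> by (simp add: vhomog_def)
    qed
    then show ?thesis using True by (auto simp: vcontract_def contract_def intro!: homog_sum)
  qed (simp add: vcontract_def contract_def)
qed

text \<open>The comparison of the two ways to compute \<open>Tor(I, k)\<close>, as a chase in the double complex
  \<open>K \<otimes> F\<close>.  Its rows are exact because \<open>F\<close> is a resolution, its columns because the Koszul complex is
  exact away from constants.  Starting from \<open>y\<close>, one lifts to \<open>z\<^sub>k \<in> K\<^bsub>n-k\<^esub> \<otimes> F\<^bsub>k-1\<^esub>\<close> until
  \<open>z\<^sub>n \<in> K\<^sub>0 \<otimes> F\<^bsub>n-1\<^esub>\<close> is reached.  It is homogeneous of degree \<open>j\<close>, so its entries have no constant term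
  when no basis element has degree \<open>j\<close>, and then all \<open>z\<^sub>k\<close> can be traced back to boundaries.\<close>

theorem koszul_boundary_if_no_generator:
  fixes y :: "'x set \<Rightarrow> ('x, 'k::field) mpoly"
  assumes res: "graded_free_resolution S I F"
    and n: "n \<ge> 1"
    and y_ring: "\<And>G. y G \<in> poly_ring S"
    and y_supp: "\<And>G. y G \<noteq> 0 \<Longrightarrow> G \<subseteq> S \<and> card G = n"
    and y_homog: "\<And>G. homog (card G) j (y G)"
    and dy: "\<And>G. contract Var y G \<in> I"
    and no_gen: "\<And>b. b < rank F (n - 1) \<Longrightarrow> shift F (n - 1) b \<noteq> j"
  shows "\<exists>u x. (\<forall>G. u G \<in> poly_ring S) \<and> (\<forall>G. x G \<in> I) \<and> (\<forall>G. y G = x G + contract Var u G)"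
proof -
  \<comment> \<open>The augmented complex, with \<open>R\<close> itself in position \<open>0\<close>.\<close>
  define rk where "rk k = (case k of 0 \<Rightarrow> 1 | Suc i \<Rightarrow> rank F i)" for k
  define sh where "sh k = (case k of 0 \<Rightarrow> (\<lambda>_. 0) | Suc i \<Rightarrow> shift F i)" for k
  define A where "A k = (case k of 0 \<Rightarrow> (\<lambda>_. aug F) | Suc i \<Rightarrow> diff F i)" for k
  let ?L = "\<lambda>k. lincomb (rk k) (rk (Suc k)) (A k)"
  have L0: "?L 0 = (\<lambda>v a. if a = 0 then aug_map F v else 0)"
    by (auto simp: lincomb_def aug_map_def rk_def A_def fun_eq_iff)
  have L0_0: "?L 0 v = (\<lambda>_. 0) \<longleftrightarrow> aug_map F v = 0" for v
    unfolding L0 by (auto simp: fun_eq_iff)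
  have LS: "?L (Suc k) = diff_map F k" for k
    by (auto simp: lincomb_def diff_map_def rk_def A_def fun_eq_iff)
  have A_ring: "A k a b \<in> poly_ring S" if "a < rk k" "b < rk (Suc k)" for k a b
    using res that unfolding graded_free_resolution_def
    by (cases k) (auto simp: A_def rk_def)
  have A_hom: "homog (sh k a) (sh (Suc k) b) (A k a b)" if "a < rk k" "b < rk (Suc k)" for k a b
    using res that unfolding graded_free_resolution_def
    by (cases k) (auto simp: A_def rk_def sh_def homog_def)
  have ideal: "aug_map F ` free_module S (rk 1) = I"
    using res by (simp add: graded_free_resolution_def rk_def)
  have ex: "{v \<in> free_module S (rk (Suc k)). ?L k v = (\<lambda>_. 0)} = ?L (Suc k) ` free_module S (rk (Suc (Suc k)))"
    for k
  proof (cases k)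
    case 0
    then show ?thesis using res L0_0 unfolding graded_free_resolution_def LS
      by (simp add: rk_def)
  next
    case (Suc i)
    then show ?thesis using res unfolding graded_free_resolution_def Suc LS
      by (simp add: rk_def)
  qed
  define im where "im k = ?L k ` free_module S (rk (Suc k))" for k
  define P where "P k z \<longleftrightarrow> (\<forall>G. z G \<in> free_module S (rk k)) \<and>
      (\<forall>G a. z G a \<noteq> 0 \<longrightarrow> G \<subseteq> S \<and> card G + k = n) \<and>
      (\<forall>G. vhomog (rk k) (\<lambda>a. sh k a + card G) j (z G)) \<and> (\<forall>G. vcontract z G \<in> im k)"
    for k and z :: "'x set \<Rightarrow> nat \<Rightarrow> ('x, 'k) mpoly"
  define z0 where "z0 G = (\<lambda>a::nat. if a = 0 then y G else 0)" for G
  have P0: "P 0 z0"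
  proof -
    have "vcontract z0 G \<in> im 0" for G
    proof -
      obtain v where v: "v \<in> free_module S (rk (Suc 0))" "aug_map F v = contract Var y G"
        using dy[of G] ideal by (metis One_nat_def imageE)
      have "vcontract z0 G = (\<lambda>a. if a = 0 then contract Var y G else 0)"
        by (auto simp: vcontract_def z0_def)
      then have "vcontract z0 G = ?L 0 v" unfolding L0 v(2) .
      then show ?thesis unfolding im_def using v(1) by (rule image_eqI)
    qed
    moreover have "vhomog (rk 0) (\<lambda>a. sh 0 a + card G) j (z0 G)" for G
      using y_homog[of G] by (simp add: vhomog_def z0_def rk_def sh_def)
    moreover have "z0 G \<in> free_module S (rk 0)" for G
      using y_ring by (simp add: z0_def free_module_def rk_def)
    moreover have "G \<subseteq> S \<and> card G + 0 = n" if "z0 G a \<noteq> 0" for G a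
      using that y_supp[of G] by (auto simp: z0_def split: if_splits)
    ultimately show ?thesis unfolding P_def by blast
  qed
  \<comment> \<open>Lift the cycle step by step along the resolution.\<close>
  have "\<exists>z. \<forall>k. (P k (z k) \<and> (k = 0 \<longrightarrow> z k = z0)) \<and> (\<forall>G. ?L k (z (Suc k) G) = vcontract (z k) G)"
  proof (rule dependent_nat_choice)
    show "\<exists>z. P 0 z \<and> (0 = (0::nat) \<longrightarrow> z = z0)" using P0 by blast
  next
    fix z k assume "P k z \<and> (k = 0 \<longrightarrow> z = z0)"
    then have z: "\<And>G. z G \<in> free_module S (rk k)" "\<And>G a. z G a \<noteq> 0 \<Longrightarrow> G \<subseteq> S \<and> card G + k = n"
      "\<And>G. vhomog (rk k) (\<lambda>a. sh k a + card G) j (z G)" "\<And>G. vcontract z G \<in> im k"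
      by (auto simp: P_def)
    have "\<exists>v. v \<in> free_module S (rk (Suc k)) \<and> ?L k v = vcontract z G" for G
      using z(4)[of G] by (auto simp: im_def)
    then obtain v where v: "\<And>G. v G \<in> free_module S (rk (Suc k))" "\<And>G. ?L k (v G) = vcontract z G"
      by metis
    \<comment> \<open>An arbitrary lift is replaced by its component of total degree \<open>j\<close>.\<close>
    define z' where "z' G = (if vcontract z G = (\<lambda>_. 0) then (\<lambda>_. 0)
        else vcomp (\<lambda>b. sh (Suc k) b + card G) j (v G))" for G
    have Lz': "?L k (z' G) = vcontract z G" for G
    proof (cases "vcontract z G = (\<lambda>_. 0)")
      case False
      have "?L k (z' G) = vcomp (\<lambda>a. sh k a + card G) j (vcontract z G)"
        using False A_hom by (simp add: z'_def lincomb_vcomp[where sh = "\<lambda>a. sh k a + card G"] homog_shift v)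
      also have "\<dots> = vcontract z G"
      proof
        fix a
        have "vcontract z G \<in> free_module S (rk k)" using z(1) by (rule vcontract_free_module)
        then show "vcomp (\<lambda>a. sh k a + card G) j (vcontract z G) a = vcontract z G a"
          using vcontract_vhomog[of "rk k" "sh k" j z G] z(3)
          by (cases "a < rk k") (auto simp: vcomp_def vhomog_def hcomp_homog free_module_def)
      qed
      finally show ?thesis .
    qed (simp add: z'_def)
    have z'_free: "z' G \<in> free_module S (rk (Suc k))" for G
      using v(1)[of G] by (auto simp: z'_def vcomp_def free_module_def intro: hcomp_poly_ring)
    have z'_supp: "G \<subseteq> S \<and> card G + Suc k = n" if nz: "z' G a \<noteq> 0" for G a
    proof -
      have "vcontract z G \<noteq> (\<lambda>_. 0)" using nz by (auto simp: z'_def)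
      then obtain c where "contract Var (\<lambda>H. z H c) G \<noteq> 0" by (auto simp: vcontract_def)
      then obtain e where e: "G \<subseteq> S" "e \<in> S" "e \<notin> G" "z (insert e G) c \<noteq> 0"
        using contract_nonzero by blast
      moreover have "finite G" using e(1) finite_S finite_subset by blast
      ultimately show ?thesis using z(2)[OF e(4)] by simp
    qed
    have z'_hom: "vhomog (rk (Suc k)) (\<lambda>a. sh (Suc k) a + card G) j (z' G)" for G
      using vhomog_vcomp[of "rk (Suc k)" "\<lambda>b. sh (Suc k) b + card G" j "v G"]
      by (auto simp: z'_def) (simp add: vhomog_def)
    have "vcontract z' G \<in> im (Suc k)" for G
    proof -
      have "?L k (vcontract z' G) = vcontract (vcontract z) G"
        unfolding lincomb_vcontract Lz' ..
      then show ?thesis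
        using vcontract_free_module[of z', OF z'_free] ex[of k] by (auto simp: im_def vcontract_square)
    qed
    then have "P (Suc k) z'" unfolding P_def using z'_free z'_supp z'_hom by blast
    then show "\<exists>z'. (P (Suc k) z' \<and> (Suc k = 0 \<longrightarrow> z' = z0)) \<and> (\<forall>G. ?L k (z' G) = vcontract z G)"
      using Lz' by blast
  qed
  then obtain z where z: "\<And>k. P k (z k)" "z 0 = z0" "\<And>k G. ?L k (z (Suc k) G) = vcontract (z k) G"
    by blast
  have z_free: "z k G \<in> free_module S (rk k)"
    and z_supp: "z k G a \<noteq> 0 \<Longrightarrow> G \<subseteq> S \<and> card G + k = n"
    and z_hom: "vhomog (rk k) (\<lambda>a. sh k a + card G) j (z k G)" for k G a
    using z(1)[of k] by (auto simp: P_def)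
  \<comment> \<open>Descend again: since \<open>F\<^bsub>n-1\<^esub>\<close> has no generator of degree \<open>j\<close>, the last lift is a Koszul boundary.\<close>
  define D where "D k \<longleftrightarrow> (\<exists>u w. (\<forall>G. u G \<in> free_module S (rk k)) \<and>
      (\<forall>G a. u G a \<noteq> 0 \<longrightarrow> G \<subseteq> S \<and> card G + k = Suc n) \<and>
      (\<forall>G. w G \<in> free_module S (rk (Suc k))) \<and>
      (\<forall>G. z k G = (\<lambda>a. ?L k (w G) a + vcontract u G a)))" for k
  have D_n: "D n"
  proof -
    have "\<exists>u. (\<forall>G. u G \<in> free_module S (rk n)) \<and> (\<forall>G a. u G a \<noteq> 0 \<longrightarrow> G \<subseteq> S \<and> card G = Suc 0) \<and>
        (\<forall>G. vcontract u G = z n G)"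
    proof (rule vkoszul_exact)
      show "z n G \<in> free_module S (rk n)" for G by (rule z_free)
      show "G \<subseteq> S \<and> card G = 0" if "z n G a \<noteq> 0" for G a using z_supp[OF that] by simp
      show "vcontract (z n) G = (\<lambda>_. 0)" for G
      proof (rule ext, rule ccontr)
        fix a assume "vcontract (z n) G a \<noteq> 0"
        then obtain e where e: "G \<subseteq> S" "z n (insert e G) a \<noteq> 0"
          unfolding vcontract_def using contract_nonzero by blast
        moreover have "finite G" using e(1) finite_S finite_subset by blast
        ultimately show False using z_supp[OF e(2)] by simp
      qed
      show "lookup (z n {} a) 0 = 0" for a
      proof (cases "a < rk n")
        case True
        then have "homog (sh n a) j (z n {} a)" using z_hom[of n "{}"] by (simp add: vhomog_def)
        moreover have "sh n a \<noteq> j" using no_gen True n by (cases n) (auto simp: sh_def rk_def)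
        ultimately show ?thesis by (auto simp: homog_def in_keys_iff)
      next
        case False
        then show ?thesis using z_free[of n "{}"] by (simp add: free_module_def)
      qed
    qed
    then obtain u where u: "\<And>G. u G \<in> free_module S (rk n)" "\<And>G a. u G a \<noteq> 0 \<Longrightarrow> G \<subseteq> S \<and> card G = Suc 0"
      "\<And>G. vcontract u G = z n G" by blast
    have "(\<lambda>_. 0) \<in> free_module S (rk (Suc n))" by (simp add: free_module_def)
    then show ?thesis unfolding D_def using u
      by (intro exI[of _ u] exI[of _ "\<lambda>_ _. 0"]) auto
  qed
  have D_step: "D k" if "D (Suc k)" "k < n" for k
  proof -
    obtain u w where u: "\<And>G. u G \<in> free_module S (rk (Suc k))"
        "\<And>G a. u G a \<noteq> 0 \<Longrightarrow> G \<subseteq> S \<and> card G + Suc k = Suc n"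
      and w: "\<And>G. w G \<in> free_module S (rk (Suc (Suc k)))"
      and eq: "\<And>G. z (Suc k) G = (\<lambda>a. ?L (Suc k) (w G) a + vcontract u G a)"
      using \<open>D (Suc k)\<close> unfolding D_def by blast
    define v where "v G = (\<lambda>a. z k G a - ?L k (u G) a)" for G
    have LL: "?L k (?L (Suc k) (w G)) = (\<lambda>_. 0)" for G
      using ex[of k] w[of G] by blast
    have "\<exists>u'. (\<forall>G. u' G \<in> free_module S (rk k)) \<and> (\<forall>G a. u' G a \<noteq> 0 \<longrightarrow> G \<subseteq> S \<and> card G = Suc (n - k)) \<and>
        (\<forall>G. vcontract u' G = v G)"
    proof (rule vkoszul_exact)
      fix G
      have "?L k (u G) \<in> free_module S (rk k)" using A_ring u(1) by (rule lincomb_free_module)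
      then show "v G \<in> free_module S (rk k)"
        using z_free[of k G] by (auto simp: v_def free_module_def intro: poly_ring_diff)
      have "vcontract (z k) G = ?L k (z (Suc k) G)" by (simp add: z(3))
      also have "\<dots> = ?L k (vcontract u G)" unfolding eq lincomb_add LL by simp
      also have "\<dots> = vcontract (\<lambda>H. ?L k (u H)) G" by (rule lincomb_vcontract)
      finally show "vcontract v G = (\<lambda>_. 0)" unfolding v_def vcontract_diff by simp
      show supp: "G \<subseteq> S \<and> card G = n - k" if "v G a \<noteq> 0" for a
      proof -
        have "z k G a \<noteq> 0 \<or> (\<exists>b. u G b \<noteq> 0)"
          using that by (auto simp: v_def lincomb_def split: if_splits intro: ccontr)
        then show ?thesis using z_supp u(2) by fastforce
      qed
    next
      fix a
      have "z k {} a = 0" using z_supp[of k "{}" a] that by fastforce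
      moreover have "u {} b = 0" for b using u(2)[of "{}" b] that by fastforce
      ultimately show "lookup (v {} a) 0 = 0" by (simp add: v_def lincomb_def)
    qed
    then obtain u' where u': "\<And>G. u' G \<in> free_module S (rk k)"
       "\<And>G a. u' G a \<noteq> 0 \<Longrightarrow> G \<subseteq> S \<and> card G = Suc (n - k)" "\<And>G. vcontract u' G = v G" by blast
    have "z k G = (\<lambda>a. ?L k (u G) a + vcontract u' G a)" for G by (simp add: u' v_def)
    moreover have "G \<subseteq> S \<and> card G + k = Suc n" if "u' G a \<noteq> 0" for G a
      using u'(2)[OF that] \<open>k < n\<close> by simp
    ultimately show ?thesis unfolding D_def using u'(1) u(1) by blast
  qed
  have "D 0" by (rule inc_induct[of 0 n D]) (auto intro: D_n D_step)
  then obtain u w where u: "\<And>G. u G \<in> free_module S (rk 0)" and w: "\<And>G. w G \<in> free_module S (rk 1)"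
    and eq: "\<And>G. z0 G = (\<lambda>a. ?L 0 (w G) a + vcontract u G a)"
    unfolding D_def z(2) by auto
  have "u G 0 \<in> poly_ring S" for G using u[of G] by (simp add: free_module_def rk_def)
  moreover have "aug_map F (w G) \<in> I" for G using w[of G] ideal by blast
  moreover have "y G = aug_map F (w G) + contract Var (\<lambda>H. u H 0) G" for G
    using fun_cong[OF eq[of G], of 0] unfolding L0 by (simp add: z0_def vcontract_def)
  ultimately show ?thesis by (intro exI[of _ "\<lambda>G. u G 0"] exI[of _ "\<lambda>G. aug_map F (w G)"]) simp
qed

end

section \<open>Toric ideals and vertex degrees\<close>

subsection \<open>Sums of coefficients\<close>

text \<open>If \<open>P\<close> selects the monomials of vertex degree \<open>\<gamma>\<close>, this is the coefficient at \<open>\<gamma>\<close> of the image in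
  \<open>k[V(G)]\<close>.\<close>

definition csum :: "(('x \<Rightarrow>\<^sub>0 nat) \<Rightarrow> bool) \<Rightarrow> ('x, 'k::field) mpoly \<Rightarrow> 'k" where
  "csum P p = (\<Sum>m\<in>{m\<in>keys p. P m}. lookup p m)"

lemma csum_superset:
  "finite A \<Longrightarrow> keys p \<subseteq> A \<Longrightarrow> csum P p = (\<Sum>m\<in>{m\<in>A. P m}. lookup p m)"
  unfolding csum_def by (intro sum.mono_neutral_left) (auto simp: in_keys_iff)

lemma csum_zero [simp]: "csum P 0 = 0"
  by (simp add: csum_def)

lemma csum_False [simp]: "csum (\<lambda>_. False) p = 0"
  by (simp add: csum_def)

lemma csum_add: "csum P (p + q) = csum P p + csum P q"
proof -
  let ?A = "keys p \<union> keys q"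
  have "csum P p = (\<Sum>m\<in>{m\<in>?A. P m}. lookup p m)" "csum P q = (\<Sum>m\<in>{m\<in>?A. P m}. lookup q m)"
    by (intro csum_superset; simp)+
  moreover have "csum P (p + q) = (\<Sum>m\<in>{m\<in>?A. P m}. lookup (p + q) m)"
    using keys_add[of p q] by (intro csum_superset) auto
  ultimately show ?thesis by (simp add: lookup_add sum.distrib)
qed

lemma csum_sum: "csum P (sum f A) = (\<Sum>a\<in>A. csum P (f a))"
  by (induction A rule: infinite_finite_induct) (auto simp: csum_add)

lemma csum_uminus: "csum P (- p) = - csum P p"
  using csum_add[of P p "- p"] by (simp add: eq_neg_iff_add_eq_0 add.commute)

lemma csum_single: "csum P (single m c) = (if P m then c else 0)"
proof -
  have "csum P (single m c) = (\<Sum>m'\<in>{m'\<in>{m}. P m'}. lookup (single m c) m')"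
    by (intro csum_superset) auto
  also have "{m'\<in>{m}. P m'} = (if P m then {m} else {})" by auto
  finally show ?thesis by simp
qed

lemma csum_sg_times: "csum P (sg idx e F * p) = sg idx e F * csum P p"
  unfolding sg_def by (cases "even (card {f \<in> F. idx f < idx e})") (auto simp: csum_uminus)

lemma csum_single_times: "csum P (single t c * p) = c * csum (\<lambda>u. P (t + u)) p"
proof -
  have "keys (single t c * p) \<subseteq> (+) t ` keys p" using keys_single_times by blast
  then have "csum P (single t c * p) = (\<Sum>m\<in>{m\<in>(+) t ` keys p. P m}. lookup (single t c * p) m)"
    by (intro csum_superset) auto
  also have "{m\<in>(+) t ` keys p. P m} = (+) t ` {u\<in>keys p. P (t + u)}" by auto
  also have "(\<Sum>m\<in>(+) t ` {u\<in>keys p. P (t + u)}. lookup (single t c * p) m)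
      = (\<Sum>u\<in>{u\<in>keys p. P (t + u)}. lookup (single t c * p) (t + u))"
    by (subst sum.reindex) auto
  also have "\<dots> = c * csum (\<lambda>u. P (t + u)) p"
    by (simp add: lookup_single_times_shift csum_def sum_distrib_left)
  finally show ?thesis .
qed

lemma csum_Var_times: "csum P (Var e * p) = csum (\<lambda>u. P (single e 1 + u)) p"
  unfolding Var_def csum_single_times by simp

lemma csum_cong: "(\<And>m. m \<in> keys p \<Longrightarrow> P m \<longleftrightarrow> Q m) \<Longrightarrow> csum P p = csum Q p"
  unfolding csum_def by (intro sum.cong) auto

lemma csum_hcomp: "csum P (hcomp s j p) = csum (\<lambda>m. P m \<and> mdeg m + s = j) p"
proof -
  have "keys (hcomp s j p) \<subseteq> keys p" by (auto simp: in_keys_iff lookup_hcomp split: if_splits)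
  then have "csum P (hcomp s j p) = (\<Sum>m\<in>{m\<in>keys p. P m}. lookup (hcomp s j p) m)"
    by (intro csum_superset) auto
  also have "\<dots> = (\<Sum>m\<in>{m\<in>{m\<in>keys p. P m}. mdeg m + s = j}. lookup p m)"
    unfolding lookup_hcomp by (rule sum.inter_filter[symmetric]) simp
  also have "{m\<in>{m\<in>keys p. P m}. mdeg m + s = j} = {m\<in>keys p. P m \<and> mdeg m + s = j}" by auto
  also have "(\<Sum>m\<in>{m\<in>keys p. P m \<and> mdeg m + s = j}. lookup p m) = csum (\<lambda>m. P m \<and> mdeg m + s = j) p"
    by (simp add: csum_def)
  finally show ?thesis .
qed

subsection \<open>Vertex degrees of monomials in the edges\<close>

definition vdeg :: "('v set \<Rightarrow>\<^sub>0 nat) \<Rightarrow> 'v \<Rightarrow> nat" where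
  "vdeg m v = (\<Sum>e\<in>{e\<in>keys m. v \<in> e}. lookup m e)"

lemma vdeg_superset: "finite A \<Longrightarrow> keys m \<subseteq> A \<Longrightarrow> vdeg m v = (\<Sum>e\<in>{e\<in>A. v \<in> e}. lookup m e)"
  unfolding vdeg_def by (intro sum.mono_neutral_left) (auto simp: in_keys_iff)

lemma vdeg_add: "vdeg (m + m') v = vdeg m v + vdeg m' v"
proof -
  let ?A = "keys m \<union> keys m'"
  have "vdeg m v = (\<Sum>e\<in>{e\<in>?A. v \<in> e}. lookup m e)" "vdeg m' v = (\<Sum>e\<in>{e\<in>?A. v \<in> e}. lookup m' e)"
    by (intro vdeg_superset; simp)+
  moreover have "vdeg (m + m') v = (\<Sum>e\<in>{e\<in>?A. v \<in> e}. lookup (m + m') e)"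
    by (intro vdeg_superset) (auto simp: keys_nat_add)
  ultimately show ?thesis by (simp add: lookup_add sum.distrib)
qed

lemma vdeg_zero [simp]: "vdeg 0 v = 0"
  by (simp add: vdeg_def)

lemma vdeg_single: "vdeg (single e k) v = (if v \<in> e then k else 0)"
proof -
  have "vdeg (single e k) v = (\<Sum>f\<in>{f\<in>{e}. v \<in> f}. lookup (single e k) f)"
    by (intro vdeg_superset) auto
  also have "{f\<in>{e}. v \<in> f} = (if v \<in> e then {e} else {})" by auto
  finally show ?thesis by simp
qed

lemma vdeg_sum: "vdeg (sum f A) v = (\<Sum>a\<in>A. vdeg (f a) v)"
  by (induction A rule: infinite_finite_induct) (auto simp: vdeg_add)

lemma sum_le_vdeg:
  assumes "finite B" "\<And>e. e \<in> B \<Longrightarrow> v \<in> e"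
  shows "(\<Sum>e\<in>B. lookup m e) \<le> vdeg m v"
proof -
  have "vdeg m v = (\<Sum>e\<in>{e\<in>keys m \<union> B. v \<in> e}. lookup m e)"
    using assms(1) by (intro vdeg_superset) auto
  then show ?thesis using assms by (auto intro!: sum_mono2)
qed

lemma vdeg_eq_sum:
  assumes "finite B" "\<And>e. e \<in> B \<Longrightarrow> v \<in> e" "\<And>e. e \<in> keys m \<Longrightarrow> v \<in> e \<Longrightarrow> e \<in> B"
  shows "vdeg m v = (\<Sum>e\<in>B. lookup m e)"
  unfolding vdeg_def using assms by (intro sum.mono_neutral_left) (auto simp: in_keys_iff)

text \<open>Every edge has two ends, so the vertex degree determines the standard degree.\<close>

lemma sum_vdeg:
  assumes "finite V" "\<And>e. e \<in> keys m \<Longrightarrow> e \<subseteq> V \<and> card e = 2"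
  shows "(\<Sum>v\<in>V. vdeg m v) = 2 * mdeg m"
proof -
  have "(\<Sum>v\<in>V. vdeg m v) = (\<Sum>e\<in>keys m. \<Sum>v\<in>{v\<in>V. v \<in> e}. lookup m e)"
    unfolding vdeg_def by (rule sum.swap_restrict) (auto simp: assms)
  also have "\<dots> = (\<Sum>e\<in>keys m. 2 * lookup m e)"
  proof (intro sum.cong refl)
    fix e assume "e \<in> keys m"
    then have "{v\<in>V. v \<in> e} = e" "card e = 2" using assms(2) by auto
    then show "(\<Sum>v\<in>{v\<in>V. v \<in> e}. lookup m e) = 2 * lookup m e" by simp
  qed
  finally show ?thesis by (simp add: mdeg_def sum_distrib_left)
qed

subsection \<open>Toric ideals\<close>

lemma single_power: "single a 1 ^ k = (single (((+) a ^^ k) 0) 1 :: ('x, 'k::field) mpoly)"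
  by (induction k) (auto simp: mult_single)

lemma lookup_funpow_add: "lookup (((+) a ^^ k) 0) v = k * lookup (a :: 'v \<Rightarrow>\<^sub>0 nat) v"
  by (induction k) (auto simp: lookup_add)

lemma prod_single: "(\<Prod>e\<in>A. single (f e) 1) = (single (\<Sum>e\<in>A. f e) 1 :: ('x, 'k::field) mpoly)"
  by (induction A rule: infinite_finite_induct) (auto simp: mult_single)

text \<open>The image of a monomial in the edges is the monomial in the vertices given by its vertex degree,
  so a polynomial lies in the toric ideal iff its coefficients cancel in each vertex degree.\<close>

lemma toric_ideal_iff:
  fixes p :: "('v set, 'k::field) mpoly"
  assumes "\<And>e. e \<in> edges G \<Longrightarrow> finite e"
  shows "p \<in> toric_ideal G \<longleftrightarrow> p \<in> poly_ring (edges G) \<and> (\<forall>\<gamma>. csum (\<lambda>m. vdeg m = \<gamma>) p = 0)"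
proof (cases "p \<in> poly_ring (edges G)")
  case True
  define \<delta> :: "('v set \<Rightarrow>\<^sub>0 nat) \<Rightarrow> 'v \<Rightarrow>\<^sub>0 nat"
    where "\<delta> m = (\<Sum>e\<in>keys m. ((+) (\<Sum>v\<in>e. single v 1) ^^ lookup m e) 0)" for m
  have mono: "(\<Prod>e\<in>keys m. (\<Prod>v\<in>e. Var v) ^ lookup m e) = (single (\<delta> m) 1 :: ('v, 'k) mpoly)" for m
    by (simp add: Var_def prod_single single_power \<delta>_def)
  have \<delta>: "lookup (\<delta> m) = vdeg m" if "m \<in> keys p" for m
  proof
    fix v
    have fin: "finite e" if "e \<in> keys m" for e
      using that \<open>m \<in> keys p\<close> True assms by (auto simp: poly_ring_def)
    have "lookup (\<delta> m) v = (\<Sum>e\<in>keys m. if v \<in> e then lookup m e else 0)"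
      unfolding \<delta>_def lookup_sum lookup_funpow_add
      using fin by (intro sum.cong) (auto simp: lookup_sum lookup_single when_def sum.delta)
    also have "\<dots> = vdeg m v" unfolding vdeg_def by (rule sum.inter_filter[symmetric]) simp
    finally show "lookup (\<delta> m) v = vdeg m v" .
  qed
  have "poly_subst (\<lambda>e. \<Prod>v\<in>e. Var v) p = (\<Sum>m\<in>keys p. single (\<delta> m) (lookup p m))"
    unfolding poly_subst_def mono Const_def by (simp add: mult_single)
  then have l: "lookup (poly_subst (\<lambda>e. \<Prod>v\<in>e. Var v) p) k = csum (\<lambda>m. \<delta> m = k) p" for k
    by (simp add: lookup_sum lookup_single when_def csum_def sum.inter_filter[symmetric])
  have "poly_subst (\<lambda>e. \<Prod>v\<in>e. Var v) p = 0 \<longleftrightarrow> (\<forall>k. csum (\<lambda>m. \<delta> m = k) p = 0)"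
    unfolding l[symmetric] by (metis lookup_zero poly_mapping_eqI)
  also have "\<dots> \<longleftrightarrow> (\<forall>\<gamma>. csum (\<lambda>m. vdeg m = \<gamma>) p = 0)"
  proof (intro iffI allI)
    fix \<gamma> assume 0: "\<forall>k. csum (\<lambda>m. \<delta> m = k) p = 0"
    show "csum (\<lambda>m. vdeg m = \<gamma>) p = 0"
    proof (cases "\<exists>m\<in>keys p. vdeg m = \<gamma>")
      case True
      then obtain m where m: "m \<in> keys p" "vdeg m = \<gamma>" by blast
      have "csum (\<lambda>m. vdeg m = \<gamma>) p = csum (\<lambda>m'. \<delta> m' = \<delta> m) p"
        using \<delta> m by (intro csum_cong) (metis poly_mapping_eq_iff)
      then show ?thesis using 0 by simp
    next
      case False
      then have "csum (\<lambda>m. vdeg m = \<gamma>) p = csum (\<lambda>_. False) p" by (intro csum_cong) auto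
      then show ?thesis by simp
    qed
  next
    fix k assume 0: "\<forall>\<gamma>. csum (\<lambda>m. vdeg m = \<gamma>) p = 0"
    have "csum (\<lambda>m. \<delta> m = k) p = csum (\<lambda>m. vdeg m = lookup k) p"
      using \<delta> by (intro csum_cong) (metis poly_mapping_eq_iff)
    then show "csum (\<lambda>m. \<delta> m = k) p = 0" using 0 by simp
  qed
  finally show ?thesis using True by (simp add: toric_ideal_def)
qed (simp add: toric_ideal_def)

locale toric_graph =
  fixes G :: "'v graph"
  assumes simple: "finite_simple_graph G"
begin

lemma edgeD: "e \<in> edges G \<Longrightarrow> e \<subseteq> verts G \<and> card e = 2"
  using simple by (simp add: finite_simple_graph_def)

lemma finite_verts: "finite (verts G)"
  using simple by (simp add: finite_simple_graph_def)

lemma finite_edges: "finite (edges G)"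
  using finite_subset[of "edges G" "Pow (verts G)"] edgeD finite_verts by blast

lemma toric_iff:
  "p \<in> toric_ideal G \<longleftrightarrow> p \<in> poly_ring (edges G) \<and> (\<forall>\<gamma>. csum (\<lambda>m. vdeg m = \<gamma>) p = 0)"
  using edgeD finite_verts by (intro toric_ideal_iff) (auto intro: finite_subset)

text \<open>The offset \<open>\<kappa>\<close> makes it possible to work in the degree \<open>\<alpha> - \<kappa>\<close> without assuming that it is nonnegative.\<close>

lemma toric_csum:
  fixes p :: "('v set, 'k::field) mpoly"
  assumes "p \<in> toric_ideal G"
  shows "csum (\<lambda>m. \<forall>v. vdeg m v + \<kappa> v = \<alpha> v) p = 0"
proof (cases "\<forall>v. \<kappa> v \<le> \<alpha> v")
  case True
  have "x + \<kappa> v = \<alpha> v \<longleftrightarrow> x = \<alpha> v - \<kappa> v" for x v using True[rule_format, of v] by auto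
  then have "(\<lambda>m. \<forall>v. vdeg m v + \<kappa> v = \<alpha> v) = (\<lambda>m. vdeg m = (\<lambda>v. \<alpha> v - \<kappa> v))"
    by (auto simp: fun_eq_iff)
  then show ?thesis using assms unfolding toric_iff by simp
next
  case False
  then obtain v where "\<alpha> v < \<kappa> v" by (auto simp: not_le)
  then have "(\<lambda>m. \<forall>v. vdeg m v + \<kappa> v = \<alpha> v) = (\<lambda>_. False)"
    by (intro ext) (metis not_add_less2)
  then show ?thesis by (simp only: csum_False)
qed

lemma toric_zero [simp]: "0 \<in> toric_ideal G"
  by (simp add: toric_iff)

lemma toric_add: "p \<in> toric_ideal G \<Longrightarrow> q \<in> toric_ideal G \<Longrightarrow> p + q \<in> toric_ideal G"
  by (simp add: toric_iff csum_add poly_ring_add)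

lemma toric_sum: "(\<And>a. a \<in> A \<Longrightarrow> f a \<in> toric_ideal G) \<Longrightarrow> sum f A \<in> toric_ideal G"
  by (induction A rule: infinite_finite_induct) (auto intro: toric_add)

lemma toric_mult:
  fixes p q :: "('v set, 'k::field) mpoly"
  assumes "q \<in> poly_ring (edges G)" "p \<in> toric_ideal G"
  shows "q * p \<in> toric_ideal G"
proof -
  have p: "p \<in> poly_ring (edges G)" using assms(2) by (simp add: toric_iff)
  have "csum (\<lambda>m. vdeg m = \<gamma>) (q * p) = 0" for \<gamma>
  proof -
    have "q * p = (\<Sum>t\<in>keys q. single t (lookup q t) * p)"
      by (subst poly_mapping_sum_singles[of q]) (simp add: sum_distrib_right)
    moreover have "csum (\<lambda>m. vdeg m = \<gamma>) (single t c * p) = 0" for t c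
      using toric_csum[OF assms(2), of "vdeg t" \<gamma>]
      by (simp add: csum_single_times fun_eq_iff vdeg_add add.commute)
    ultimately show ?thesis by (simp add: csum_sum)
  qed
  then show ?thesis using poly_ring_mult[OF assms(1) p] by (simp add: toric_iff)
qed

text \<open>All monomials of a given vertex degree have the same standard degree, so that a homogeneous
  component either keeps all of them or none.\<close>

lemma toric_hcomp:
  assumes "p \<in> toric_ideal G"
  shows "hcomp s j p \<in> toric_ideal G"
proof -
  have p: "p \<in> poly_ring (edges G)" using assms by (simp add: toric_iff)
  have deg: "2 * mdeg m = (\<Sum>v\<in>verts G. vdeg m v)" if "m \<in> keys p" for m
    using that p edgeD by (intro sum_vdeg[symmetric] finite_verts) (auto simp: poly_ring_def)
  have "csum (\<lambda>m. vdeg m = \<gamma>) (hcomp s j p) = 0" for \<gamma>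
  proof -
    let ?c = "2 * s + (\<Sum>v\<in>verts G. \<gamma> v) = 2 * j"
    have "csum (\<lambda>m. vdeg m = \<gamma>) (hcomp s j p) = csum (\<lambda>m. vdeg m = \<gamma> \<and> ?c) p"
      unfolding csum_hcomp by (intro csum_cong) (use deg in fastforce)
    also have "\<dots> = 0" using assms by (cases ?c) (auto simp: toric_iff)
    finally show ?thesis .
  qed
  then show ?thesis using hcomp_poly_ring[OF p] by (simp add: toric_iff)
qed

lemma toric_binomial:
  assumes "keys m \<subseteq> edges G" "keys m' \<subseteq> edges G" "\<And>v. vdeg m v = vdeg m' v"
  shows "single m 1 - single m' 1 \<in> (toric_ideal G :: ('v set, 'k::field) mpoly set)"
proof -
  have "vdeg m = vdeg m'" using assms(3) by blast
  then have "csum (\<lambda>m. vdeg m = \<gamma>) (single m 1 + - single m' 1) = (0 :: 'k)" for \<gamma>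
    unfolding csum_add csum_uminus csum_single by simp
  then show ?thesis using assms by (simp add: toric_iff poly_ring_diff poly_ring_single)
qed

lemma toric_graded: "graded_submodule (edges G) 1 (\<lambda>_. 0) (ideal_module (edges G) (toric_ideal G))"
  unfolding graded_submodule_def ideal_module_def free_module_def vcomp_def
  by (auto intro: poly_ring_add poly_ring_mult toric_add toric_mult toric_hcomp hcomp_poly_ring)

text \<open>The chosen resolution is only known to be some minimal one, whence the quantification over all
  resolutions.\<close>

lemma betti_toric_nonzero:
  assumes "\<And>F. graded_free_resolution (edges G) (toric_ideal G :: ('v set, 'k::field) mpoly set) F
     \<Longrightarrow> \<exists>b<rank F i. shift F i b = j"
  shows "betti (edges G) (toric_ideal G :: ('v set, 'k) mpoly set) i j \<noteq> 0"
proof -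
  let ?I = "toric_ideal G :: ('v set, 'k) mpoly set"
  define F where "F = (SOME F. minimal_graded_free_resolution (edges G) ?I F)"
  have "\<exists>F. minimal_graded_free_resolution (edges G) ?I F"
    by (intro minimal_graded_free_resolution_exists finite_edges toric_graded)
       (auto simp: toric_ideal_def)
  then have "minimal_graded_free_resolution (edges G) ?I F"
    unfolding F_def by (rule someI_ex)
  then obtain b where "b < rank F i" "shift F i b = j"
    using assms by (auto simp: minimal_graded_free_resolution_def)
  then have "{b. b < rank F i \<and> shift F i b = j} \<noteq> {}" by blast
  then show ?thesis by (simp add: betti_def F_def[symmetric])
qed

end

section \<open>Signs, pairings and ideals\<close>

text \<open>Neighbours \<open>q\<close> and \<open>e\<close> in the order of the variables: exchanging them flips the sign.\<close>

lemma sg_adjacent: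
  assumes "finite R" "q \<notin> R" "e \<notin> R" "idx q \<noteq> idx e" "\<And>f. f \<in> R \<Longrightarrow> idx f < idx e \<longleftrightarrow> idx f < idx q"
  shows "sg idx e (insert q R) = - (sg idx q (insert e R) :: 'a::comm_ring_1)"
proof -
  have *: "sg idx b (insert a R) = - (sg idx a (insert b R) :: 'a)"
    if "idx a < idx b" "a \<notin> R" "\<And>f. f \<in> R \<Longrightarrow> idx f < idx a \<longleftrightarrow> idx f < idx b" for a b
  proof -
    have "{f \<in> insert a R. idx f < idx b} = insert a {f \<in> R. idx f < idx b}"
      "{f \<in> insert b R. idx f < idx a} = {f \<in> R. idx f < idx b}" using that by auto
    then show ?thesis using that \<open>finite R\<close> by (simp add: sg_def)
  qed
  show ?thesis
  proof (cases "idx q < idx e")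
    case True
    then show ?thesis using * assms by blast
  next
    case False
    then have "idx e < idx q" using assms(4) by simp
    from *[OF this] assms have "sg idx q (insert e R) = - (sg idx e (insert q R) :: 'a)" by blast
    then show ?thesis by simp
  qed
qed

text \<open>The classes become blocks of consecutive variables, so that \<open>sg_adjacent\<close> applies to any two
  members of the same class.\<close>

lemma index_refining_classes:
  fixes cl :: "'x \<Rightarrow> nat"
  assumes "finite S"
  shows "\<exists>idx :: 'x \<Rightarrow> nat. inj_on idx S \<and> (\<forall>e\<in>S. \<forall>f\<in>S. cl e < cl f \<longrightarrow> idx e < idx f)"
proof -
  obtain h where h: "bij_betw h S {..<card S}"
    using ex_bij_betw_finite_nat[OF assms] by (auto simp: lessThan_atLeast0)
  then have lt: "h e < card S" if "e \<in> S" for e using that by (auto simp: bij_betw_def)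
  define idx where "idx e = cl e * card S + h e" for e
  have less: "idx e < idx f" if "cl e < cl f" "e \<in> S" for e f
  proof -
    have "idx e < Suc (cl e) * card S" using lt[OF that(2)] by (simp add: idx_def)
    also have "\<dots> \<le> cl f * card S" using that(1) by (intro mult_le_mono1) simp
    finally show ?thesis by (simp add: idx_def)
  qed
  have "inj_on idx S"
  proof (rule inj_onI)
    fix e f assume ef: "e \<in> S" "f \<in> S" "idx e = idx f"
    then have "cl e = cl f" using less[of e f] less[of f e] by (metis less_irrefl linorder_neqE_nat)
    then have "h e = h f" using ef by (simp add: idx_def)
    then show "e = f" using h ef by (auto simp: bij_betw_def inj_on_def)
  qed
  then show ?thesis using less by blast
qed

text \<open>The predicate \<open>pos\<close> picks one element from each orbit, which makes the cancellation valid in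
  characteristic \<open>2\<close> as well.\<close>

lemma sum_involution_zero:
  fixes g :: "'b \<Rightarrow> 'a::ab_group_add"
  assumes "finite A" "\<And>x. x \<in> A \<Longrightarrow> \<tau> x \<in> A" "\<And>x. x \<in> A \<Longrightarrow> \<tau> (\<tau> x) = x"
    "\<And>x. x \<in> A \<Longrightarrow> g (\<tau> x) = - g x" "\<And>x. x \<in> A \<Longrightarrow> pos (\<tau> x) \<longleftrightarrow> \<not> pos x"
  shows "sum g A = 0"
proof -
  let ?P = "{x \<in> A. pos x}" and ?M = "{x \<in> A. \<not> pos x}"
  have "sum g A = sum g (?P \<union> ?M)" by (rule arg_cong[of _ _ "sum g"]) auto
  also have "\<dots> = sum g ?P + sum g ?M" using assms(1) by (intro sum.union_disjoint) auto
  also have "sum g ?M = (\<Sum>x\<in>?P. g (\<tau> x))"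
    by (rule sum.reindex_bij_witness[of _ \<tau> \<tau>]) (use assms in auto)
  also have "\<dots> = - sum g ?P" using assms(4) by (simp add: sum_negf)
  finally show ?thesis by simp
qed

context koszul
begin

text \<open>By \<open>contract_contract\<close>, forms that are proportional modulo \<open>I\<close> have a composition with values
  in \<open>I\<close>.\<close>

lemma contract_minors:
  assumes I_zero: "0 \<in> I" and I_add: "\<And>p q. p \<in> I \<Longrightarrow> q \<in> I \<Longrightarrow> p + q \<in> I"
    and I_mult: "\<And>p q. q \<in> poly_ring S \<Longrightarrow> p \<in> I \<Longrightarrow> q * p \<in> I"
    and minors: "\<And>e e'. e \<in> S \<Longrightarrow> e' \<in> S \<Longrightarrow> f e * g e' - f e' * g e \<in> I"
    and w: "\<And>F. w F \<in> poly_ring S"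
  shows "contract f (contract g w) F \<in> I"
proof -
  have I_sum: "sum h A \<in> I" if "\<And>a. a \<in> A \<Longrightarrow> h a \<in> I" for h and A :: "'x set"
    using that by (induction A rule: infinite_finite_induct) (auto intro: I_zero I_add)
  have "sg idx e F * sg idx e' (insert e F) * (f e * g e' - f e' * g e) * w (insert e (insert e' F)) \<in> I"
    if "e \<in> S" "e' \<in> S" for e e'
  proof -
    have "sg idx e F * sg idx e' (insert e F) * w (insert e (insert e' F)) \<in> poly_ring S"
      unfolding sg_def by (intro poly_ring_intros w)
    from I_mult[OF this minors[OF that]] show ?thesis by (simp add: mult_ac)
  qed
  note term_in = this
  show ?thesis
  proof (cases "F \<subseteq> S")
    case True
    show ?thesis unfolding contract_contract[OF True] by (intro I_sum term_in) auto
  qed (simp add: contract_def I_zero)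
qed

lemma contract_ideal:
  assumes I_zero: "0 \<in> I" and I_add: "\<And>p q. p \<in> I \<Longrightarrow> q \<in> I \<Longrightarrow> p + q \<in> I"
    and I_mult: "\<And>p q. q \<in> poly_ring S \<Longrightarrow> p \<in> I \<Longrightarrow> q * p \<in> I"
    and g: "\<And>e. e \<in> S \<Longrightarrow> g e \<in> poly_ring S" and w: "\<And>F. w F \<in> I"
  shows "contract g w F \<in> I"
proof -
  have I_sum: "sum h A \<in> I" if "\<And>a. a \<in> A \<Longrightarrow> h a \<in> I" for h and A :: "'x set"
    using that by (induction A rule: infinite_finite_induct) (auto intro: I_zero I_add)
  have "sg idx e F * g e * w (insert e F) \<in> I" if "e \<in> S" for e
    using g[OF that] by (intro I_mult poly_ring_mult w) (auto simp: sg_def intro: poly_ring_intros)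
  then show ?thesis by (auto simp: contract_def intro!: I_sum I_zero)
qed

end

section \<open>The combinatorics of disjoint ears\<close>

text \<open>The squarefree monomial with support \<open>F\<close>, as an exponent vector.\<close>

definition ind :: "'x set \<Rightarrow> 'x \<Rightarrow>\<^sub>0 nat" where
  "ind F = (\<Sum>e\<in>F. single e 1)"

lemma lookup_ind: "finite F \<Longrightarrow> lookup (ind F) e = (if e \<in> F then 1 else 0)"
  by (simp add: ind_def lookup_sum lookup_single when_def sum.delta)

lemma ind_insert: "finite F \<Longrightarrow> e \<notin> F \<Longrightarrow> ind (insert e F) = single e 1 + ind F"
  by (simp add: ind_def)

text \<open>For \<open>\<chi>\<close> the indicator of a vertex along a path: the odd edges together with the first vertex
  cover each vertex as often as the even edges together with the last vertex.\<close>

lemma telescope: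
  fixes \<chi> :: "nat \<Rightarrow> nat"
  shows "(\<Sum>t<n. \<chi> (2 * t + 1) + \<chi> (2 * t + 2)) + \<chi> 0 = \<chi> (2 * n) + (\<Sum>t<n. \<chi> (2 * t) + \<chi> (2 * t + 1))"
  by (induction n) auto

text \<open>An induced subgraph that is the disjoint union of graphs \<open>G\<^bsub>r,d\<^esub>\<close>, one for each \<open>l \<in> L\<close>.  The path has
  the vertices \<open>c l 0 = x\<^sub>1, c l 1 = z\<^sub>1, \<dots>, c l (2 * k l) = x\<^sub>2\<close>, so \<open>k l = r\<^sub>l - 1\<close>; the vertices \<open>y l i\<close> are
  numbered from \<open>0\<close>.  That the subgraph is induced is expressed by the last assumption.\<close>

locale ear_graphs = toric_graph G for G :: "'v graph" +
  fixes L :: "nat set" and k d :: "nat \<Rightarrow> nat" and c y :: "nat \<Rightarrow> nat \<Rightarrow> 'v"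
  assumes finite_L: "finite L"
    and k_pos: "l \<in> L \<Longrightarrow> k l \<ge> 1" and d_pos: "l \<in> L \<Longrightarrow> d l \<ge> 1"
    and c_eq: "l \<in> L \<Longrightarrow> l' \<in> L \<Longrightarrow> j \<le> 2 * k l \<Longrightarrow> j' \<le> 2 * k l' \<Longrightarrow> c l j = c l' j' \<longleftrightarrow> l = l' \<and> j = j'"
    and y_eq: "l \<in> L \<Longrightarrow> l' \<in> L \<Longrightarrow> i < d l \<Longrightarrow> i' < d l' \<Longrightarrow> y l i = y l' i' \<longleftrightarrow> l = l' \<and> i = i'"
    and cy: "l \<in> L \<Longrightarrow> l' \<in> L \<Longrightarrow> j \<le> 2 * k l \<Longrightarrow> i < d l' \<Longrightarrow> c l j \<noteq> y l' i"
    and E_edge': "l \<in> L \<Longrightarrow> j < 2 * k l \<Longrightarrow> {c l j, c l (Suc j)} \<in> edges G"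
    and A_edge': "l \<in> L \<Longrightarrow> i < d l \<Longrightarrow> {c l 0, y l i} \<in> edges G"
    and B_edge': "l \<in> L \<Longrightarrow> i < d l \<Longrightarrow> {c l (2 * k l), y l i} \<in> edges G"
    and induced': "e \<in> edges G \<Longrightarrow> (\<And>v. v \<in> e \<Longrightarrow> \<exists>l\<in>L. (\<exists>j\<le>2 * k l. v = c l j) \<or> (\<exists>i<d l. v = y l i)) \<Longrightarrow>
      \<exists>l\<in>L. (\<exists>j<2 * k l. e = {c l j, c l (Suc j)}) \<or> (\<exists>i<d l. e = {c l 0, y l i} \<or> e = {c l (2 * k l), y l i})"
begin

text \<open>The path edges and, for each \<open>y\<^sub>i\<close>, the edges \<open>a\<^sub>i\<close> to \<open>x\<^sub>1\<close> and \<open>b\<^sub>i\<close> to \<open>x\<^sub>2\<close>.\<close>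

definition E where "E l j = {c l j, c l (Suc j)}"
definition A where "A l i = {c l 0, y l i}"
definition B where "B l i = {c l (2 * k l), y l i}"

lemma yc: "l \<in> L \<Longrightarrow> l' \<in> L \<Longrightarrow> j \<le> 2 * k l \<Longrightarrow> i < d l' \<Longrightarrow> y l' i \<noteq> c l j"
  using cy by metis

lemma E_edge: "l \<in> L \<Longrightarrow> j < 2 * k l \<Longrightarrow> E l j \<in> edges G"
  and A_edge: "l \<in> L \<Longrightarrow> i < d l \<Longrightarrow> A l i \<in> edges G"
  and B_edge: "l \<in> L \<Longrightarrow> i < d l \<Longrightarrow> B l i \<in> edges G"
  by (simp_all add: E_def A_def B_def E_edge' A_edge' B_edge')

lemma induced:
  assumes "e \<in> edges G" "\<And>v. v \<in> e \<Longrightarrow> \<exists>l\<in>L. (\<exists>j\<le>2 * k l. v = c l j) \<or> (\<exists>i<d l. v = y l i)"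
  obtains l j where "l \<in> L" "j < 2 * k l" "e = E l j" | l i where "l \<in> L" "i < d l" "e = A l i"
    | l i where "l \<in> L" "i < d l" "e = B l i"
  using induced'[OF assms] unfolding E_def A_def B_def by blast

lemma c_in: "l \<in> L \<Longrightarrow> l' \<in> L \<Longrightarrow> j \<le> 2 * k l \<Longrightarrow> j' < 2 * k l' \<Longrightarrow>
      c l j \<in> E l' j' \<longleftrightarrow> l = l' \<and> (j = j' \<or> j = Suc j')"
    "l \<in> L \<Longrightarrow> l' \<in> L \<Longrightarrow> j \<le> 2 * k l \<Longrightarrow> i < d l' \<Longrightarrow> c l j \<in> A l' i \<longleftrightarrow> l = l' \<and> j = 0"
    "l \<in> L \<Longrightarrow> l' \<in> L \<Longrightarrow> j \<le> 2 * k l \<Longrightarrow> i < d l' \<Longrightarrow> c l j \<in> B l' i \<longleftrightarrow> l = l' \<and> j = 2 * k l"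
  by (auto simp: E_def A_def B_def c_eq cy)

lemma y_in: "l \<in> L \<Longrightarrow> l' \<in> L \<Longrightarrow> i < d l \<Longrightarrow> j' < 2 * k l' \<Longrightarrow> y l i \<notin> E l' j'"
    "l \<in> L \<Longrightarrow> l' \<in> L \<Longrightarrow> i < d l \<Longrightarrow> i' < d l' \<Longrightarrow> y l i \<in> A l' i' \<longleftrightarrow> l = l' \<and> i = i'"
    "l \<in> L \<Longrightarrow> l' \<in> L \<Longrightarrow> i < d l \<Longrightarrow> i' < d l' \<Longrightarrow> y l i \<in> B l' i' \<longleftrightarrow> l = l' \<and> i = i'"
  by (auto simp: E_def A_def B_def y_eq yc)

lemma E_eq: "l \<in> L \<Longrightarrow> l' \<in> L \<Longrightarrow> j < 2 * k l \<Longrightarrow> j' < 2 * k l' \<Longrightarrow> E l j = E l' j' \<longleftrightarrow> l = l' \<and> j = j'"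
  by (auto simp: E_def doubleton_eq_iff c_eq)

lemma B_eq: "l \<in> L \<Longrightarrow> l' \<in> L \<Longrightarrow> i < d l \<Longrightarrow> i' < d l' \<Longrightarrow> B l i = B l' i' \<longleftrightarrow> l = l' \<and> i = i'"
  by (metis y_in(3) B_def insertI1 insertI2)

lemma E_neq_B: "l \<in> L \<Longrightarrow> l' \<in> L \<Longrightarrow> j < 2 * k l \<Longrightarrow> i < d l' \<Longrightarrow> E l j \<noteq> B l' i"
  by (metis y_in(1) B_def insertI1 insertI2)

lemma B_neq_E: "l \<in> L \<Longrightarrow> l' \<in> L \<Longrightarrow> j < 2 * k l \<Longrightarrow> i < d l' \<Longrightarrow> B l' i \<noteq> E l j"
  using E_neq_B by metis

lemma vdeg_E: "l \<in> L \<Longrightarrow> j < 2 * k l \<Longrightarrow> vdeg (single (E l j) 1) v = of_bool (v = c l j) + of_bool (v = c l (Suc j))"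
  using c_eq[of l l j "Suc j"] by (auto simp: vdeg_single E_def)

lemma vdeg_A: "l \<in> L \<Longrightarrow> i < d l \<Longrightarrow> vdeg (single (A l i) 1) v = of_bool (v = c l 0) + of_bool (v = y l i)"
  using cy[of l l 0 i] by (auto simp: vdeg_single A_def)

lemma vdeg_B: "l \<in> L \<Longrightarrow> i < d l \<Longrightarrow> vdeg (single (B l i) 1) v = of_bool (v = c l (2 * k l)) + of_bool (v = y l i)"
  using cy[of l l "2 * k l" i] by (auto simp: vdeg_single B_def)

text \<open>The products of \<open>Q\<close> (even path edges) and of \<open>P\<close> without its last element.\<close>

definition qm where "qm l = (\<Sum>t<k l. single (E l (2 * t)) (1::nat))"
definition pm where "pm l = (\<Sum>t<k l - 1. single (E l (2 * t + 1)) (1::nat))"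

text \<open>The simplex \<open>{p, b\<^sub>1, \<dots>, b\<^sub>d}\<close> whose boundary is the sphere.  Removing one vertex \<open>e\<close> from it leaves a face
  of \<open>\<Delta>\<^sub>\<alpha>\<close>; \<open>cofactor l e\<close> is a monomial that completes this face to degree \<open>\<alpha>\<close>.\<close>

definition last_edge where "last_edge l = E l (2 * k l - 1)"
definition nonface where "nonface l = insert (last_edge l) (B l ` {..<d l})"

definition cofactor where
  "cofactor l e = (if e = last_edge l then qm l else single (A l (THE i. i < d l \<and> e = B l i)) 1 + pm l)"

lemma last_edge: "l \<in> L \<Longrightarrow> last_edge l \<in> edges G"
  using k_pos[of l] by (simp add: last_edge_def E_edge)

lemma last_neq_B: "l \<in> L \<Longrightarrow> l' \<in> L \<Longrightarrow> i < d l' \<Longrightarrow> last_edge l \<noteq> B l' i"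
  using k_pos[of l] by (simp add: last_edge_def E_neq_B)

lemma last_eq: "l \<in> L \<Longrightarrow> l' \<in> L \<Longrightarrow> last_edge l = last_edge l' \<longleftrightarrow> l = l'"
  using k_pos[of l] k_pos[of l'] by (auto simp: last_edge_def E_eq)

lemma cofactor_last: "cofactor l (last_edge l) = qm l"
  by (simp add: cofactor_def)

lemma cofactor_B:
  assumes "l \<in> L" "i < d l"
  shows "cofactor l (B l i) = single (A l i) 1 + pm l"
proof -
  have "(THE i'. i' < d l \<and> B l i = B l i') = i" using assms by (auto simp: B_eq)
  then show ?thesis using assms last_neq_B by (auto simp: cofactor_def)
qed

lemma keys_qm: "l \<in> L \<Longrightarrow> keys (qm l) \<subseteq> edges G"
  unfolding qm_def by (rule order_trans[OF keys_sum_subset]) (auto intro: E_edge)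

lemma keys_pm: "l \<in> L \<Longrightarrow> keys (pm l) \<subseteq> edges G"
  unfolding pm_def by (rule order_trans[OF keys_sum_subset]) (auto intro: E_edge)

lemma cofactor_keys: "l \<in> L \<Longrightarrow> e \<in> nonface l \<Longrightarrow> keys (cofactor l e) \<subseteq> edges G"
  using keys_qm[of l] keys_pm[of l]
  by (auto simp: nonface_def cofactor_last cofactor_B keys_nat_add A_edge)

lemma cofactor_mdeg: "l \<in> L \<Longrightarrow> e \<in> nonface l \<Longrightarrow> mdeg (cofactor l e) = k l"
  using k_pos[of l]
  by (auto simp: nonface_def cofactor_last cofactor_B qm_def pm_def mdeg_add mdeg_sum)

text \<open>The equal degrees say that the \<open>2\<close>-minors of the variables against their cofactors lie in the toric
  ideal.  For two edges \<open>b\<^sub>i\<close> and \<open>b\<^sub>t\<close> the minor is a multiple of the binomial of the \<open>4\<close>-cycle through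
  \<open>y\<^sub>i\<close> and \<open>y\<^sub>t\<close>; for \<open>b\<^sub>i\<close> and the last path edge it is the binomial of the cycle of length \<open>2r\<close>
  through \<open>y\<^sub>i\<close>.\<close>

lemma cofactor_minors:
  assumes l: "l \<in> L" and e: "e \<in> nonface l" "e' \<in> nonface l"
  shows "vdeg (single e 1 + cofactor l e') v = vdeg (single e' 1 + cofactor l e) v"
proof -
  have *: "vdeg (single (last_edge l) 1 + cofactor l (B l i)) v = vdeg (single (B l i) 1 + cofactor l (last_edge l)) v"
    if i: "i < d l" for i
  proof -
    define n where "n = k l - 1"
    have n: "k l = Suc n" using k_pos[OF l] by (simp add: n_def)
    define \<chi> where "\<chi> j = (of_bool (v = c l j) :: nat)" for j
    have E: "vdeg (single (E l j) 1) v = \<chi> j + \<chi> (Suc j)" if "j < 2 * k l" for j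
      using vdeg_E[OF l that] by (simp add: \<chi>_def)
    have q: "vdeg (qm l) v = (\<Sum>t<Suc n. \<chi> (2 * t) + \<chi> (2 * t + 1))"
      unfolding qm_def vdeg_sum n by (intro sum.cong) (auto simp: E n simp del: One_nat_def simp flip: Suc_eq_plus1)
    have "vdeg (pm l) v = (\<Sum>t<n. \<chi> (2 * t + 1) + \<chi> (2 * t + 2))"
      unfolding pm_def vdeg_sum n_def[symmetric] by (intro sum.cong) (auto simp: E n simp del: One_nat_def simp flip: Suc_eq_plus1)
    moreover have "vdeg (single (last_edge l) 1) v = \<chi> (2 * n + 1) + \<chi> (2 * n + 2)"
      unfolding last_edge_def by (subst E) (auto simp: n)
    ultimately have p: "vdeg (single (last_edge l) 1) v + vdeg (pm l) v = (\<Sum>t<Suc n. \<chi> (2 * t + 1) + \<chi> (2 * t + 2))"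
      by simp
    show ?thesis
      using telescope[of \<chi> "Suc n"] p q
      by (simp add: cofactor_B[OF l i] cofactor_last vdeg_add vdeg_A[OF l i] vdeg_B[OF l i] n
            \<chi>_def[of 0, symmetric] \<chi>_def[of "Suc (Suc (2 * n))", symmetric] del: sum.lessThan_Suc One_nat_def)
  qed
  show ?thesis using e *
    by (auto simp: nonface_def simp del: One_nat_def)
       (simp add: cofactor_B[OF l] vdeg_add vdeg_A[OF l] vdeg_B[OF l] del: One_nat_def)
qed

definition all_nonfaces where "all_nonfaces = (\<Union>l\<in>L. nonface l)"
definition base_face where "base_face = (\<Union>l\<in>L. B l ` {..<d l})"

lemma nonface_edges: "l \<in> L \<Longrightarrow> nonface l \<subseteq> edges G"
  by (auto simp: nonface_def last_edge B_edge)

lemma all_nonfaces_edges: "all_nonfaces \<subseteq> edges G"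
  using nonface_edges by (auto simp: all_nonfaces_def)

lemma finite_nonfaces: "finite all_nonfaces"
  using all_nonfaces_edges finite_edges finite_subset by blast

lemma nonface_disjoint: "l \<in> L \<Longrightarrow> l' \<in> L \<Longrightarrow> e \<in> nonface l \<Longrightarrow> e \<in> nonface l' \<Longrightarrow> l = l'"
  by (auto simp: nonface_def last_eq B_eq last_neq_B dest: last_neq_B)

lemma base_face_eq: "base_face = all_nonfaces - last_edge ` L"
  by (auto simp: base_face_def all_nonfaces_def nonface_def last_neq_B dest: last_neq_B)

lemma base_face_edges: "base_face \<subseteq> edges G"
  by (auto simp: base_face_def B_edge)

lemma sum_base_face: "(\<Sum>e\<in>base_face. f e) = (\<Sum>l\<in>L. \<Sum>i<d l. f (B l i))"
proof -
  have "(\<Sum>e\<in>base_face. f e) = (\<Sum>l\<in>L. \<Sum>e\<in>B l ` {..<d l}. f e)"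
    unfolding base_face_def using finite_L by (intro sum.UNION_disjoint) (auto simp: B_eq)
  also have "\<dots> = (\<Sum>l\<in>L. \<Sum>i<d l. f (B l i))"
    by (intro sum.cong refl, subst sum.reindex) (auto simp: inj_on_def B_eq)
  finally show ?thesis .
qed

lemma card_base_face: "card base_face = (\<Sum>l\<in>L. d l)"
  using sum_base_face[of "\<lambda>_. 1::nat"] by simp

lemma card_all_nonfaces: "card all_nonfaces = (\<Sum>l\<in>L. d l) + card L"
proof -
  have "last_edge ` L \<subseteq> all_nonfaces" by (auto simp: all_nonfaces_def nonface_def)
  then have "card base_face = card all_nonfaces - card (last_edge ` L)" "card (last_edge ` L) \<le> card all_nonfaces"
    unfolding base_face_eq using finite_L finite_nonfaces by (auto intro: card_Diff_subset card_mono)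
  moreover have "card (last_edge ` L) = card L" by (intro card_image) (auto simp: inj_on_def last_eq)
  ultimately show ?thesis by (simp add: card_base_face)
qed

text \<open>A monomial of vertex degree \<open>\<alpha>\<close>: the product of the facets \<open>{b\<^sub>1, \<dots>, b\<^sub>d} \<union> Q\<close> of all components.\<close>

definition homology_deg where "homology_deg = (\<Sum>l\<in>L. qm l) + ind base_face"

lemma vdeg_homology_deg: "vdeg homology_deg v = (\<Sum>l\<in>L. (\<Sum>t<k l. vdeg (single (E l (2 * t)) 1) v) + (\<Sum>i<d l. vdeg (single (B l i) 1) v))"
  unfolding homology_deg_def ind_def sum_base_face vdeg_add vdeg_sum qm_def by (simp add: sum.distrib)

lemma vdeg_homology_deg_y:
  assumes "l \<in> L" "i < d l"
  shows "vdeg homology_deg (y l i) = 1"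
proof -
  have "vdeg homology_deg (y l i) = (\<Sum>l'\<in>L. if l' = l then 1 else 0)"
    unfolding vdeg_homology_deg
  proof (intro sum.cong refl)
    fix l' assume l': "l' \<in> L"
    have "(\<Sum>t<k l'. vdeg (single (E l' (2 * t)) 1) (y l i)) = 0"
      using assms l' by (intro sum.neutral) (auto simp: vdeg_single y_in)
    moreover have "(\<Sum>i'<d l'. vdeg (single (B l' i') 1) (y l i)) = (\<Sum>i'<d l'. if i' = i then (if l' = l then 1 else 0) else 0)"
      using assms l' by (intro sum.cong) (auto simp: vdeg_single y_in)
    ultimately show "(\<Sum>t<k l'. vdeg (single (E l' (2 * t)) 1) (y l i)) + (\<Sum>i'<d l'. vdeg (single (B l' i') 1) (y l i))
        = (if l' = l then 1 else 0)" using assms by (simp add: sum.delta)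
  qed
  then show ?thesis using assms finite_L by (simp add: sum.delta)
qed

lemma vdeg_homology_deg_c:
  assumes "l \<in> L" "j \<le> 2 * k l"
  shows "vdeg homology_deg (c l j) = (if j = 2 * k l then d l else 1)"
proof -
  have "vdeg homology_deg (c l j) = (\<Sum>l'\<in>L. if l' = l then (if j = 2 * k l then d l else 1) else 0)"
    unfolding vdeg_homology_deg
  proof (intro sum.cong refl)
    fix l' assume l': "l' \<in> L"
    have "(\<Sum>t<k l'. vdeg (single (E l' (2 * t)) 1) (c l j))
        = (\<Sum>t<k l'. if t = j div 2 then (if l' = l then 1 else 0) else 0)"
      using assms l' by (intro sum.cong) (auto simp: vdeg_single c_in)
    also have "\<dots> = (if l' = l \<and> j \<noteq> 2 * k l then 1 else 0)"
      using assms by (auto simp: sum.delta)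
    finally have 1: "(\<Sum>t<k l'. vdeg (single (E l' (2 * t)) 1) (c l j)) = (if l' = l \<and> j \<noteq> 2 * k l then 1 else 0)" .
    have 2: "(\<Sum>i<d l'. vdeg (single (B l' i) 1) (c l j)) = (\<Sum>i<d l'. if l' = l \<and> j = 2 * k l then 1 else 0)"
      using assms l' by (intro sum.cong) (auto simp: vdeg_single c_in)
    show "(\<Sum>t<k l'. vdeg (single (E l' (2 * t)) 1) (c l j)) + (\<Sum>i<d l'. vdeg (single (B l' i) 1) (c l j))
        = (if l' = l then (if j = 2 * k l then d l else 1) else 0)" unfolding 1 2 by simp
  qed
  then show ?thesis using assms finite_L by (simp add: sum.delta)
qed

lemma vdeg_homology_deg_pos:
  assumes "vdeg homology_deg v > 0"
  shows "\<exists>l\<in>L. (\<exists>j\<le>2 * k l. v = c l j) \<or> (\<exists>i<d l. v = y l i)"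
proof (rule ccontr)
  assume no: "\<not> ?thesis"
  have "vdeg (single (E l (2 * t)) 1) v = 0" if "l \<in> L" "t < k l" for l t
  proof -
    have "2 * t \<le> 2 * k l" "Suc (2 * t) \<le> 2 * k l" using that by auto
    then have "v \<noteq> c l (2 * t)" "v \<noteq> c l (Suc (2 * t))" using no that(1) by blast+
    then show ?thesis by (simp add: vdeg_single E_def)
  qed
  moreover have "vdeg (single (B l i) 1) v = 0" if "l \<in> L" "i < d l" for l i
    using no that by (auto simp: vdeg_single B_def)
  ultimately have "vdeg homology_deg v = 0" unfolding vdeg_homology_deg by (simp add: sum.neutral)
  then show False using assms by simp
qed

text \<open>The retraction identifies the edges of \<open>even_class l\<close> and maps no other edge to \<open>B l 0\<close>.  The
  transversals are the edge sets that it maps bijectively to the facet \<open>base_face\<close> of the sphere.\<close>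

definition even_class where "even_class l = insert (B l 0) ((\<lambda>t. E l (2 * t)) ` {..<k l})"
definition core where "core = (\<Union>l\<in>L. B l ` {0<..<d l})"
definition transversals where
  "transversals = {F. F \<subseteq> core \<union> (\<Union>l\<in>L. even_class l) \<and> core \<subseteq> F \<and> (\<forall>l\<in>L. \<exists>!q. q \<in> F \<and> q \<in> even_class l)}"

lemma even_class_edges: "l \<in> L \<Longrightarrow> even_class l \<subseteq> edges G"
  using d_pos[of l] by (auto simp: even_class_def intro!: B_edge E_edge)

lemma even_class_disjoint: "l \<in> L \<Longrightarrow> l' \<in> L \<Longrightarrow> q \<in> even_class l \<Longrightarrow> q \<in> even_class l' \<Longrightarrow> l = l'"
  using d_pos[of l] d_pos[of l']
  by (auto simp: even_class_def B_eq E_eq E_neq_B B_neq_E)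

lemma core_even_class: "l \<in> L \<Longrightarrow> q \<in> even_class l \<Longrightarrow> q \<notin> core"
  using d_pos[of l] by (auto simp: even_class_def core_def B_eq E_neq_B B_neq_E)

lemma core_edges: "core \<subseteq> edges G"
  by (auto simp: core_def B_edge)

lemma B_core: "l \<in> L \<Longrightarrow> i \<noteq> 0 \<Longrightarrow> i < d l \<Longrightarrow> B l i \<in> core"
  unfolding core_def by (rule UN_I, assumption) auto

lemma transversal_edges: "F \<in> transversals \<Longrightarrow> F \<subseteq> edges G"
  using core_edges even_class_edges by (auto simp: transversals_def) blast

lemma finite_transversals: "finite transversals"
  using finite_subset[of transversals "Pow (edges G)"] transversal_edges finite_edges by blast

lemma base_face_transversal: "base_face \<in> transversals"
proof -
  have "base_face \<subseteq> core \<union> (\<Union>l\<in>L. even_class l)"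
  proof
    fix e assume "e \<in> base_face"
    then obtain l i where li: "l \<in> L" "i < d l" "e = B l i" by (auto simp: base_face_def)
    then show "e \<in> core \<union> (\<Union>l\<in>L. even_class l)"
      by (cases "i = 0") (auto simp: B_core even_class_def)
  qed
  moreover have "core \<subseteq> base_face" by (auto simp: core_def base_face_def)
  moreover have "\<exists>!q. q \<in> base_face \<and> q \<in> even_class l" if "l \<in> L" for l
  proof (rule ex1I[of _ "B l 0"])
    show "B l 0 \<in> base_face \<and> B l 0 \<in> even_class l"
    proof
      show "B l 0 \<in> base_face" unfolding base_face_def
        by (rule UN_I[OF that]) (use d_pos[OF that] in auto)
    qed (simp add: even_class_def)
    fix q assume "q \<in> base_face \<and> q \<in> even_class l"
    then obtain l' i where "l' \<in> L" "i < d l'" "q = B l' i" and q: "q \<in> even_class l"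
      by (auto simp: base_face_def)
    then have "q \<noteq> E l (2 * t)" if "t < k l" for t
      using B_neq_E[OF \<open>l \<in> L\<close>, of l' "2 * t" i] that by simp
    then show "q = B l 0" using q by (auto simp: even_class_def)
  qed
  ultimately show ?thesis by (simp add: transversals_def)
qed

text \<open>The fundamental cycle and the cocycle only meet in the facet \<open>base_face\<close>.\<close>

lemma transversal_in_nonfaces:
  assumes "F \<in> transversals" "F \<subseteq> all_nonfaces" "card F = card base_face"
  shows "F = base_face"
proof -
  have "B l i \<in> F" if li: "l \<in> L" "i < d l" for l i
  proof (cases "i = 0")
    case False
    then show ?thesis using assms(1) B_core[OF li(1)] li(2) by (auto simp: transversals_def)
  next
    case True
    obtain q where q: "q \<in> F" "q \<in> even_class l" using assms(1) li by (auto simp: transversals_def)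
    moreover have "q \<noteq> E l (2 * t)" if "t < k l" for t
    proof
      assume "q = E l (2 * t)"
      moreover obtain l' where "l' \<in> L" "q \<in> nonface l'"
        using q(1) assms(2) by (auto simp: all_nonfaces_def)
      moreover have "2 * t \<noteq> 2 * k l - 1" using k_pos[OF li(1)] by presburger
      ultimately show False using li that k_pos[of l'] E_neq_B[OF li(1) _ _ , of l' "2 * t"]
        by (auto simp: nonface_def last_edge_def E_eq)
    qed
    ultimately show ?thesis using True by (auto simp: even_class_def)
  qed
  then have "base_face \<subseteq> F" by (auto simp: base_face_def)
  moreover have "finite F" using assms(2) finite_nonfaces finite_subset by blast
  ultimately show ?thesis using assms(3) by (metis card_subset_eq)
qed

text \<open>The geometric reason for the cocycle property: the sphere has no simplex that properly contains
  \<open>base_face\<close>, so a face of \<open>\<Delta>\<^sub>\<alpha>\<close> that contains one more edge than a transversal maps to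
  \<open>base_face\<close> again.  If the new edge is \<open>a\<^sub>i\<close> or an odd path edge, then by parity along the path
  no even path edge occurs, so all \<open>b\<^sub>i\<close> do, which exceeds the degree of \<open>y\<^sub>i\<close> or of \<open>x\<^sub>2\<close>.\<close>

lemma transversal_extension:
  assumes F: "F \<in> transversals" and e: "e \<in> edges G" "e \<notin> F" and m: "keys m \<subseteq> edges G"
    and homology_deg: "\<And>v. vdeg (m + ind (insert e F)) v = vdeg homology_deg v"
  shows "\<exists>l\<in>L. e \<in> even_class l"
proof -
  define M where "M = m + ind (insert e F)"
  have finF: "finite F" using transversal_edges[OF F] finite_edges finite_subset by blast
  have lM: "lookup M f \<ge> 1" if "f \<in> insert e F" for f
    using that finF by (simp add: M_def lookup_add lookup_ind)
  have keysM: "keys M \<subseteq> edges G"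
    using m e(1) transversal_edges[OF F] finF
    by (auto simp: M_def keys_nat_add in_keys_iff lookup_ind split: if_splits)
  have vM: "vdeg M v = vdeg homology_deg v" for v using homology_deg by (simp add: M_def)
  have le: "lookup M f \<le> vdeg homology_deg v" if "v \<in> f" for v f
    using sum_le_vdeg[of "{f}" v M] that by (simp add: vM)
  have inW: "\<exists>l\<in>L. (\<exists>j\<le>2 * k l. v = c l j) \<or> (\<exists>i<d l. v = y l i)" if "f \<in> keys M" "v \<in> f" for f v
    using vdeg_homology_deg_pos[of v] le[OF that(2)] that(1) by (simp add: in_keys_iff)
  have two: "lookup M f + lookup M f' \<le> vdeg homology_deg v" if "v \<in> f" "v \<in> f'" "f \<noteq> f'" for v f f'
  proof -
    have "(\<Sum>g\<in>{f, f'}. lookup M g) \<le> vdeg M v" by (rule sum_le_vdeg) (use that in auto)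
    then show ?thesis using that(3) by (simp add: vM)
  qed
  have path: "lookup M (E l j) + lookup M (E l (Suc j)) = 1" if l: "l \<in> L" "Suc j < 2 * k l" for l j
  proof -
    have "vdeg M (c l (Suc j)) = (\<Sum>f\<in>{E l j, E l (Suc j)}. lookup M f)"
    proof (rule vdeg_eq_sum)
      fix f assume f: "f \<in> keys M" "c l (Suc j) \<in> f"
      then have "f \<in> edges G" using keysM by blast
      from this inW[OF f(1)] show "f \<in> {E l j, E l (Suc j)}"
        by (rule induced) (use f(2) l in \<open>auto simp: c_in\<close>)
    qed (use l in \<open>auto simp: c_in\<close>)
    moreover have "E l j \<noteq> E l (Suc j)" using l by (simp add: E_eq)
    ultimately show ?thesis using vM vdeg_homology_deg_c[of l "Suc j"] l by simp
  qed
  have parity: "lookup M (E l j) = (if even j then lookup M (E l 0) else 1 - lookup M (E l 0))"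
    if "l \<in> L" "j < 2 * k l" for l j
    using that(2)
  proof (induction j)
    case (Suc j)
    have "lookup M (E l j) + lookup M (E l (Suc j)) = 1" using path that(1) Suc.prems by simp
    moreover have "lookup M (E l 0) \<le> 1" using path[of l 0] that(1) k_pos[of l] by simp
    ultimately show ?case using Suc by auto
  qed simp
  have all_B: "lookup M (B l i) \<ge> 1" if l: "l \<in> L" "lookup M (E l 0) = 0" "i < d l" for l i
  proof (cases "i = 0")
    case False
    then have "B l i \<in> F" using F B_core[OF l(1)] l(3) by (auto simp: transversals_def)
    then show ?thesis using lM by blast
  next
    case True
    obtain q where q: "q \<in> F" "q \<in> even_class l" using F l by (auto simp: transversals_def)
    have "q \<noteq> E l (2 * t)" if "t < k l" for t
      using lM[of q] q(1) parity[of l "2 * t"] l that by auto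
    then show ?thesis using True q lM by (auto simp: even_class_def)
  qed
  have "e \<in> keys M" using lM[of e] by (simp add: in_keys_iff)
  consider (1) l j where "l \<in> L" "j < 2 * k l" "e = E l j" | (2) l i where "l \<in> L" "i < d l" "e = A l i"
    | (3) l i where "l \<in> L" "i < d l" "e = B l i"
    using induced[OF e(1) inW[OF \<open>e \<in> keys M\<close>]] by blast
  then show ?thesis
  proof cases
    case (1 l j)
    show ?thesis
    proof (cases "even j")
      case True
      then obtain t where "j = 2 * t" by (elim evenE)
      then have "e \<in> even_class l" using 1 by (auto simp: even_class_def)
      then show ?thesis using 1 by blast
    next
      case False
      then have "lookup M (E l 0) = 0" using parity[of l j] lM[of e] 1 by (cases "lookup M (E l 0)") auto
      moreover from this have "lookup M (last_edge l) = 1"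
        using parity[of l "2 * k l - 1"] 1 k_pos[of l] by (simp add: last_edge_def)
      moreover have "(\<Sum>f\<in>nonface l. lookup M f) \<le> vdeg M (c l (2 * k l))"
        using 1 k_pos[of l]
        by (intro sum_le_vdeg) (auto simp: nonface_def last_edge_def c_in)
      moreover have "(\<Sum>f\<in>nonface l. lookup M f) = lookup M (last_edge l) + (\<Sum>i<d l. lookup M (B l i))"
        unfolding nonface_def using 1 last_neq_B[of l l]
        by (subst sum.insert) (auto simp: sum.reindex inj_on_def B_eq)
      moreover have "(\<Sum>i<d l. 1) \<le> (\<Sum>i<d l. lookup M (B l i))"
        by (intro sum_mono all_B) (use 1 calculation(1) in auto)
      ultimately show ?thesis using vM vdeg_homology_deg_c[of l "2 * k l"] 1 by simp
    qed
  next
    case (2 l i)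
    have "lookup M (A l i) + lookup M (E l 0) \<le> vdeg homology_deg (c l 0)"
      using 2 k_pos[of l] y_in(1)[of l l i 0] by (intro two) (auto simp: c_in A_def)
    then have "lookup M (E l 0) = 0"
      using lM[of e] 2 vdeg_homology_deg_c[of l 0] k_pos[of l] by simp
    then have "lookup M (B l i) \<ge> 1" using all_B 2 by blast
    moreover have "lookup M (A l i) + lookup M (B l i) \<le> vdeg homology_deg (y l i)"
      using 2 k_pos[of l] c_in(2)[of l l 0 i] c_in(3)[of l l 0 i] by (intro two) (auto simp: y_in)
    ultimately show ?thesis using lM[of e] 2 vdeg_homology_deg_y[of l i] by simp
  next
    case (3 l i)
    then have "i = 0" using e(2) F B_core[of l i] by (cases "i = 0") (auto simp: transversals_def)
    then have "e \<in> even_class l" using 3 by (simp add: even_class_def)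
    then show ?thesis using 3 by blast
  qed
qed

end

section \<open>The homology class of the sphere\<close>

text \<open>The variables are ordered so that each even class is a block.  The retraction then preserves the
  order of the elements of a transversal, and all signs in the cocycle are \<open>1\<close>.\<close>

locale ear_koszul = ear_graphs G L k d c y + koszul "edges G" idx
  for G :: "'v graph" and L :: "nat set" and k d :: "nat \<Rightarrow> nat" and c y :: "nat \<Rightarrow> nat \<Rightarrow> 'v"
    and idx :: "'v set \<Rightarrow> nat" +
  assumes even_class_contiguous: "l \<in> L \<Longrightarrow> q \<in> even_class l \<Longrightarrow> q' \<in> even_class l \<Longrightarrow>
    f \<in> edges G \<Longrightarrow> f \<notin> even_class l \<Longrightarrow> idx f < idx q \<longleftrightarrow> idx f < idx q'"
begin

text \<open>The fundamental cycle of a join of boundaries of simplices arises from the union of these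
  simplices by contracting successively with one form for each simplex.  The coefficients \<open>cofactor\<close>
  make the result homogeneous of vertex degree \<open>\<alpha>\<close>.\<close>

definition cofactor_form :: "nat \<Rightarrow> 'v set \<Rightarrow> ('v set, 'k::field) mpoly" where
  "cofactor_form l e = (if e \<in> nonface l then single (cofactor l e) 1 else 0)"

definition top_chain :: "'v set set \<Rightarrow> ('v set, 'k::field) mpoly" where
  "top_chain F = (if F = all_nonfaces then 1 else 0)"

definition sphere_chain :: "nat list \<Rightarrow> 'v set set \<Rightarrow> ('v set, 'k::field) mpoly" where
  "sphere_chain ls = foldr (\<lambda>l. contract (cofactor_form l)) ls top_chain"

lemma sphere_chain_simps [simp]:
  "sphere_chain [] = top_chain"
  "sphere_chain (l # ls) = contract (cofactor_form l) (sphere_chain ls)"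
  by (simp_all add: sphere_chain_def)

lemma cofactor_form_ring: "l \<in> L \<Longrightarrow> cofactor_form l e \<in> poly_ring (edges G)"
  using cofactor_keys by (simp add: cofactor_form_def poly_ring_single)

lemma sphere_chain_ring: "set ls \<subseteq> L \<Longrightarrow> sphere_chain ls F \<in> poly_ring (edges G)"
  by (induction ls arbitrary: F)
     (auto simp: top_chain_def intro!: contract_poly_ring cofactor_form_ring)

lemma sphere_chain_support:
  assumes "sphere_chain ls F \<noteq> (0 :: ('v set, 'k::field) mpoly)"
  shows "F \<subseteq> all_nonfaces \<and> card F + length ls = card all_nonfaces"
  using assms
proof (induction ls arbitrary: F)
  case (Cons l ls)
  have "contract (cofactor_form l) (sphere_chain ls) F \<noteq> (0 :: ('v set, 'k) mpoly)"
    using Cons.prems by simp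
  then obtain e where e: "e \<notin> F" "sphere_chain ls (insert e F) \<noteq> (0 :: ('v set, 'k) mpoly)"
    by (rule contract_nonzero)
  then have IH: "insert e F \<subseteq> all_nonfaces" "card (insert e F) + length ls = card all_nonfaces"
    using Cons.IH[OF e(2)] by blast+
  then have "F \<subseteq> all_nonfaces" by simp
  moreover from this have "finite F" using finite_nonfaces by (rule finite_subset)
  ultimately show ?case using e(1) IH(2) by simp
qed (auto simp: top_chain_def split: if_splits)

lemma sphere_chain_homog:
  assumes "set ls \<subseteq> L"
  shows "homog (card F) (card all_nonfaces + (\<Sum>l\<leftarrow>ls. k l - 1)) (sphere_chain ls F :: ('v set, 'k::field) mpoly)"
  using assms
proof (induction ls arbitrary: F)
  case Nil
  then show ?case by (auto simp: top_chain_def homog_one)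
next
  case (Cons l ls)
  let ?J = "card all_nonfaces + (\<Sum>l\<leftarrow>ls. k l - 1)"
  show ?case
  proof (cases "F \<subseteq> edges G")
    case True
    then have "finite F" using finite_edges finite_subset by blast
    have "homog (card F) (?J + (k l - 1)) (sg idx e F * cofactor_form l e * (sphere_chain ls (insert e F) :: ('v set, 'k) mpoly))"
      if "e \<in> edges G - F" for e
    proof (intro homog_mult)
      show "homog (card F) (card F) (sg idx e F :: ('v set, 'k) mpoly)" by (rule homog_sg)
      show "homog (card F) (card F + k l) (cofactor_form l e :: ('v set, 'k) mpoly)"
        using Cons.prems cofactor_mdeg[of l e] by (auto simp: cofactor_form_def homog_def)
      have "card (insert e F) + (k l - 1) = card F + k l"
        using that \<open>finite F\<close> k_pos[of l] Cons.prems by simp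
      moreover have "homog (card (insert e F)) ?J (sphere_chain ls (insert e F) :: ('v set, 'k) mpoly)"
        using Cons by simp
      ultimately show "homog (card F + k l) (?J + (k l - 1)) (sphere_chain ls (insert e F) :: ('v set, 'k) mpoly)"
        by (metis homog_shift)
    qed
    then show ?thesis using True by (auto simp: contract_def ac_simps intro!: homog_sum)
  qed (simp add: contract_def)
qed

text \<open>The part of the Koszul differential that removes vertices of the \<open>l\<close>-th simplex anticommutes with
  the other contractions, and modulo the toric ideal it is proportional to the \<open>l\<close>-th one.\<close>

lemma partial_boundary_in_toric_ideal:
  assumes "set ls \<subseteq> L" "l \<in> set ls"
  shows "contract (\<lambda>e. if e \<in> nonface l then Var e else 0) (sphere_chain ls) F
    \<in> (toric_ideal G :: ('v set, 'k::field) mpoly set)"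
  using assms
proof (induction ls arbitrary: F)
  case (Cons l' ls)
  let ?f = "\<lambda>e. if e \<in> nonface l then Var e else 0 :: ('v set, 'k) mpoly"
  show ?case
  proof (cases "l' = l")
    case True
    have minor: "?f e * cofactor_form l e' - ?f e' * cofactor_form l e \<in> toric_ideal G"
      if e: "e \<in> edges G" "e' \<in> edges G" for e e'
    proof (cases "e \<in> nonface l \<and> e' \<in> nonface l")
      case True
      have "single (single e 1 + cofactor l e') 1 - single (single e' 1 + cofactor l e) 1
          \<in> (toric_ideal G :: ('v set, 'k) mpoly set)"
        using True e Cons.prems \<open>l' = l\<close> cofactor_keys cofactor_minors[of l e e']
        by (intro toric_binomial) (auto simp: keys_nat_add)
      then show ?thesis using True by (simp add: cofactor_form_def Var_def mult_single)
    qed (auto simp: cofactor_form_def)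
    show ?thesis unfolding sphere_chain_simps True
      by (rule contract_minors)
         (use minor Cons.prems sphere_chain_ring in \<open>auto intro: toric_add toric_mult\<close>)
  next
    case False
    have IH: "contract ?f (sphere_chain ls) F \<in> toric_ideal G" for F
      using Cons False by simp
    have "contract (cofactor_form l') (contract ?f (sphere_chain ls)) F \<in> toric_ideal G"
      by (rule contract_ideal)
         (use IH Cons.prems in \<open>auto intro: toric_add toric_mult cofactor_form_ring\<close>)
    from toric_mult[OF poly_ring_uminus[OF poly_ring_one] this]
    show ?thesis unfolding sphere_chain_simps contract_anticommute[of ?f] by simp
  qed
qed simp

lemma boundary_in_toric_ideal:
  assumes "set ls = L"
  shows "contract Var (sphere_chain ls) F \<in> (toric_ideal G :: ('v set, 'k::field) mpoly set)"
proof (cases "F \<subseteq> edges G")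
  case True
  let ?f = "\<lambda>l e. if e \<in> nonface l then Var e else 0 :: ('v set, 'k) mpoly"
  have "sg idx e F * Var e * (sphere_chain ls (insert e F) :: ('v set, 'k) mpoly)
      = (\<Sum>l\<in>L. sg idx e F * ?f l e * sphere_chain ls (insert e F))" for e
  proof (cases "sphere_chain ls (insert e F) = (0 :: ('v set, 'k) mpoly)")
    case False
    then have "e \<in> all_nonfaces" using sphere_chain_support by blast
    then obtain l0 where l0: "l0 \<in> L" "e \<in> nonface l0" by (auto simp: all_nonfaces_def)
    have "?f l e = (if l = l0 then Var e else 0)" if "l \<in> L" for l
      using nonface_disjoint that l0 by auto
    then have "(\<Sum>l\<in>L. ?f l e) = Var e" using l0 finite_L by (simp add: sum.delta)
    then show ?thesis by (simp only: sum_distrib_left[symmetric] sum_distrib_right[symmetric])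
  qed simp
  then have eq: "contract Var (sphere_chain ls) F = (\<Sum>l\<in>L. contract (?f l) (sphere_chain ls) F)"
    using True by (simp add: contract_def sum.swap[of _ L])
  have sub: "set ls \<subseteq> L" "\<And>l. l \<in> L \<Longrightarrow> l \<in> set ls" using assms by auto
  show ?thesis unfolding eq by (intro toric_sum partial_boundary_in_toric_ideal sub)
qed (simp add: contract_def)

text \<open>At the facet that omits the last path edges there is a single way to contract: the form of the
  \<open>l\<close>-th simplex has to remove its own last path edge.\<close>

lemma sphere_chain_value:
  assumes "set ls \<subseteq> L" "distinct ls"
  shows "\<exists>\<sigma>. (\<sigma> = 1 \<or> \<sigma> = - 1) \<and>
    sphere_chain ls (all_nonfaces - last_edge ` set ls)
      = single (\<Sum>l\<in>set ls. qm l) (\<sigma> :: 'k::field)"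
  using assms
proof (induction ls)
  case Nil
  then show ?case by (intro exI[of _ 1]) (simp add: top_chain_def)
next
  case (Cons l ls)
  then obtain \<sigma> where \<sigma>: "\<sigma> = 1 \<or> \<sigma> = - 1"
    "sphere_chain ls (all_nonfaces - last_edge ` set ls) = single (\<Sum>l\<in>set ls. qm l) (\<sigma> :: 'k)" by auto
  have l: "l \<in> L" using Cons.prems by simp
  let ?F = "all_nonfaces - last_edge ` set (l # ls)" and ?p = "last_edge l"
  have p: "?p \<in> all_nonfaces" "?p \<notin> last_edge ` set ls"
    using Cons.prems l by (auto simp: all_nonfaces_def nonface_def last_eq)
  then have ins: "insert ?p ?F = all_nonfaces - last_edge ` set ls" by auto
  have zero: "cofactor_form l e * sphere_chain ls (insert e ?F) = (0 :: ('v set, 'k) mpoly)"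
    if e: "e \<in> edges G - ?F" "e \<noteq> ?p" for e
  proof (cases "e \<in> nonface l")
    case True
    then have "e \<in> last_edge ` set ls" using e l by (auto simp: all_nonfaces_def)
    then obtain l' where l': "l' \<in> set ls" "e = last_edge l'" by blast
    then have "l' = l" using True l Cons.prems(1) nonface_disjoint[of l' l e] by (auto simp: nonface_def)
    then show ?thesis using l' e(2) by simp
  qed (simp add: cofactor_form_def)
  have F_edges: "?F \<subseteq> edges G" using all_nonfaces_edges by blast
  have "sphere_chain (l # ls) ?F
      = (\<Sum>e\<in>edges G - ?F. sg idx e ?F * cofactor_form l e * (sphere_chain ls (insert e ?F) :: ('v set, 'k) mpoly))"
    unfolding sphere_chain_simps contract_def using F_edges by (rule if_P)
  also have "\<dots> = (\<Sum>e\<in>edges G - ?F. if e = ?p then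
      sg idx ?p ?F * (cofactor_form l ?p * sphere_chain ls (insert ?p ?F)) else (0 :: ('v set, 'k) mpoly))"
  proof (intro sum.cong refl)
    fix e assume e: "e \<in> edges G - ?F"
    show "sg idx e ?F * cofactor_form l e * sphere_chain ls (insert e ?F) = (if e = ?p then
      sg idx ?p ?F * (cofactor_form l ?p * sphere_chain ls (insert ?p ?F)) else (0 :: ('v set, 'k) mpoly))"
    proof (cases "e = ?p")
      case True
      show ?thesis by (simp only: True mult.assoc if_True simp_thms)
    next
      case False
      then show ?thesis by (simp only: mult.assoc zero[OF e False] mult_zero_right if_False)
    qed
  qed
  also have "\<dots> = sg idx ?p ?F * (cofactor_form l ?p * sphere_chain ls (insert ?p ?F))"
    using finite_edges last_edge[OF l] by (simp add: sum.delta)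
  also have "cofactor_form l ?p * sphere_chain ls (insert ?p ?F) = single (\<Sum>l\<in>set (l # ls). qm l) \<sigma>"
    unfolding ins \<sigma>(2) using Cons.prems
    by (simp add: cofactor_form_def nonface_def cofactor_last mult_single)
  finally have *: "sphere_chain (l # ls) ?F = sg idx ?p ?F * single (\<Sum>l\<in>set (l # ls). qm l) \<sigma>" .
  show ?case
  proof (cases "even (card {f \<in> ?F. idx f < idx ?p})")
    case True
    then show ?thesis using * \<sigma>(1) by (intro exI[of _ \<sigma>]) (simp add: sg_def)
  next
    case False
    then show ?thesis using * \<sigma>(1) by (intro exI[of _ "- \<sigma>"]) (auto simp: sg_def single_uminus)
  qed
qed

text \<open>The cochain that is \<open>1\<close> on \<open>base_face\<close>, pulled back along the retraction and evaluated on the part of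
  vertex degree \<open>\<alpha>\<close>.\<close>

definition cocycle :: "('v set set \<Rightarrow> ('v set, 'k::field) mpoly) \<Rightarrow> 'k" where
  "cocycle w = (\<Sum>F\<in>transversals. csum (\<lambda>m. \<forall>v. vdeg (m + ind F) v = vdeg homology_deg v) (w F))"

lemma cocycle_add: "cocycle (\<lambda>F. u F + w F) = cocycle u + cocycle w"
  by (simp add: cocycle_def csum_add sum.distrib)

lemma cocycle_toric_ideal:
  assumes "\<And>F. w F \<in> toric_ideal G"
  shows "cocycle w = 0"
  unfolding cocycle_def vdeg_add by (intro sum.neutral ballI toric_csum assms)

text \<open>A face that occurs here contains, by \<open>transversal_extension\<close>, exactly two elements of one even
  class.  It is reached from the two transversals that omit either of them, with opposite signs.\<close>

lemma cocycle_boundary: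
  fixes u :: "'v set set \<Rightarrow> ('v set, 'k::field) mpoly"
  assumes u: "\<And>F. u F \<in> poly_ring (edges G)"
  shows "cocycle (contract Var u) = 0"
proof -
  let ?P = "\<lambda>F m. \<forall>v. vdeg (m + ind F) v = vdeg homology_deg v"
  define C where "C F = csum (?P F) (u F)" for F
  define g where "g = (\<lambda>(F, e). sg idx e F * C (insert e F))"
  define swaps where "swaps = {(F, e). F \<in> transversals \<and> e \<in> edges G - F \<and> (\<exists>l\<in>L. e \<in> even_class l)}"
  have "csum (?P F) (contract Var u F) = (\<Sum>e\<in>edges G - F. g (F, e))" if F: "F \<in> transversals" for F
  proof -
    have "csum (?P F) (sg idx e F * Var e * u (insert e F)) = g (F, e)" if e: "e \<in> edges G - F" for e
    proof -
      have "finite F" using transversal_edges[OF F] finite_edges finite_subset by blast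
      then have "ind (insert e F) = single e 1 + ind F" using e by (intro ind_insert) auto
      then have "(\<lambda>m. ?P F (single e 1 + m)) = ?P (insert e F)"
        by (simp add: vdeg_add add_ac)
      then show ?thesis by (simp add: g_def C_def csum_sg_times csum_Var_times mult.assoc)
    qed
    then show ?thesis using transversal_edges[OF F] by (simp add: contract_def csum_sum)
  qed
  then have "cocycle (contract Var u) = (\<Sum>F\<in>transversals. \<Sum>e\<in>edges G - F. g (F, e))"
    by (simp add: cocycle_def)
  also have "\<dots> = (\<Sum>x\<in>(SIGMA F:transversals. edges G - F). g x)"
    using finite_transversals finite_edges by (subst sum.Sigma) auto
  also have "\<dots> = (\<Sum>x\<in>swaps. g x)"
  proof (rule sum.mono_neutral_right)
    show "finite (SIGMA F:transversals. edges G - F)"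
      using finite_transversals finite_edges by auto
    show "swaps \<subseteq> (SIGMA F:transversals. edges G - F)" by (auto simp: swaps_def)
    show "\<forall>x\<in>(SIGMA F:transversals. edges G - F) - swaps. g x = 0"
    proof
      fix x assume x: "x \<in> (SIGMA F:transversals. edges G - F) - swaps"
      then obtain F e where Fe: "x = (F, e)" "F \<in> transversals" "e \<in> edges G" "e \<notin> F"
        "\<not> (\<exists>l\<in>L. e \<in> even_class l)" by (auto simp: swaps_def)
      have "csum (?P (insert e F)) (u (insert e F)) = csum (\<lambda>_. False) (u (insert e F))"
      proof (intro csum_cong)
        fix m assume "m \<in> keys (u (insert e F))"
        then have "keys m \<subseteq> edges G" using u by (auto simp: poly_ring_def)
        then show "?P (insert e F) m \<longleftrightarrow> False"
          using transversal_extension[OF Fe(2,3,4)] Fe(5) by blast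
      qed
      then show "g x = 0" by (simp add: g_def Fe(1) C_def)
    qed
  qed
  also have "\<dots> = 0"
  proof -
    \<comment> \<open>Exchange \<open>e\<close> with the element of its class that the transversal contains.\<close>
    define cls where "cls e = (THE l. l \<in> L \<and> e \<in> even_class l)" for e
    define rep where "rep F l = (THE q. q \<in> F \<and> q \<in> even_class l)" for F l
    define \<tau> where "\<tau> = (\<lambda>(F, e). (insert e (F - {rep F (cls e)}), rep F (cls e)))"
    define pos where "pos = (\<lambda>(F, e). idx e < idx (rep F (cls e)))"
    have cls: "cls e = l" if "l \<in> L" "e \<in> even_class l" for l e
      unfolding cls_def using that even_class_disjoint by blast
    have repD: "rep F l \<in> F \<and> rep F l \<in> even_class l" if "F \<in> transversals" "l \<in> L" for F l
      unfolding rep_def by (rule theI') (use that in \<open>simp add: transversals_def\<close>)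
    have rep_eq: "q = rep F l" if "F \<in> transversals" "l \<in> L" "q \<in> F" "q \<in> even_class l" for F l q
    proof -
      have "\<exists>!q. q \<in> F \<and> q \<in> even_class l" using that by (simp add: transversals_def)
      then show ?thesis using that(3,4) repD[OF that(1,2)] by blast
    qed
    have key: "\<tau> (F, e) \<in> swaps \<and> \<tau> (\<tau> (F, e)) = (F, e) \<and> g (\<tau> (F, e)) = - g (F, e) \<and>
        (pos (\<tau> (F, e)) \<longleftrightarrow> \<not> pos (F, e))" if x: "(F, e) \<in> swaps" for F e
    proof -
      obtain l where F: "F \<in> transversals" and e: "e \<in> edges G" "e \<notin> F" and l: "l \<in> L" "e \<in> even_class l"
        using x by (auto simp: swaps_def)
      define q where "q = rep F l"
      define R where "R = F - {q}"
      have q: "q \<in> F" "q \<in> even_class l" using repD[OF F l(1)] by (auto simp: q_def)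
      have qe: "q \<noteq> e" using q e by blast
      have FR: "F = insert q R" "q \<notin> R" "e \<notin> R" using q e by (auto simp: R_def)
      have R_class: "f \<notin> even_class l" if "f \<in> R" for f
        using rep_eq[OF F l(1)] that by (auto simp: R_def q_def)
      have R_edges: "R \<subseteq> edges G" using transversal_edges[OF F] by (auto simp: R_def)
      then have finR: "finite R" using finite_edges by (rule finite_subset)
      have \<tau>_Fe: "\<tau> (F, e) = (insert e R, q)" by (simp add: \<tau>_def cls[OF l] q_def R_def)
      have F2: "insert e R \<in> transversals"
      proof -
        have "insert e R \<subseteq> core \<union> (\<Union>l\<in>L. even_class l)" "core \<subseteq> insert e R"
          using F l core_even_class[OF l(1) q(2)] FR(1) by (auto simp: transversals_def)
        moreover have "\<exists>!p. p \<in> insert e R \<and> p \<in> even_class l'" if l': "l' \<in> L" for l'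
        proof (cases "l' = l")
          case True
          then show ?thesis using l R_class by (intro ex1I[of _ e]) auto
        next
          case False
          then have "e \<notin> even_class l'" "q \<notin> even_class l'"
            using even_class_disjoint l q l' by blast+
          then have "p \<in> insert e R \<and> p \<in> even_class l' \<longleftrightarrow> p \<in> F \<and> p \<in> even_class l'" for p
            unfolding FR(1) by blast
          then show ?thesis using F l' by (simp add: transversals_def)
        qed
        ultimately show ?thesis by (simp add: transversals_def)
      qed
      have rep2: "rep (insert e R) l = e" using rep_eq[OF F2 l(1), of e] l by simp
      have "\<tau> (F, e) \<in> swaps"
        unfolding \<tau>_Fe using F2 q FR qe l transversal_edges[OF F] by (auto simp: swaps_def)
      moreover have "\<tau> (insert e R, q) = (F, e)"
        using FR qe by (auto simp: \<tau>_def cls[OF l(1) q(2)] rep2)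
      moreover have "idx q \<noteq> idx e"
        using inj_idx qe q(1) transversal_edges[OF F] e by (meson inj_onD subsetD)
      moreover have "g (insert e R, q) = - g (F, e)"
      proof -
        have "idx f < idx e \<longleftrightarrow> idx f < idx q" if "f \<in> R" for f
          using even_class_contiguous[OF l(1,2) q(2) _ R_class[OF that]] R_edges that by blast
        then have "sg idx e (insert q R) = - (sg idx q (insert e R) :: 'k)"
          by (intro sg_adjacent finR FR \<open>idx q \<noteq> idx e\<close>)
        then show ?thesis by (simp add: g_def FR(1) insert_commute)
      qed
      moreover have "pos (insert e R, q) \<longleftrightarrow> idx q < idx e" "pos (F, e) \<longleftrightarrow> idx e < idx q"
        by (simp_all add: pos_def cls[OF l] cls[OF l(1) q(2)] rep2 q_def[symmetric])
      ultimately show ?thesis unfolding \<tau>_Fe by auto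
    qed
    have key': "\<tau> x \<in> swaps \<and> \<tau> (\<tau> x) = x \<and> g (\<tau> x) = - g x \<and> (pos (\<tau> x) \<longleftrightarrow> \<not> pos x)"
      if "x \<in> swaps" for x
      using key[of "fst x" "snd x"] that by simp
    have "finite swaps"
      using finite_subset[of swaps "transversals \<times> edges G"] finite_transversals finite_edges
      by (auto simp: swaps_def)
    then show ?thesis
      by (rule sum_involution_zero[where \<tau> = \<tau> and pos = pos]) (use key' in blast)+
  qed
  finally show ?thesis .
qed

lemma cocycle_sphere_chain:
  assumes "set ls = L" "distinct ls"
  shows "cocycle (sphere_chain ls) \<noteq> (0 :: 'k::field)"
proof -
  let ?P = "\<lambda>F m. \<forall>v. vdeg (m + ind F) v = vdeg homology_deg v"
  obtain \<sigma> :: 'k where \<sigma>: "\<sigma> = 1 \<or> \<sigma> = - 1" "sphere_chain ls base_face = single (\<Sum>l\<in>L. qm l) \<sigma>"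
    using sphere_chain_value[of ls] assms unfolding base_face_eq by auto
  have "csum (?P F) (sphere_chain ls F) = (if F = base_face then \<sigma> else 0)" if F: "F \<in> transversals" for F
  proof (cases "sphere_chain ls F = (0 :: ('v set, 'k) mpoly)")
    case True
    then show ?thesis using \<sigma> by (auto dest: arg_cong[where f = "\<lambda>p. lookup p (\<Sum>l\<in>L. qm l)"])
  next
    case False
    from sphere_chain_support[OF this]
    have "F \<subseteq> all_nonfaces" "card F + card L = card all_nonfaces"
      using assms distinct_card[of ls] by auto
    then have "F = base_face"
      by (intro transversal_in_nonfaces F) (simp_all add: card_base_face card_all_nonfaces)
    then show ?thesis by (simp add: \<sigma>(2) csum_single homology_deg_def)
  qed
  then have "cocycle (sphere_chain ls) = (\<Sum>F\<in>transversals. if F = base_face then \<sigma> else 0)"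
    by (simp add: cocycle_def)
  also have "\<dots> = \<sigma>" using base_face_transversal finite_transversals by (simp add: sum.delta)
  finally show ?thesis using \<sigma>(1) by auto
qed

lemma betti_nonzero:
  assumes "L \<noteq> {}"
  shows "betti (edges G) (toric_ideal G :: ('v set, 'k::field) mpoly set)
    ((\<Sum>l\<in>L. d l) - 1) (\<Sum>l\<in>L. d l + k l) \<noteq> 0"
proof (rule betti_toric_nonzero)
  fix F assume res: "graded_free_resolution (edges G) (toric_ideal G :: ('v set, 'k) mpoly set) F"
  let ?n = "\<Sum>l\<in>L. d l" and ?j = "\<Sum>l\<in>L. d l + k l"
  define ls where "ls = sorted_list_of_set L"
  have ls: "set ls = L" "distinct ls" using finite_L by (simp_all add: ls_def)
  have len: "length ls = card L" using ls distinct_card by metis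
  show "\<exists>b<rank F (?n - 1). shift F (?n - 1) b = ?j"
  proof (rule ccontr)
    assume no: "\<not> ?thesis"
    have "\<exists>u x. (\<forall>H. u H \<in> poly_ring (edges G)) \<and> (\<forall>H. x H \<in> (toric_ideal G :: ('v set, 'k) mpoly set)) \<and>
        (\<forall>H. sphere_chain ls H = x H + contract Var u H)"
    proof (rule koszul_boundary_if_no_generator[OF res, where n = ?n and j = ?j])
      obtain l where "l \<in> L" using assms by blast
      then have "d l \<le> ?n" using finite_L by (intro member_le_sum) auto
      then show "1 \<le> ?n" using d_pos[OF \<open>l \<in> L\<close>] by simp
      fix H
      show "sphere_chain ls H \<in> poly_ring (edges G)" using ls by (intro sphere_chain_ring) auto
      show "H \<subseteq> edges G \<and> card H = ?n" if "sphere_chain ls H \<noteq> (0 :: ('v set, 'k) mpoly)"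
        using sphere_chain_support[OF that] all_nonfaces_edges len by (auto simp: card_all_nonfaces)
      have "(\<Sum>l\<leftarrow>ls. k l - 1) = (\<Sum>l\<in>L. k l - 1)" using ls by (metis sum_list_distinct_conv_sum_set)
      then have "card all_nonfaces + (\<Sum>l\<leftarrow>ls. k l - 1) = (\<Sum>l\<in>L. d l + 1 + (k l - 1))"
        by (simp add: card_all_nonfaces sum.distrib sum_Suc)
      also have "\<dots> = ?j"
      proof (intro sum.cong refl)
        fix l assume "l \<in> L"
        then show "d l + 1 + (k l - 1) = d l + k l" using k_pos[of l] by simp
      qed
      finally show "homog (card H) ?j (sphere_chain ls H :: ('v set, 'k) mpoly)"
        using sphere_chain_homog[of ls H] ls by simp
      show "contract Var (sphere_chain ls) H \<in> (toric_ideal G :: ('v set, 'k) mpoly set)"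
        using ls(1) by (rule boundary_in_toric_ideal)
    next
      fix b assume "b < rank F (?n - 1)"
      then show "shift F (?n - 1) b \<noteq> ?j" using no by blast
    qed
    then obtain u x where u: "\<And>H. u H \<in> poly_ring (edges G)"
      and x: "\<And>H. x H \<in> (toric_ideal G :: ('v set, 'k) mpoly set)"
      and eq: "\<And>H. sphere_chain ls H = x H + contract Var u H" by blast
    have "sphere_chain ls = (\<lambda>H. x H + contract Var u H)" using eq by blast
    then have "cocycle (sphere_chain ls) = (0 :: 'k)"
      using cocycle_add[of x "contract Var u"] cocycle_toric_ideal[OF x] cocycle_boundary[OF u] by simp
    then show False using cocycle_sphere_chain[OF ls] by blast
  qed
qed

end

theorem (in ear_graphs) betti_ear_nonzero:
  assumes "L \<noteq> {}"
  shows "betti (edges G) (toric_ideal G :: ('v set, 'k::field) mpoly set)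
    ((\<Sum>l\<in>L. d l) - 1) (\<Sum>l\<in>L. d l + k l) \<noteq> 0"
proof -
  define cl where "cl e = (if \<exists>l\<in>L. e \<in> even_class l then Suc (THE l. l \<in> L \<and> e \<in> even_class l) else 0)" for e
  have cl: "cl e = Suc l" if "l \<in> L" "e \<in> even_class l" for l e
  proof -
    have "(THE l. l \<in> L \<and> e \<in> even_class l) = l" using that even_class_disjoint by blast
    then show ?thesis using that by (auto simp: cl_def)
  qed
  have cl': "cl f \<noteq> Suc l" if "l \<in> L" "f \<notin> even_class l" for l f
    using cl[of _ f] that by (cases "\<exists>l\<in>L. f \<in> even_class l") (auto simp: cl_def)
  obtain idx where idx: "inj_on idx (edges G)" "\<And>e f. e \<in> edges G \<Longrightarrow> f \<in> edges G \<Longrightarrow> cl e < cl f \<Longrightarrow> idx e < (idx f :: nat)"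
    using index_refining_classes[OF finite_edges, of cl] by blast
  interpret ear_koszul G L k d c y idx
  proof
    show "finite (edges G)" by (rule finite_edges)
    show "inj_on idx (edges G)" by (rule idx(1))
    fix l q q' f assume l: "l \<in> L" and q: "q \<in> even_class l" and q': "q' \<in> even_class l"
      and f: "f \<in> edges G" "f \<notin> even_class l"
    have "idx f < idx p \<longleftrightarrow> cl f < Suc l" if "p \<in> even_class l" for p
    proof -
      have "p \<in> edges G" "cl p = Suc l" using even_class_edges l that cl by blast+
      then show ?thesis using idx(2)[of f p] idx(2)[of p f] f cl'[OF l f(2)]
        by (metis linorder_neqE_nat not_less_iff_gr_or_eq)
    qed
    then show "idx f < idx q \<longleftrightarrow> idx f < idx q'" using q q' by simp
  qed
  show ?thesis by (rule betti_nonzero[OF assms])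
qed

section \<open>The lower bounds\<close>

definition path_vertex :: "nat \<Rightarrow> nat \<Rightarrow> grd_vertex" where
  "path_vertex r j = (if j = 0 then X 1 else if j = 2 * (r - 1) then X 2 else Z j)"

lemma path_vertex_eq:
  "r \<ge> 3 \<Longrightarrow> j \<le> 2 * (r - 1) \<Longrightarrow> j' \<le> 2 * (r - 1) \<Longrightarrow> path_vertex r j = path_vertex r j' \<longleftrightarrow> j = j'"
  by (auto simp: path_vertex_def)

lemma path_vertex_neq_Y: "path_vertex r j \<noteq> Y i"
  by (auto simp: path_vertex_def)

lemma atLeastAtMost_Suc_image: "{1..d} = Suc ` {..<d}"
  by (simp add: image_Suc_lessThan)

lemma verts_grd:
  assumes "r \<ge> 3"
  shows "verts (grd r d) = path_vertex r ` {..2 * (r - 1)} \<union> (\<lambda>i. Y (Suc i)) ` {..<d}"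
proof -
  have "{..2 * (r - 1)} = insert 0 (insert (2 * (r - 1)) {1..2 * r - 3})" using assms by auto
  moreover have "path_vertex r ` {1..2 * r - 3} = Z ` {1..2 * r - 3}"
    using assms by (intro image_cong) (auto simp: path_vertex_def)
  moreover have "path_vertex r 0 = X 1" "path_vertex r (2 * (r - 1)) = X 2"
    using assms by (auto simp: path_vertex_def)
  ultimately have "path_vertex r ` {..2 * (r - 1)} = {X 1, X 2} \<union> Z ` {1..2 * r - 3}"
    by (simp only: image_insert) blast
  then show ?thesis unfolding grd_def atLeastAtMost_Suc_image[of d] by (auto simp: image_image)
qed

lemma edges_grd:
  assumes "r \<ge> 3"
  shows "edges (grd r d) = (\<lambda>j. {path_vertex r j, path_vertex r (Suc j)}) ` {..<2 * (r - 1)}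
    \<union> (\<lambda>i. {path_vertex r 0, Y (Suc i)}) ` {..<d} \<union> (\<lambda>i. {path_vertex r (2 * (r - 1)), Y (Suc i)}) ` {..<d}"
proof -
  let ?p = "\<lambda>j. {path_vertex r j, path_vertex r (Suc j)}"
  have "{..<2 * (r - 1)} = insert 0 (insert (2 * r - 3) {1..2 * r - 4})" using assms by auto
  moreover have "?p ` {1..2 * r - 4} = (\<lambda>i. {Z i, Z (i + 1)}) ` {1..2 * r - 4}"
    using assms by (intro image_cong) (auto simp: path_vertex_def)
  moreover have "?p 0 = {X 1, Z 1}" "?p (2 * r - 3) = {Z (2 * r - 3), X 2}"
    using assms by (auto simp: path_vertex_def)
  ultimately have "?p ` {..<2 * (r - 1)} =
      {{X 1, Z 1}} \<union> (\<lambda>i. {Z i, Z (i + 1)}) ` {1..2 * r - 4} \<union> {{Z (2 * r - 3), X 2}}"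
    by (simp only: image_insert) blast
  moreover have "path_vertex r 0 = X 1" "path_vertex r (2 * (r - 1)) = X 2"
    using assms by (auto simp: path_vertex_def)
  ultimately show ?thesis unfolding grd_def atLeastAtMost_Suc_image[of d] by (auto simp: image_image)
qed

theorem theorem4p1:
  fixes G :: "'v graph" and r d :: "nat \<Rightarrow> nat" and s :: nat
  assumes "finite_simple_graph G"
    and "s \<ge> 1"
    and "\<And>l. l \<in> {1..s} \<Longrightarrow> r l \<ge> 3 \<and> d l \<ge> 2"
    and "has_induced_subgraph G (disjoint_union {1..s} (\<lambda>l. grd (r l) (d l)))"
  shows "reg (edges G) (toric_ideal G :: ('v set, 'k::field) mpoly set)
           \<ge> ereal ((\<Sum>l=1..s. real (r l)) - real s + 1) \<and>
         pdim (edges G) (toric_ideal G :: ('v set, 'k::field) mpoly set)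
           \<ge> ereal ((\<Sum>l=1..s. real (d l)) - 1)"
proof -
  define L where "L = {1..s}"
  define k where "k l = r l - 1" for l
  define H where "H = disjoint_union L (\<lambda>l. grd (r l) (d l))"
  have rd: "r l \<ge> 3" "d l \<ge> 2" if "l \<in> L" for l using assms(3) that by (auto simp: L_def)
  have "has_induced_subgraph G H" using assms(4) by (simp add: H_def L_def)
  then obtain W f where W: "W \<subseteq> verts G" and f: "bij_betw f (verts H) W"
    and edges_W: "(\<lambda>e. f ` e) ` edges H = {e \<in> edges G. e \<subseteq> W}"
    unfolding has_induced_subgraph_def graph_isomorphic_def induced_on_def by auto
  define c where "c l j = f (l, path_vertex (r l) j)" for l j
  define y where "y l i = f (l, Y (Suc i))" for l i
  have inj: "f u = f v \<longleftrightarrow> u = v" if "u \<in> verts H" "v \<in> verts H" for u v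
    using f that by (auto simp: bij_betw_def inj_on_def)
  have c_vert: "(l, path_vertex (r l) j) \<in> verts H" if "l \<in> L" "j \<le> 2 * k l" for l j
    using that by (auto simp: H_def disjoint_union_def verts_grd[OF rd(1)] k_def)
  have y_vert: "(l, Y (Suc i)) \<in> verts H" if "l \<in> L" "i < d l" for l i
    using that by (auto simp: H_def disjoint_union_def verts_grd[OF rd(1)])
  have edge_image: "f ` Pair l ` e \<in> edges G" if "l \<in> L" "e \<in> edges (grd (r l) (d l))" for l e
  proof -
    have "Pair l ` e \<in> edges H" using that by (auto simp: H_def disjoint_union_def)
    then show ?thesis using edges_W by blast
  qed
  interpret ear_graphs G L k d c y
  proof
    show "finite_simple_graph G" by (rule assms(1))
    show "finite L" by (simp add: L_def)
    show "1 \<le> k l" "1 \<le> d l" if "l \<in> L" for l using rd[OF that] by (auto simp: k_def)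
    show "c l j = c l' j' \<longleftrightarrow> l = l' \<and> j = j'"
      if "l \<in> L" "l' \<in> L" "j \<le> 2 * k l" "j' \<le> 2 * k l'" for l l' j j'
      using that rd(1)[of l] by (auto simp: c_def inj c_vert path_vertex_eq k_def)
    show "y l i = y l' i' \<longleftrightarrow> l = l' \<and> i = i'"
      if "l \<in> L" "l' \<in> L" "i < d l" "i' < d l'" for l l' i i'
      using that by (auto simp: y_def inj y_vert)
    show "c l j \<noteq> y l' i" if "l \<in> L" "l' \<in> L" "j \<le> 2 * k l" "i < d l'" for l l' j i
      using that by (auto simp: c_def y_def inj c_vert y_vert path_vertex_neq_Y)
    show "{c l j, c l (Suc j)} \<in> edges G" if "l \<in> L" "j < 2 * k l" for l j
      using edge_image[of l "{path_vertex (r l) j, path_vertex (r l) (Suc j)}"] that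
      by (auto simp: edges_grd[OF rd(1)] c_def k_def)
    show "{c l 0, y l i} \<in> edges G" if "l \<in> L" "i < d l" for l i
      using edge_image[of l "{path_vertex (r l) 0, Y (Suc i)}"] that
      by (auto simp: edges_grd[OF rd(1)] c_def y_def k_def)
    show "{c l (2 * k l), y l i} \<in> edges G" if "l \<in> L" "i < d l" for l i
      using edge_image[of l "{path_vertex (r l) (2 * (r l - 1)), Y (Suc i)}"] that
      by (auto simp: edges_grd[OF rd(1)] c_def y_def k_def)
    show "\<exists>l\<in>L. (\<exists>j<2 * k l. e = {c l j, c l (Suc j)}) \<or> (\<exists>i<d l. e = {c l 0, y l i} \<or> e = {c l (2 * k l), y l i})"
      if e: "e \<in> edges G" and v: "\<And>v. v \<in> e \<Longrightarrow> \<exists>l\<in>L. (\<exists>j\<le>2 * k l. v = c l j) \<or> (\<exists>i<d l. v = y l i)" for e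
    proof -
      have "v \<in> W" if "v \<in> e" for v
      proof -
        have "\<exists>u\<in>verts H. v = f u" using v[OF that] c_vert y_vert unfolding c_def y_def by blast
        then show ?thesis using f by (auto simp: bij_betw_def)
      qed
      then have "e \<in> (\<lambda>e. f ` e) ` edges H" using e edges_W by auto
      then obtain l e' where l: "l \<in> L" "e' \<in> edges (grd (r l) (d l))" "e = f ` Pair l ` e'"
        by (auto simp: H_def disjoint_union_def)
      from l(2) show ?thesis unfolding edges_grd[OF rd(1)[OF l(1)]]
      proof (elim UnE imageE)
        fix j assume "j \<in> {..<2 * (r l - 1)}" "e' = {path_vertex (r l) j, path_vertex (r l) (Suc j)}"
        then show ?thesis using l(1,3) by (intro bexI[of _ l] disjI1 exI[of _ j]) (auto simp: c_def k_def)
      next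
        fix i assume "i \<in> {..<d l}" "e' = {path_vertex (r l) 0, Y (Suc i)}"
        then show ?thesis using l(1,3) by (intro bexI[of _ l] disjI2 exI[of _ i]) (auto simp: c_def y_def)
      next
        fix i assume "i \<in> {..<d l}" "e' = {path_vertex (r l) (2 * (r l - 1)), Y (Suc i)}"
        then show ?thesis using l(1,3) by (intro bexI[of _ l] disjI2 exI[of _ i]) (auto simp: c_def y_def k_def)
      qed
    qed
  qed
  let ?I = "toric_ideal G :: ('v set, 'k) mpoly set"
  let ?i = "(\<Sum>l\<in>L. d l) - 1" and ?j = "\<Sum>l\<in>L. d l + k l"
  have "L \<noteq> {}" using assms(2) by (simp add: L_def)
  then have betti: "betti (edges G) ?I ?i ?j \<noteq> 0" by (rule betti_ear_nonzero)
  have "1 \<in> L" using assms(2) by (simp add: L_def)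
  then have "d 1 \<le> (\<Sum>l\<in>L. d l)" using finite_L by (intro member_le_sum) auto
  then have "(\<Sum>l\<in>L. d l) \<ge> 1" using rd(2)[OF \<open>1 \<in> L\<close>] by simp
  then have i: "real ?i = (\<Sum>l\<in>L. real (d l)) - 1" by simp
  have "real ?j = (\<Sum>l\<in>L. real (d l) + (real (r l) - 1))"
    unfolding of_nat_sum
  proof (intro sum.cong refl)
    fix l assume "l \<in> L"
    then show "real (d l + k l) = real (d l) + (real (r l) - 1)"
      using rd(1)[of l] by (simp add: k_def)
  qed
  also have "\<dots> = (\<Sum>l\<in>L. real (d l)) + ((\<Sum>l\<in>L. real (r l)) - real s)"
    by (simp add: sum.distrib sum_subtractf L_def)
  finally have ji: "real ?j - real ?i = (\<Sum>l\<in>L. real (r l)) - real s + 1" using i by simp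
  have "ereal (real ?j - real ?i) \<le> reg (edges G) ?I"
    unfolding reg_def using betti by (intro Sup_upper) blast
  then have "ereal ((\<Sum>l\<in>L. real (r l)) - real s + 1) \<le> reg (edges G) ?I" by (simp only: ji)
  moreover have "ereal (real ?i) \<le> pdim (edges G) ?I"
    unfolding pdim_def using betti by (intro Sup_upper) blast
  then have "ereal ((\<Sum>l\<in>L. real (d l)) - 1) \<le> pdim (edges G) ?I" by (simp only: i)
  ultimately show ?thesis unfolding L_def by blast
qed

end
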